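(* The seminorm $L:a\in\mathcal A_\infty\mapsto L(a)=\|[D,a]\|$ is a Lip-norm in the sense of Rieffel, namely $(\mathcal A_\infty,L)$ is a quantum metric space. More precisely, the set $\mathcal L=\{a\in\mathcal A_\infty:L(a)<\infty\}$ is a dense $*$-algebra of $\mathcal A_\infty$, and $\{a\in\mathcal A_\infty:\|a\|\le1,\ L(a)\le1\}$ is relatively compact in norm.
   Context: Indices $j\in\{1,2,3\}$ are taken mod $3$. $M_3(\mathbb C)$ has matrix units $e_{ij}$, and $\mathbb C^3$ is identified with its diagonal subalgebra. $\mathrm{UHF}(3^\infty)$ is the $C^*$-inductive limit of $M_3(\mathbb C)^{\otimes n}$ under $x\mapsto x\otimes I_3$; each $M_3(\mathbb C)^{\otimes n}$ is regarded as a unital subalgebra of it. For $n\ge0$ put $\alpha^n_j=e_{jj}\otimes e_{22}^{\otimes n}\in M_3(\mathbb C)^{\otimes(n+1)}$, and for $k\ge1$ put $\beta^k_j=(e_{jj}\otimes e_{11}+e_{j+2,j+2}\otimes e_{33})\otimes e_{22}^{\otimes(k-1)}\in M_3(\mathbb C)^{\otimes(k+1)}$. The finite-dimensional $*$-algebra $\mathcal A_n\subset M_3(\mathbb C)^{\otimes n}\otimes\mathbb C^3\subset M_3(\mathbb C)^{\otimes(n+1)}$ is the linear span of the $\alpha^n_j$ and of the $x\otimes\beta^k_j$ with $j=1,2,3$, $k=1,\dots,n$, $x\in M_3(\mathbb C)^{\otimes(n-k)}$. $\mathcal A_\infty$ is the $C^*$-subalgebra of $\mathrm{UHF}(3^\infty)$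 of all norm limits $\lim_n a_n$ with $a_n\in\mathcal A_n$. The slice map $\rho_n:\mathrm{UHF}(3^\infty)\to M_3(\mathbb C)^{\otimes(n+1)}$, identity on the first $n+1$ tensor factors and applying the state $x\mapsto x_{22}$ to each of the others, restricts to a $*$-homomorphism $\rho_n:\mathcal A_\infty\to\mathcal A_n$. Let $E=\{x\in M_3(\mathbb C):x_{jj}=0,\ j=1,2,3\}$ with inner product $(x,y)=\mathrm{Tr}(x^*y)$. For $n\ge0$ let $\mathcal H_n=(\mathbb C^3)^{\otimes n}\otimes E$ (with $(\mathbb C^3)^{\otimes n}$ the Hilbert space), $F_n(x\otimes m)=x\otimes m^T$ (transpose), $D_n=2^nF_n$, and $\pi_n(a)z=\rho_n(a)z$ for $a\in\mathcal A_\infty$, $z\in\mathcal H_n$, where $M_3(\mathbb C)^{\otimes n}\otimes\mathbb C^3$ acts on $\mathcal H_n$ by $(a\otimes b)(x\otimes m)=ax\otimes bm$ (matrix acting on a vector, and matrix multiplication of the diagonal matrix $b$ with $m$). Set $\mathcal H=\bigoplus_n\mathcal H_n$, $D=\bigoplus_nD_n$, $\pi=\bigoplus_n\pi_n$; $[D,a]$ means $[D,\pi(a)]$, so $L(a)=\sup_n\|[D_n,\pi_n(a)]\|\in[0,\infty]$. A Lip-norm (Rieffel) on a unital $C^*$-algebra is a seminorm, finite on a dense subspace, vanishing exactly on the scalars, such that the metric $(\phi,\psi)\mapsto\sup\{|\phi(a)-\psi(a)|:a=a^*,\ L(a)\le1\}$ on the state space induces the weak-$*$ topology. *)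

theory Defs
  imports "HOL-Analysis.Analysis" "HOL-Library.Function_Algebras"
begin

section \<open>Unital C*-algebras and Lip-norms\<close>

class unital_cstar_algebra = real_normed_algebra_1 + complete_space +
  fixes scaleC :: "complex \<Rightarrow> 'a \<Rightarrow> 'a" (infixr "*\<^sub>C" 75)
    and star :: "'a \<Rightarrow> 'a"
  assumes scaleC_add_right: "c *\<^sub>C (x + y) = c *\<^sub>C x + c *\<^sub>C y"
    and scaleC_add_left: "(c + d) *\<^sub>C x = c *\<^sub>C x + d *\<^sub>C x"
    and scaleC_scaleC: "c *\<^sub>C d *\<^sub>C x = (c * d) *\<^sub>C x"
    and scaleR_scaleC: "r *\<^sub>R x = complex_of_real r *\<^sub>C x"
    and mult_scaleC_left: "(c *\<^sub>C x) * y = c *\<^sub>C (x * y)"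
    and mult_scaleC_right: "x * (c *\<^sub>C y) = c *\<^sub>C (x * y)"
    and norm_scaleC: "norm (c *\<^sub>C x) = cmod c * norm x"
    and star_add: "star (x + y) = star x + star y"
    and star_scaleC: "star (c *\<^sub>C x) = cnj c *\<^sub>C star x"
    and star_mult: "star (x * y) = star y * star x"
    and star_star: "star (star x) = x"
    and cstar_identity: "norm (star x * x) = (norm x)\<^sup>2"

definition star_subalgebra :: "'a::unital_cstar_algebra set \<Rightarrow> bool" where
  "star_subalgebra A \<longleftrightarrow> 0 \<in> A \<and>
     (\<forall>a\<in>A. \<forall>b\<in>A. a + b \<in> A) \<and> (\<forall>c. \<forall>a\<in>A. c *\<^sub>C a \<in> A) \<and>
     (\<forall>a\<in>A. \<forall>b\<in>A. a * b \<in> A) \<and> (\<forall>a\<in>A. star a \<in> A)"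

definition unital_cstar_subalgebra :: "'a::unital_cstar_algebra set \<Rightarrow> bool" where
  "unital_cstar_subalgebra A \<longleftrightarrow> star_subalgebra A \<and> 1 \<in> A \<and> closed A"

text \<open>Functionals on a subset \<open>A\<close> of the ambient algebra are taken extensional, so that equality of
  states is equality on \<open>A\<close> and the product topology over \<open>A\<close> is pointwise convergence.\<close>

definition states :: "'a::unital_cstar_algebra set \<Rightarrow> ('a \<Rightarrow> complex) set" where
  "states A = {\<phi> \<in> extensional A.
     (\<forall>a\<in>A. \<forall>b\<in>A. \<phi> (a + b) = \<phi> a + \<phi> b) \<and> (\<forall>c. \<forall>a\<in>A. \<phi> (c *\<^sub>C a) = c * \<phi> a) \<and>
     (\<forall>a\<in>A. \<phi> (star a * a) \<in> \<real>\<^sub>\<ge>\<^sub>0) \<and> \<phi> 1 = 1}"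

definition weak_star :: "'a::unital_cstar_algebra set \<Rightarrow> ('a \<Rightarrow> complex) topology" where
  "weak_star A = subtopology (product_topology (\<lambda>_. euclidean) A) (states A)"

definition seminorm_on :: "'a::unital_cstar_algebra set \<Rightarrow> ('a \<Rightarrow> ennreal) \<Rightarrow> bool" where
  "seminorm_on A L \<longleftrightarrow> (\<forall>a\<in>A. \<forall>b\<in>A. L (a + b) \<le> L a + L b) \<and>
     (\<forall>c. \<forall>a\<in>A. L (c *\<^sub>C a) = ennreal (cmod c) * L a)"

definition lip_dist ::
    "'a::unital_cstar_algebra set \<Rightarrow> ('a \<Rightarrow> ennreal) \<Rightarrow> ('a \<Rightarrow> complex) \<Rightarrow> ('a \<Rightarrow> complex) \<Rightarrow> ennreal" where
  "lip_dist A L \<phi> \<psi> = (SUP a\<in>{a \<in> A. star a = a \<and> L a \<le> 1}. ennreal (cmod (\<phi> a - \<psi> a)))"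

text \<open>The supremum defining the metric is formed in \<open>[0,\<infinity>]\<close>; its finiteness is part of the
  definition, as otherwise \<open>enn2real\<close> would not return the intended distance.\<close>

definition lip_norm :: "'a::unital_cstar_algebra set \<Rightarrow> ('a \<Rightarrow> ennreal) \<Rightarrow> bool" where
  "lip_norm A L \<longleftrightarrow> seminorm_on A L \<and>
     A \<subseteq> closure {a \<in> A. L a < \<infinity>} \<and>
     (\<forall>a\<in>A. L a = 0 \<longleftrightarrow> (\<exists>c. a = c *\<^sub>C 1)) \<and>
     (\<forall>\<phi>\<in>states A. \<forall>\<psi>\<in>states A. lip_dist A L \<phi> \<psi> < \<infinity>) \<and>
     Metric_space (states A) (\<lambda>\<phi> \<psi>. enn2real (lip_dist A L \<phi> \<psi>)) \<and>
     Metric_space.mtopology (states A) (\<lambda>\<phi> \<psi>. enn2real (lip_dist A L \<phi> \<psi>)) = weak_star A"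

definition quantum_metric_space :: "'a::unital_cstar_algebra set \<Rightarrow> ('a \<Rightarrow> ennreal) \<Rightarrow> bool" where
  "quantum_metric_space A L \<longleftrightarrow> unital_cstar_subalgebra A \<and> lip_norm A L"

section \<open>Tensor powers of the 3 by 3 matrices\<close>

text \<open>Indices live in the type \<open>3\<close> of integers modulo 3, in which the index 3 is the numeral
  \<open>3 = 0\<close> and \<open>j + 2\<close> is taken modulo 3. The standard basis of the \<open>n\<close>-fold tensor power of
  \<open>\<complex>\<^sup>3\<close> is indexed by words of length \<open>n\<close>, and \<open>M3 n\<close> is the \<open>n\<close>-fold tensor power of the
  algebra of 3 by 3 matrices: matrices over words, vanishing off the words of length \<open>n\<close>.
  In particular \<open>M3 1\<close> is the matrix algebra itself. The algebra structure is that of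
  \<open>mmul n\<close>, \<open>madj\<close>, \<open>mone n\<close>; the pointwise multiplication of functions is never used.\<close>

definition words :: "nat \<Rightarrow> 3 list set" where
  "words n = {w. length w = n}"

type_synonym cmat = "3 list \<Rightarrow> 3 list \<Rightarrow> complex"

definition M3 :: "nat \<Rightarrow> cmat set" where
  "M3 n = {x. \<forall>v w. x v w \<noteq> 0 \<longrightarrow> v \<in> words n \<and> w \<in> words n}"

definition mscale :: "complex \<Rightarrow> cmat \<Rightarrow> cmat" where
  "mscale c x = (\<lambda>v w. c * x v w)"

definition mmul :: "nat \<Rightarrow> cmat \<Rightarrow> cmat \<Rightarrow> cmat" where
  "mmul n x y = (\<lambda>v w. \<Sum>u\<in>words n. x v u * y u w)"

definition madj :: "cmat \<Rightarrow> cmat" where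
  "madj x = (\<lambda>v w. cnj (x w v))"

definition mone :: "nat \<Rightarrow> cmat" where
  "mone n = (\<lambda>v w. if v \<in> words n \<and> v = w then 1 else 0)"

definition mapv :: "nat \<Rightarrow> cmat \<Rightarrow> (3 list \<Rightarrow> complex) \<Rightarrow> 3 list \<Rightarrow> complex" where
  "mapv n x z = (\<lambda>v. \<Sum>w\<in>words n. x v w * z w)"

definition vnorm :: "nat \<Rightarrow> (3 list \<Rightarrow> complex) \<Rightarrow> real" where
  "vnorm n z = sqrt (\<Sum>w\<in>words n. (cmod (z w))\<^sup>2)"

definition mnorm :: "nat \<Rightarrow> cmat \<Rightarrow> real" where
  "mnorm n x = (SUP z\<in>{z. vnorm n z \<le> 1}. vnorm n (mapv n x z))"

text \<open>\<open>tens m x y\<close> is the tensor product of \<open>x \<in> M3 m\<close> with \<open>y \<in> M3 n\<close>, an element of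
  \<open>M3 (m + n)\<close>; \<open>amp n k\<close> is the connecting map from \<open>M3 n\<close> to \<open>M3 (n + k)\<close>, tensoring with the unit.\<close>

definition tens :: "nat \<Rightarrow> cmat \<Rightarrow> cmat \<Rightarrow> cmat" where
  "tens m x y = (\<lambda>v w. x (take m v) (take m w) * y (drop m v) (drop m w))"

definition amp :: "nat \<Rightarrow> nat \<Rightarrow> cmat \<Rightarrow> cmat" where
  "amp n k x = tens n x (mone k)"

lemma finite_words [simp]: "finite (words n)"
  using finite_lists_length_eq[of "UNIV :: 3 set" n] by (simp add: words_def)

lemma words_ne [simp]: "words n \<noteq> {}"
  by (auto simp: words_def intro: exI[of _ "replicate n 0"])

lemma sum_words_add: "(\<Sum>w\<in>words (n + k). f w) = (\<Sum>v\<in>words n. \<Sum>u\<in>words k. f (v @ u))"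
proof -
  have "(\<Sum>w\<in>words (n + k). f w) = (\<Sum>(v, u)\<in>words n \<times> words k. f (v @ u))"
    by (rule sum.reindex_bij_witness[of _ "\<lambda>(v, u). v @ u" "\<lambda>w. (take n w, drop n w)"])
       (simp_all add: words_def case_prod_unfold mem_Times_iff)
  then show ?thesis by (simp add: sum.cartesian_product)
qed

lemma words_addE:
  assumes "w \<in> words (n + k)"
  obtains v u where "w = v @ u" "v \<in> words n" "u \<in> words k"
  using assms by (intro that[of "take n w" "drop n w"]) (auto simp: words_def)

lemma M_outside: "x \<in> M3 n \<Longrightarrow> v \<notin> words n \<or> w \<notin> words n \<Longrightarrow> x v w = 0"
  unfolding M3_def by blast

lemma M_eqI:
  assumes "x \<in> M3 n" "y \<in> M3 n" "\<And>v w. v \<in> words n \<Longrightarrow> w \<in> words n \<Longrightarrow> x v w = y v w"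
  shows "x = y"
proof (intro ext)
  fix v w show "x v w = y v w"
    using assms(3) M_outside[OF assms(1)] M_outside[OF assms(2)] by metis
qed

lemma M_0 [simp]: "0 \<in> M3 n"
  and M_add [simp]: "x \<in> M3 n \<Longrightarrow> y \<in> M3 n \<Longrightarrow> x + y \<in> M3 n"
  and M_diff [simp]: "x \<in> M3 n \<Longrightarrow> y \<in> M3 n \<Longrightarrow> x - y \<in> M3 n"
  and M_uminus [simp]: "x \<in> M3 n \<Longrightarrow> - x \<in> M3 n"
  and M_scale [simp]: "x \<in> M3 n \<Longrightarrow> mscale c x \<in> M3 n"
  and M_adj [simp]: "x \<in> M3 n \<Longrightarrow> madj x \<in> M3 n"
  and M_one [simp]: "mone n \<in> M3 n"
  by (auto simp: M3_def mscale_def madj_def mone_def fun_Compl_def split: if_splits, 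
      (metis add_0 diff_0_right diff_self)+)

lemma M_I: "(\<And>v w. v \<notin> words n \<or> w \<notin> words n \<Longrightarrow> x v w = 0) \<Longrightarrow> x \<in> M3 n"
  unfolding M3_def by blast

lemma M_mul [simp]: "x \<in> M3 n \<Longrightarrow> y \<in> M3 n \<Longrightarrow> mmul n x y \<in> M3 n"
  using M_outside[of x n] M_outside[of y n] by (intro M_I) (auto simp: mmul_def)

lemma M_amp [simp]:
  assumes "x \<in> M3 n"
  shows "amp n k x \<in> M3 (n + k)"
proof (rule M_I, rule ccontr)
  fix v w assume vw: "v \<notin> words (n + k) \<or> w \<notin> words (n + k)" and "amp n k x v w \<noteq> 0"
  then have *: "x (take n v) (take n w) \<noteq> 0" "drop n v \<in> words k" "drop n v = drop n w"
    by (auto simp: amp_def tens_def mone_def split: if_splits)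
  then have "take n v \<in> words n" "take n w \<in> words n"
    using M_outside[OF assms] by metis+
  with * have "length v = n + k" "length w = n + k"
    using append_take_drop_id[of n v] append_take_drop_id[of n w]
    by (metis (mono_tags) length_append mem_Collect_eq words_def)+
  then show False using vw by (simp add: words_def)
qed

lemma mmul_assoc: "mmul n (mmul n x y) z = mmul n x (mmul n y z)"
  unfolding mmul_def
  by (intro ext, simp add: sum_distrib_left sum_distrib_right mult.assoc, rule sum.swap)

lemma if_mult_simps: "(if b then 1 else 0) * z = (if b then z else (0::complex))"
  "z * (if b then 1 else 0) = (if b then z else 0)"
  by simp_all

lemma mmul_one_left:
  assumes "x \<in> M3 n"
  shows "mmul n (mone n) x = x"
proof (rule M_eqI[OF _ assms])
  fix v w assume "v \<in> words n"
  then show "mmul n (mone n) x v w = x v w"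
    by (simp add: mmul_def mone_def if_mult_simps)
qed (use assms in simp)

lemma mmul_one_right:
  assumes "x \<in> M3 n"
  shows "mmul n x (mone n) = x"
proof (rule M_eqI[OF _ assms])
  fix v w assume "w \<in> words n"
  moreover have "(\<Sum>u\<in>words n. x v u * mone n u w) = (\<Sum>u\<in>words n. if u = w then x v u else 0)"
    by (rule sum.cong) (auto simp: mone_def)
  ultimately show "mmul n x (mone n) v w = x v w"
    by (simp add: mmul_def)
qed (use assms in simp)

lemma mmul_add_left: "mmul n (x + y) z = mmul n x z + mmul n y z"
  and mmul_add_right: "mmul n z (x + y) = mmul n z x + mmul n z y"
  and mmul_diff_left: "mmul n (x - y) z = mmul n x z - mmul n y z"
  and mmul_diff_right: "mmul n z (x - y) = mmul n z x - mmul n z y"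
  and mmul_scale_left: "mmul n (mscale c x) z = mscale c (mmul n x z)"
  and mmul_scale_right: "mmul n z (mscale c x) = mscale c (mmul n z x)"
  and madj_mul: "madj (mmul n x y) = mmul n (madj y) (madj x)"
  by (auto simp: mmul_def mscale_def madj_def fun_eq_iff algebra_simps sum.distrib sum_subtractf
      sum_distrib_left)

lemma madj_add: "madj (x + y) = madj x + madj y"
  and madj_diff: "madj (x - y) = madj x - madj y"
  and madj_scale: "madj (mscale c x) = mscale (cnj c) (madj x)"
  and madj_madj [simp]: "madj (madj x) = x"
  by (auto simp: madj_def mscale_def fun_eq_iff)

lemma mscale_simps: 
  "mscale c (x + y) = mscale c x + mscale c y"
  "mscale c (x - y) = mscale c x - mscale c y"
  "mscale (c + d) x = mscale c x + mscale d x"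
  "mscale c (mscale d x) = mscale (c * d) x"
  "mscale 1 x = x" 
  by (auto simp: mscale_def fun_eq_iff algebra_simps)

lemma mscale_minus1: "mscale (- 1) x = - x"
  by (auto simp: mscale_def fun_eq_iff)

lemma vnorm_L2: "vnorm n z = L2_set (\<lambda>w. cmod (z w)) (words n)"
  by (simp add: vnorm_def L2_set_def)

lemma vnorm_ge0 [simp]: "0 \<le> vnorm n z"
  by (simp add: vnorm_L2)

lemma vnorm_sq: "(vnorm n z)\<^sup>2 = (\<Sum>w\<in>words n. (cmod (z w))\<^sup>2)"
  by (simp add: vnorm_def sum_nonneg)

lemma vnorm_triangle: "vnorm n (\<lambda>w. y w + z w) \<le> vnorm n y + vnorm n z"
  unfolding vnorm_L2
  by (rule order_trans[OF L2_set_mono L2_set_triangle_ineq]) (auto intro: norm_triangle_ineq)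

lemma vnorm_scale: "vnorm n (\<lambda>w. c * z w) = cmod c * vnorm n z"
  by (simp add: vnorm_L2 norm_mult L2_set_right_distrib)

lemma vnorm_cong: "(\<And>w. w \<in> words n \<Longrightarrow> y w = z w) \<Longrightarrow> vnorm n y = vnorm n z"
  by (simp add: vnorm_def)

lemma cmod_le_vnorm: "w \<in> words n \<Longrightarrow> cmod (z w) \<le> vnorm n z"
  unfolding vnorm_L2 by (rule member_le_L2_set) auto

lemma vnorm_mapv_bound:
  "vnorm n (mapv n x z) \<le> (\<Sum>v\<in>words n. \<Sum>w\<in>words n. cmod (x v w)) * vnorm n z"
proof -
  have "vnorm n (mapv n x z) \<le> (\<Sum>v\<in>words n. cmod (mapv n x z v))"
    unfolding vnorm_L2 by (rule L2_set_le_sum) auto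
  also have "\<dots> \<le> (\<Sum>v\<in>words n. (\<Sum>w\<in>words n. cmod (x v w)) * vnorm n z)"
  proof (rule sum_mono)
    fix v
    have "cmod (mapv n x z v) \<le> (\<Sum>w\<in>words n. cmod (x v w * z w))"
      unfolding mapv_def by (rule norm_sum)
    also have "\<dots> \<le> (\<Sum>w\<in>words n. cmod (x v w) * vnorm n z)"
      by (intro sum_mono) (auto simp: norm_mult intro!: mult_left_mono cmod_le_vnorm)
    finally show "cmod (mapv n x z v) \<le> (\<Sum>w\<in>words n. cmod (x v w)) * vnorm n z"
      by (simp add: sum_distrib_right)
  qed
  finally show ?thesis by (simp add: sum_distrib_right)
qed

lemma mnorm_bdd: "bdd_above ((\<lambda>z. vnorm n (mapv n x z)) ` {z. vnorm n z \<le> 1})"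
proof (rule bdd_aboveI2)
  fix z assume "z \<in> {z. vnorm n z \<le> 1}"
  then have "(\<Sum>v\<in>words n. \<Sum>w\<in>words n. cmod (x v w)) * vnorm n z
    \<le> (\<Sum>v\<in>words n. \<Sum>w\<in>words n. cmod (x v w)) * 1"
    by (intro mult_left_mono) (auto intro!: sum_nonneg)
  then show "vnorm n (mapv n x z) \<le> (\<Sum>v\<in>words n. \<Sum>w\<in>words n. cmod (x v w))"
    using vnorm_mapv_bound[of n x z] by simp
qed

lemma mapv_scale: "mapv n x (\<lambda>w. c * z w) = (\<lambda>v. c * mapv n x z v)"
  by (simp add: mapv_def sum_distrib_left mult_ac)

lemma vnorm_mapv: "vnorm n (mapv n x z) \<le> mnorm n x * vnorm n z"
proof (cases "vnorm n z = 0")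
  case True
  then show ?thesis using vnorm_mapv_bound[of n x z] by simp
next
  case False
  let ?c = "complex_of_real (inverse (vnorm n z))"
  have "vnorm n (\<lambda>w. ?c * z w) \<le> 1"
    using False by (subst vnorm_scale) (auto simp: norm_inverse)
  then have "vnorm n (mapv n x (\<lambda>w. ?c * z w)) \<le> mnorm n x"
    unfolding mnorm_def by (intro cSUP_upper mnorm_bdd) auto
  then have "inverse (vnorm n z) * vnorm n (mapv n x z) \<le> mnorm n x"
    unfolding mapv_scale vnorm_scale by (simp add: norm_inverse)
  then show ?thesis using False vnorm_ge0[of n z] by (simp add: field_simps)
qed

lemma mnorm_least:
  assumes "0 \<le> c" "\<And>z. vnorm n (mapv n x z) \<le> c * vnorm n z"
  shows "mnorm n x \<le> c"
  unfolding mnorm_def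
proof (rule cSUP_least)
  show "{z. vnorm n z \<le> 1} \<noteq> {}"
    by (auto intro!: exI[of _ "\<lambda>_. 0"] simp: vnorm_def)
  fix z assume "z \<in> {z. vnorm n z \<le> 1}"
  then have "c * vnorm n z \<le> c" using assms(1) by (simp add: mult_left_le)
  then show "vnorm n (mapv n x z) \<le> c" using assms(2)[of z] by linarith
qed

lemma mnorm_entry:
  assumes "v \<in> words n" "w \<in> words n"
  shows "cmod (x v w) \<le> mnorm n x"
proof -
  let ?z = "\<lambda>u. if u = w then 1 else (0::complex)"
  have 1: "mapv n x ?z = (\<lambda>v. x v w)"
    using assms(2) by (simp add: mapv_def if_distrib cong: if_cong)
  have 2: "vnorm n ?z = 1"
    using assms(2) by (simp add: vnorm_def if_distrib[of cmod] if_distrib[of "\<lambda>x. x ^ 2"] cong: if_cong)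
  show ?thesis
    using vnorm_mapv[of n x ?z] cmod_le_vnorm[OF assms(1), of "\<lambda>v. x v w"] unfolding 1 2 by simp
qed

lemma mnorm_ge0 [simp]: "0 \<le> mnorm n x"
proof -
  obtain v where "v \<in> words n" using words_ne by blast
  then show ?thesis by (intro order_trans[OF norm_ge_zero mnorm_entry])
qed

lemma mnorm_triangle: "mnorm n (x + y) \<le> mnorm n x + mnorm n y"
proof (rule mnorm_least)
  fix z
  have "vnorm n (mapv n (x + y) z) = vnorm n (\<lambda>v. mapv n x z v + mapv n y z v)"
    by (simp add: mapv_def distrib_right sum.distrib)
  also have "\<dots> \<le> mnorm n x * vnorm n z + mnorm n y * vnorm n z"
    by (rule order_trans[OF vnorm_triangle add_mono[OF vnorm_mapv vnorm_mapv]])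
  finally show "vnorm n (mapv n (x + y) z) \<le> (mnorm n x + mnorm n y) * vnorm n z"
    by (simp add: distrib_right)
qed simp

lemma mnorm_scale_le: "mnorm n (mscale c x) \<le> cmod c * mnorm n x"
proof (rule mnorm_least)
  fix z
  have "mapv n (mscale c x) z = (\<lambda>v. c * mapv n x z v)"
    by (simp add: mapv_def mscale_def sum_distrib_left mult_ac)
  then show "vnorm n (mapv n (mscale c x) z) \<le> cmod c * mnorm n x * vnorm n z"
    using vnorm_mapv[of n x z] by (simp add: vnorm_scale mult.assoc mult_left_mono)
qed simp

lemma mnorm_scale: "mnorm n (mscale c x) = cmod c * mnorm n x"
proof (cases "c = 0")
  case True
  then show ?thesis using mnorm_scale_le[of n c x] by (simp add: antisym)
next
  case False
  have "mnorm n x \<le> inverse (cmod c) * mnorm n (mscale c x)"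
    using mnorm_scale_le[of n "inverse c" "mscale c x"] False by (simp add: mscale_simps norm_inverse)
  then have "cmod c * mnorm n x \<le> mnorm n (mscale c x)" using False by (simp add: field_simps)
  then show ?thesis using mnorm_scale_le[of n c x] by linarith
qed

lemma mnorm_uminus [simp]: "mnorm n (- x) = mnorm n x"
  using mnorm_scale[of n "-1" x] by (simp add: mscale_minus1)

lemma mnorm_0 [simp]: "mnorm n 0 = 0"
  using mnorm_scale[of n 0 0] by (simp add: mscale_def zero_fun_def)

lemma mnorm_minus_commute: "mnorm n (x - y) = mnorm n (y - x)"
  using mnorm_uminus[of n "x - y"] by simp

lemma mnorm_diff_triangle: "mnorm n (x - z) \<le> mnorm n (x - y) + mnorm n (y - z)"
  using mnorm_triangle[of n "x - y" "y - z"] by simp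

lemma mnorm_abs_diff: "\<bar>mnorm n x - mnorm n y\<bar> \<le> mnorm n (x - y)"
  using mnorm_triangle[of n "x - y" y] mnorm_triangle[of n "y - x" x] mnorm_minus_commute[of n x y]
  by simp

lemma mapv_mul: "mapv n (mmul n x y) z = mapv n x (mapv n y z)"
  unfolding mapv_def mmul_def
  by (intro ext, simp add: sum_distrib_left sum_distrib_right mult.assoc, rule sum.swap)

lemma mnorm_mul: "mnorm n (mmul n x y) \<le> mnorm n x * mnorm n y"
proof (rule mnorm_least)
  fix z
  have "vnorm n (mapv n x (mapv n y z)) \<le> mnorm n x * vnorm n (mapv n y z)"
    by (rule vnorm_mapv)
  also have "\<dots> \<le> mnorm n x * (mnorm n y * vnorm n z)"
    by (intro mult_left_mono vnorm_mapv) simp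
  finally show "vnorm n (mapv n (mmul n x y) z) \<le> mnorm n x * mnorm n y * vnorm n z"
    by (simp add: mapv_mul mult.assoc)
qed simp

lemma mnorm_sq_le: "(mnorm n x)\<^sup>2 \<le> mnorm n (mmul n (madj x) x)"
proof -
  let ?y = "mmul n (madj x) x"
  have "mnorm n x \<le> sqrt (mnorm n ?y)"
  proof (rule mnorm_least)
    fix z
    have "complex_of_real ((vnorm n (mapv n x z))\<^sup>2)
        = (\<Sum>v\<in>words n. cnj (mapv n x z v) * mapv n x z v)"
      unfolding vnorm_sq of_real_sum by (simp only: complex_norm_square mult.commute)
    also have "\<dots> = (\<Sum>v\<in>words n. \<Sum>u\<in>words n. \<Sum>w\<in>words n. cnj (z u) * (cnj (x v u) * x v w * z w))"
      by (simp add: mapv_def sum_product) (simp add: mult_ac)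
    also have "\<dots> = (\<Sum>u\<in>words n. \<Sum>v\<in>words n. \<Sum>w\<in>words n. cnj (z u) * (cnj (x v u) * x v w * z w))"
      by (rule sum.swap)
    also have "\<dots> = (\<Sum>u\<in>words n. \<Sum>w\<in>words n. \<Sum>v\<in>words n. cnj (z u) * (cnj (x v u) * x v w * z w))"
      by (rule sum.cong[OF refl], rule sum.swap)
    also have "\<dots> = (\<Sum>u\<in>words n. cnj (z u) * mapv n ?y z u)"
      by (simp add: mapv_def mmul_def madj_def sum_distrib_left sum_distrib_right mult.assoc)
    finally have "(vnorm n (mapv n x z))\<^sup>2 \<le> cmod (\<Sum>u\<in>words n. cnj (z u) * mapv n ?y z u)"
      by (metis norm_of_real abs_ge_self)
    also have "\<dots> \<le> (\<Sum>u\<in>words n. \<bar>cmod (z u)\<bar> * \<bar>cmod (mapv n ?y z u)\<bar>)"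
      by (rule order_trans[OF norm_sum]) (simp add: norm_mult)
    also have "\<dots> \<le> vnorm n z * vnorm n (mapv n ?y z)"
      unfolding vnorm_L2 by (rule L2_set_mult_ineq)
    also have "\<dots> \<le> vnorm n z * (mnorm n ?y * vnorm n z)"
      by (intro mult_left_mono vnorm_mapv) simp
    also have "\<dots> = (sqrt (mnorm n ?y) * vnorm n z)\<^sup>2"
      by (simp add: power_mult_distrib power2_eq_square[of "vnorm n z"])
    finally show "vnorm n (mapv n x z) \<le> sqrt (mnorm n ?y) * vnorm n z"
      by (rule power2_le_imp_le) simp
  qed simp
  then have "(mnorm n x)\<^sup>2 \<le> (sqrt (mnorm n ?y))\<^sup>2" by (intro power_mono) simp_all
  then show ?thesis by simp
qed

lemma mnorm_adj: "mnorm n (madj x) = mnorm n x"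
proof -
  have *: "mnorm n x \<le> mnorm n (madj x)" for x
  proof -
    have "mnorm n x * mnorm n x \<le> mnorm n (madj x) * mnorm n x"
      using mnorm_sq_le[of n x] mnorm_mul[of n "madj x" x] by (simp add: power2_eq_square)
    then show ?thesis
      using mnorm_ge0[of n x] mnorm_ge0[of n "madj x"] 
      by (cases "mnorm n x = 0") (auto simp: mult_le_cancel_right)
  qed
  show ?thesis using *[of x] *[of "madj x"] by simp
qed

lemma mnorm_cstar: "mnorm n (mmul n (madj x) x) = (mnorm n x)\<^sup>2"
  using mnorm_sq_le[of n x] mnorm_mul[of n "madj x" x] by (simp add: mnorm_adj power2_eq_square)

lemma mnorm_one: "mnorm n (mone n) = 1"
proof (rule antisym)
  show "mnorm n (mone n) \<le> 1"
  proof (rule mnorm_least)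
    fix z
    have "vnorm n (mapv n (mone n) z) = vnorm n z"
      by (rule vnorm_cong) (simp add: mapv_def mone_def if_mult_simps)
    then show "vnorm n (mapv n (mone n) z) \<le> 1 * vnorm n z" by simp
  qed simp
  obtain v where "v \<in> words n" using words_ne by blast
  then show "1 \<le> mnorm n (mone n)"
    using mnorm_entry[of v n v "mone n"] by (simp add: mone_def)
qed

lemma amp_append: 
  "v \<in> words n \<Longrightarrow> w \<in> words n \<Longrightarrow> u \<in> words k \<Longrightarrow> s \<in> words k \<Longrightarrow>
   amp n k x (v @ u) (w @ s) = (if u = s then x v w else 0)"
  by (auto simp: amp_def tens_def mone_def words_def)

lemma amp_add: "amp n k (x + y) = amp n k x + amp n k y"
  and amp_diff: "amp n k (x - y) = amp n k x - amp n k y"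
  and amp_scale: "amp n k (mscale c x) = mscale c (amp n k x)"
  and amp_0 [simp]: "amp n k 0 = 0"
  and amp_adj: "amp n k (madj x) = madj (amp n k x)"
  by (auto simp: amp_def tens_def mscale_def madj_def mone_def fun_eq_iff algebra_simps)

lemma amp_mul:
  assumes "x \<in> M3 n" "y \<in> M3 n"
  shows "amp n k (mmul n x y) = mmul (n + k) (amp n k x) (amp n k y)"
proof (rule M_eqI[of _ "n + k"])
  fix v w assume "v \<in> words (n + k)" "w \<in> words (n + k)"
  then obtain v1 v2 w1 w2 where *: "v = v1 @ v2" "v1 \<in> words n" "v2 \<in> words k"
    "w = w1 @ w2" "w1 \<in> words n" "w2 \<in> words k"
    by (meson words_addE)
  have "mmul (n + k) (amp n k x) (amp n k y) v w
     = (\<Sum>u1\<in>words n. \<Sum>u2\<in>words k. if v2 = u2 then (if u2 = w2 then x v1 u1 * y u1 w1 else 0) else 0)"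
    unfolding mmul_def sum_words_add by (intro sum.cong refl) (auto simp: amp_append *)
  also have "\<dots> = amp n k (mmul n x y) v w"
    using * by (simp add: amp_append mmul_def)
  finally show "amp n k (mmul n x y) v w = mmul (n + k) (amp n k x) (amp n k y) v w" by simp
qed (use assms in simp_all)

lemma amp_one: "amp n k (mone n) = mone (n + k)"
proof (rule M_eqI[of _ "n + k"])
  fix v w assume vw: "v \<in> words (n + k)" "w \<in> words (n + k)"
  then obtain v1 v2 w1 w2 where *: "v = v1 @ v2" "v1 \<in> words n" "v2 \<in> words k"
    "w = w1 @ w2" "w1 \<in> words n" "w2 \<in> words k"
    by (meson words_addE)
  then show "amp n k (mone n) v w = mone (n + k) v w"
    using vw by (auto simp: amp_append) (auto simp: mone_def words_def)
qed simp_all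

lemma amp_amp:
  assumes "x \<in> M3 n"
  shows "amp (n + k) l (amp n k x) = amp n (k + l) x"
proof (rule M_eqI[of _ "n + (k + l)"])
  fix v w assume "v \<in> words (n + (k + l))" "w \<in> words (n + (k + l))"
  then obtain v1 v2 v3 w1 w2 w3 where *: "v = v1 @ v2 @ v3" "v1 \<in> words n" "v2 \<in> words k" "v3 \<in> words l"
    "w = w1 @ w2 @ w3" "w1 \<in> words n" "w2 \<in> words k" "w3 \<in> words l"
    by (metis words_addE)
  then have "amp (n + k) l (amp n k x) ((v1 @ v2) @ v3) ((w1 @ w2) @ w3)
      = (if v3 = w3 then if v2 = w2 then x v1 w1 else 0 else 0)"
    by (subst amp_append) (auto simp: amp_append words_def)
  moreover have "amp n (k + l) x (v1 @ (v2 @ v3)) (w1 @ (w2 @ w3))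
      = (if v2 @ v3 = w2 @ w3 then x v1 w1 else 0)"
    using * by (subst amp_append) (auto simp: words_def)
  ultimately show "amp (n + k) l (amp n k x) v w = amp n (k + l) x v w"
    using * by (auto simp: words_def)
qed (use assms M_amp[of "amp n k x" "n + k" l] in \<open>simp_all add: add.assoc\<close>)

lemma amp_amp':
  assumes "x \<in> M3 n" "m = n + k"
  shows "amp m l (amp n k x) = amp n (k + l) x"
  using amp_amp assms by simp

lemma amp_0_id:
  assumes "x \<in> M3 n"
  shows "amp n 0 x = x"
proof (rule M_eqI[of _ n])
  fix v w assume "v \<in> words n" "w \<in> words n"
  then show "amp n 0 x v w = x v w" using amp_append[of v n w "[]" 0 "[]" x] by (simp add: words_def)
qed (use assms M_amp[of x n 0] in simp_all)

lemma mapv_amp: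
  assumes "v \<in> words n" "u \<in> words k"
  shows "mapv (n + k) (amp n k x) z (v @ u) = mapv n x (\<lambda>w. z (w @ u)) v"
proof -
  have "mapv (n + k) (amp n k x) z (v @ u)
      = (\<Sum>w\<in>words n. \<Sum>s\<in>words k. if u = s then x v w * z (w @ s) else 0)"
    unfolding mapv_def sum_words_add using assms by (intro sum.cong refl) (auto simp: amp_append)
  then show ?thesis using assms by (simp add: mapv_def)
qed

lemma vnorm_add_sq: "(vnorm (n + k) z)\<^sup>2 = (\<Sum>u\<in>words k. (vnorm n (\<lambda>w. z (w @ u)))\<^sup>2)"
  unfolding vnorm_sq sum_words_add by (rule sum.swap)

lemma mnorm_amp: "mnorm (n + k) (amp n k x) = mnorm n x"
proof (rule antisym)
  show "mnorm (n + k) (amp n k x) \<le> mnorm n x"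
  proof (rule mnorm_least)
    fix z
    have "(vnorm (n + k) (mapv (n + k) (amp n k x) z))\<^sup>2
      = (\<Sum>u\<in>words k. (vnorm n (mapv n x (\<lambda>w. z (w @ u))))\<^sup>2)"
      unfolding vnorm_add_sq
      by (intro sum.cong refl arg_cong[of _ _ "\<lambda>x. x\<^sup>2"] vnorm_cong) (simp add: mapv_amp)
    also have "\<dots> \<le> (\<Sum>u\<in>words k. (mnorm n x * vnorm n (\<lambda>w. z (w @ u)))\<^sup>2)"
      by (intro sum_mono power_mono vnorm_mapv) simp
    also have "\<dots> = (mnorm n x * vnorm (n + k) z)\<^sup>2"
      by (simp add: power_mult_distrib vnorm_add_sq sum_distrib_left)
    finally show "vnorm (n + k) (mapv (n + k) (amp n k x) z) \<le> mnorm n x * vnorm (n + k) z"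
      by (rule power2_le_imp_le) simp
  qed simp
next
  obtain u where u: "u \<in> words k" using words_ne by blast
  show "mnorm n x \<le> mnorm (n + k) (amp n k x)"
  proof (rule mnorm_least)
    fix z :: "3 list \<Rightarrow> complex"
    define y where "y = (\<lambda>w. if drop n w = u then z (take n w) else 0)"
    have slice: "vnorm n (\<lambda>w. y (w @ s)) = (if s = u then vnorm n z else 0)" for s
      by (auto simp: vnorm_def y_def words_def)
    have y: "vnorm (n + k) y = vnorm n z"
    proof -
      have "(vnorm (n + k) y)\<^sup>2 = (\<Sum>s\<in>words k. if s = u then (vnorm n z)\<^sup>2 else 0)"
        unfolding vnorm_add_sq slice by (intro sum.cong) auto
      then show ?thesis using u by simp
    qed
    have "vnorm n (mapv n x z) = vnorm n (\<lambda>w. mapv (n + k) (amp n k x) y (w @ u))"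
    proof (rule vnorm_cong)
      fix w assume "w \<in> words n"
      then show "mapv n x z w = mapv (n + k) (amp n k x) y (w @ u)"
        using u by (simp add: mapv_amp) (auto simp: mapv_def y_def words_def)
    qed
    then have "(vnorm n (mapv n x z))\<^sup>2 \<le> (vnorm (n + k) (mapv (n + k) (amp n k x) y))\<^sup>2"
      unfolding vnorm_add_sq
      using member_le_sum[OF u, of "\<lambda>u. (vnorm n (\<lambda>w. mapv (n + k) (amp n k x) y (w @ u)))\<^sup>2"]
      by simp
    then have "vnorm n (mapv n x z) \<le> vnorm (n + k) (mapv (n + k) (amp n k x) y)"
      by (rule power2_le_imp_le) simp
    also have "\<dots> \<le> mnorm (n + k) (amp n k x) * vnorm (n + k) y" by (rule vnorm_mapv)
    finally show "vnorm n (mapv n x z) \<le> mnorm (n + k) (amp n k x) * vnorm n z" by (simp add: y)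
  qed simp
qed

section \<open>The UHF algebra of type \<open>3\<^sup>\<infinity>\<close>\<close>

text \<open>The inductive limit is built as usual inside the product of the \<open>M3 n\<close> modulo null sequences: its
  elements are represented by the sequences \<open>X n \<in> M3 n\<close> that are Cauchy along the connecting maps.\<close>

definition uhf_seq :: "(nat \<Rightarrow> cmat) \<Rightarrow> bool" where
  "uhf_seq X \<longleftrightarrow> (\<forall>n. X n \<in> M3 n) \<and>
     (\<forall>e>0. \<exists>N. \<forall>n\<ge>N. \<forall>k. mnorm (n + k) (X (n + k) - amp n k (X n)) < e)"

definition uhf_rel :: "(nat \<Rightarrow> cmat) \<Rightarrow> (nat \<Rightarrow> cmat) \<Rightarrow> bool" where
  "uhf_rel X Y \<longleftrightarrow> uhf_seq X \<and> uhf_seq Y \<and> (\<lambda>n. mnorm n (X n - Y n)) \<longlonglongrightarrow> 0"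

definition seqnorm :: "(nat \<Rightarrow> cmat) \<Rightarrow> real" where
  "seqnorm X = lim (\<lambda>n. mnorm n (X n))"

lemma uhf_seqM: "uhf_seq X \<Longrightarrow> X n \<in> M3 n"
  by (simp add: uhf_seq_def)

lemma uhf_seqD:
  assumes "uhf_seq X" "0 < e"
  obtains N where "\<And>n k. N \<le> n \<Longrightarrow> mnorm (n + k) (X (n + k) - amp n k (X n)) < e"
  using assms unfolding uhf_seq_def by blast

lemma seqnorm_LIMSEQ:
  assumes "uhf_seq X"
  shows "(\<lambda>n. mnorm n (X n)) \<longlonglongrightarrow> seqnorm X"
proof -
  have "Cauchy (\<lambda>n. mnorm n (X n))"
    unfolding Cauchy_altdef
  proof (intro allI impI)
    fix e :: real assume "e > 0"
    from uhf_seqD[OF assms this] obtain N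
      where N: "\<And>n k. N \<le> n \<Longrightarrow> mnorm (n + k) (X (n + k) - amp n k (X n)) < e" by blast
    show "\<exists>N. \<forall>m\<ge>N. \<forall>n>m. dist (mnorm m (X m)) (mnorm n (X n)) < e"
    proof (intro exI allI impI)
      fix m n assume "N \<le> m" "m < n"
      then obtain k where n: "n = m + k" using less_imp_add_positive by blast
      show "dist (mnorm m (X m)) (mnorm n (X n)) < e"
        using N[OF \<open>N \<le> m\<close>, of k] mnorm_abs_diff[of n "X n" "amp m k (X m)"]
        by (simp add: n mnorm_amp dist_real_def)
    qed
  qed
  then show ?thesis
    unfolding seqnorm_def using Cauchy_convergent_iff convergent_LIMSEQ_iff by blast
qed

lemma seqnorm_eqI: "uhf_seq X \<Longrightarrow> (\<lambda>n. mnorm n (X n)) \<longlonglongrightarrow> l \<Longrightarrow> seqnorm X = l"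
  using seqnorm_LIMSEQ LIMSEQ_unique by blast

lemma uhf_seq_bound:
  assumes "uhf_seq X"
  obtains B where "0 < B" "\<And>n. mnorm n (X n) \<le> B"
proof -
  have "Bseq (\<lambda>n. mnorm n (X n))"
    using seqnorm_LIMSEQ[OF assms] convergentI convergent_imp_Bseq by blast
  then show ?thesis
    using that by (auto simp: Bseq_def)
qed

lemma uhf_seq_add:
  assumes "uhf_seq X" "uhf_seq Y"
  shows "uhf_seq (\<lambda>n. X n + Y n)"
  unfolding uhf_seq_def
proof (intro conjI allI impI)
  fix e :: real assume "e > 0"
  then have "e / 2 > 0" by simp
  from uhf_seqD[OF assms(1) this] uhf_seqD[OF assms(2) this] obtain N1 N2
    where N: "\<And>n k. N1 \<le> n \<Longrightarrow> mnorm (n + k) (X (n + k) - amp n k (X n)) < e / 2"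
      "\<And>n k. N2 \<le> n \<Longrightarrow> mnorm (n + k) (Y (n + k) - amp n k (Y n)) < e / 2" by metis
  show "\<exists>N. \<forall>n\<ge>N. \<forall>k. mnorm (n + k) (X (n + k) + Y (n + k) - amp n k (X n + Y n)) < e"
  proof (intro exI allI impI)
    fix n k assume "max N1 N2 \<le> n"
    then show "mnorm (n + k) (X (n + k) + Y (n + k) - amp n k (X n + Y n)) < e"
      using N(1)[of n k] N(2)[of n k]
        mnorm_triangle[of "n + k" "X (n + k) - amp n k (X n)" "Y (n + k) - amp n k (Y n)"]
      by (simp add: amp_add algebra_simps)
  qed
qed (use assms uhf_seqM in simp)

lemma uhf_seq_scale:
  assumes "uhf_seq X"
  shows "uhf_seq (\<lambda>n. mscale c (X n))"
  unfolding uhf_seq_def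
proof (intro conjI allI impI)
  fix e :: real assume "e > 0"
  then have "e / (cmod c + 1) > 0" by (simp add: add_nonneg_pos)
  from uhf_seqD[OF assms(1) this] obtain N
    where N: "\<And>n k. N \<le> n \<Longrightarrow> mnorm (n + k) (X (n + k) - amp n k (X n)) < e / (cmod c + 1)" by metis
  show "\<exists>N. \<forall>n\<ge>N. \<forall>k. mnorm (n + k) (mscale c (X (n + k)) - amp n k (mscale c (X n))) < e"
  proof (intro exI allI impI)
    fix n k assume n: "N \<le> n"
    have "mnorm (n + k) (mscale c (X (n + k)) - amp n k (mscale c (X n)))
        = cmod c * mnorm (n + k) (X (n + k) - amp n k (X n))"
      by (simp only: amp_scale mscale_simps(2)[symmetric] mnorm_scale)
    also have "\<dots> \<le> (cmod c + 1) * mnorm (n + k) (X (n + k) - amp n k (X n))"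
      by (intro mult_right_mono) simp_all
    also have "\<dots> < e"
      using N[OF n, of k] pos_less_divide_eq[of "cmod c + 1" _ e]
      by (simp add: add_nonneg_pos mult.commute)
    finally show "mnorm (n + k) (mscale c (X (n + k)) - amp n k (mscale c (X n))) < e" .
  qed
qed (use assms uhf_seqM in simp)

lemma uhf_seq_uminus: "uhf_seq X \<Longrightarrow> uhf_seq (\<lambda>n. - X n)"
  using uhf_seq_scale[of X "-1"] by (simp add: mscale_minus1)

lemma uhf_seq_diff: "uhf_seq X \<Longrightarrow> uhf_seq Y \<Longrightarrow> uhf_seq (\<lambda>n. X n - Y n)"
  using uhf_seq_add[of X "\<lambda>n. - Y n"] uhf_seq_uminus[of Y] by simp

lemma uhf_seq_adj: "uhf_seq X \<Longrightarrow> uhf_seq (\<lambda>n. madj (X n))"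
  unfolding uhf_seq_def by (simp add: amp_adj madj_diff[symmetric] mnorm_adj)

lemma uhf_seq_mul:
  assumes "uhf_seq X" "uhf_seq Y"
  shows "uhf_seq (\<lambda>n. mmul n (X n) (Y n))"
  unfolding uhf_seq_def
proof (intro conjI allI impI)
  fix e :: real assume e: "e > 0"
  obtain A B where A: "0 < A" "\<And>n. mnorm n (X n) \<le> A" and B: "0 < B" "\<And>n. mnorm n (Y n) \<le> B"
    using uhf_seq_bound assms by metis
  have "e / (2 * B) > 0" "e / (2 * A) > 0" using A B e by simp_all
  from uhf_seqD[OF assms(1) this(1)] uhf_seqD[OF assms(2) this(2)] obtain N1 N2
    where N: "\<And>n k. N1 \<le> n \<Longrightarrow> mnorm (n + k) (X (n + k) - amp n k (X n)) < e / (2 * B)"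
      "\<And>n k. N2 \<le> n \<Longrightarrow> mnorm (n + k) (Y (n + k) - amp n k (Y n)) < e / (2 * A)" by metis
  show "\<exists>N. \<forall>n\<ge>N. \<forall>k. mnorm (n + k)
      (mmul (n + k) (X (n + k)) (Y (n + k)) - amp n k (mmul n (X n) (Y n))) < e"
  proof (intro exI allI impI)
    fix n k assume n: "max N1 N2 \<le> n"
    let ?dX = "X (n + k) - amp n k (X n)" and ?dY = "Y (n + k) - amp n k (Y n)"
    have "mmul (n + k) (X (n + k)) (Y (n + k)) - amp n k (mmul n (X n) (Y n))
        = mmul (n + k) ?dX (Y (n + k)) + mmul (n + k) (amp n k (X n)) ?dY"
      using assms by (simp add: amp_mul uhf_seqM mmul_diff_left mmul_diff_right)
    then have "mnorm (n + k) (mmul (n + k) (X (n + k)) (Y (n + k)) - amp n k (mmul n (X n) (Y n)))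
        \<le> mnorm (n + k) (mmul (n + k) ?dX (Y (n + k))) + mnorm (n + k) (mmul (n + k) (amp n k (X n)) ?dY)"
      using mnorm_triangle by metis
    also have "\<dots> \<le> mnorm (n + k) ?dX * mnorm (n + k) (Y (n + k)) + mnorm n (X n) * mnorm (n + k) ?dY"
      using mnorm_mul[of "n + k" "amp n k (X n)" ?dY] by (intro add_mono mnorm_mul) (simp add: mnorm_amp)
    also have "\<dots> \<le> mnorm (n + k) ?dX * B + A * mnorm (n + k) ?dY"
      by (intro add_mono mult_left_mono mult_right_mono A B) simp_all
    also have "\<dots> < e / (2 * B) * B + A * (e / (2 * A))"
      using N(1)[of n k] N(2)[of n k] n A B
      by (intro add_strict_mono mult_strict_left_mono mult_strict_right_mono) simp_all
    also have "\<dots> = e" using A B by simp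
    finally show "mnorm (n + k)
      (mmul (n + k) (X (n + k)) (Y (n + k)) - amp n k (mmul n (X n) (Y n))) < e" .
  qed
qed (use assms uhf_seqM in simp)

lemma uhf_seq_0: "uhf_seq (\<lambda>n. 0)"
  by (simp add: uhf_seq_def)

lemma uhf_seq_one: "uhf_seq mone"
  by (simp add: uhf_seq_def amp_one)

lemma uhf_seq_amp:
  assumes "x \<in> M3 m"
  shows "uhf_seq (\<lambda>n. if n < m then 0 else amp m (n - m) x)"
  unfolding uhf_seq_def
proof (intro conjI allI impI)
  fix n show "(if n < m then 0 else amp m (n - m) x) \<in> M3 n"
    using M_amp[OF assms, of "n - m"] by (cases "n < m") simp_all
next
  fix e :: real assume "e > 0"
  then show "\<exists>N. \<forall>n\<ge>N. \<forall>k. mnorm (n + k) ((if n + k < m then 0 else amp m (n + k - m) x) -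
      amp n k (if n < m then 0 else amp m (n - m) x)) < e"
    by (intro exI[of _ m]) (simp add: amp_amp'[OF assms])
qed

lemma uhf_relI:
  assumes "uhf_seq X" "uhf_seq Y" "f \<longlonglongrightarrow> 0" "\<And>n. mnorm n (X n - Y n) \<le> f n"
  shows "uhf_rel X Y"
  unfolding uhf_rel_def
  using assms by (auto intro: tendsto_sandwich[OF _ _ tendsto_const, of _ _ _ f])

lemma uhf_relD: "uhf_rel X Y \<Longrightarrow> uhf_seq X" "uhf_rel X Y \<Longrightarrow> uhf_seq Y"
  "uhf_rel X Y \<Longrightarrow> (\<lambda>n. mnorm n (X n - Y n)) \<longlonglongrightarrow> 0"
  by (simp_all add: uhf_rel_def)

lemma uhf_rel_refl: "uhf_rel X X \<longleftrightarrow> uhf_seq X"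
  by (simp add: uhf_rel_def)

lemma uhf_rel_eq: "uhf_seq X \<Longrightarrow> X = Y \<Longrightarrow> uhf_rel X Y"
  by (simp add: uhf_rel_def)

lemma uhf_rel_part_equivp: "part_equivp uhf_rel"
proof (rule part_equivpI)
  show "\<exists>x. uhf_rel x x" using uhf_seq_0 uhf_rel_refl by blast
  show "symp uhf_rel"
    by (auto simp: symp_def uhf_rel_def mnorm_minus_commute)
  show "transp uhf_rel"
  proof (rule transpI)
    fix X Y Z assume *: "uhf_rel X Y" "uhf_rel Y Z"
    show "uhf_rel X Z"
      by (rule uhf_relI[OF uhf_relD(1)[OF *(1)] uhf_relD(2)[OF *(2)]
            tendsto_add_zero[OF uhf_relD(3)[OF *(1)] uhf_relD(3)[OF *(2)]]])
         (rule mnorm_diff_triangle)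
  qed
qed

quotient_type uhf = "nat \<Rightarrow> cmat" / partial: uhf_rel
  by (rule uhf_rel_part_equivp)

lemma abs_uhf_eqI: "uhf_rel X Y \<Longrightarrow> abs_uhf X = abs_uhf Y"
  using Quotient3_rel_abs[OF Quotient3_uhf] .

instantiation uhf :: real_normed_algebra_1
begin

lift_definition zero_uhf :: uhf is "\<lambda>n. 0" 
  by (simp add: uhf_rel_refl uhf_seq_0)

lift_definition one_uhf :: uhf is mone 
  by (simp add: uhf_rel_refl uhf_seq_one)

lift_definition plus_uhf :: "uhf \<Rightarrow> uhf \<Rightarrow> uhf" is "\<lambda>X Y n. X n + Y n"
proof -
  fix X X' Y Y' assume *: "uhf_rel X X'" "uhf_rel Y Y'"
  show "uhf_rel (\<lambda>n. X n + Y n) (\<lambda>n. X' n + Y' n)"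
  proof (rule uhf_relI[OF _ _ tendsto_add_zero[OF uhf_relD(3)[OF *(1)] uhf_relD(3)[OF *(2)]]])
    show "mnorm n (X n + Y n - (X' n + Y' n)) \<le> mnorm n (X n - X' n) + mnorm n (Y n - Y' n)" for n
      using mnorm_triangle[of n "X n - X' n" "Y n - Y' n"] by (simp add: algebra_simps)
  qed (use * in \<open>simp_all add: uhf_seq_add uhf_relD\<close>)
qed

lift_definition uminus_uhf :: "uhf \<Rightarrow> uhf" is "\<lambda>X n. - X n"
  by (auto simp: uhf_rel_def uhf_seq_uminus mnorm_minus_commute)

lift_definition minus_uhf :: "uhf \<Rightarrow> uhf \<Rightarrow> uhf" is "\<lambda>X Y n. X n - Y n"
proof -
  fix X X' Y Y' assume *: "uhf_rel X X'" "uhf_rel Y Y'"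
  show "uhf_rel (\<lambda>n. X n - Y n) (\<lambda>n. X' n - Y' n)"
  proof (rule uhf_relI[OF _ _ tendsto_add_zero[OF uhf_relD(3)[OF *(1)] uhf_relD(3)[OF *(2)]]])
    show "mnorm n (X n - Y n - (X' n - Y' n)) \<le> mnorm n (X n - X' n) + mnorm n (Y n - Y' n)" for n
      using mnorm_triangle[of n "X n - X' n" "Y' n - Y n"] mnorm_minus_commute[of n "Y n" "Y' n"]
      by (simp add: algebra_simps)
  qed (use * in \<open>simp_all add: uhf_seq_diff uhf_relD\<close>)
qed

lift_definition times_uhf :: "uhf \<Rightarrow> uhf \<Rightarrow> uhf" is "\<lambda>X Y n. mmul n (X n) (Y n)"
proof -
  fix X X' Y Y' assume *: "uhf_rel X X'" "uhf_rel Y Y'"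
  have "(\<lambda>n. mnorm n (X n - X' n) * mnorm n (Y n) + mnorm n (X' n) * mnorm n (Y n - Y' n))
      \<longlonglongrightarrow> 0 * seqnorm Y + seqnorm X' * 0"
    using * by (intro tendsto_intros seqnorm_LIMSEQ uhf_relD) auto
  then have lim: "(\<lambda>n. mnorm n (X n - X' n) * mnorm n (Y n) + mnorm n (X' n) * mnorm n (Y n - Y' n)) \<longlonglongrightarrow> 0"
    by simp
  show "uhf_rel (\<lambda>n. mmul n (X n) (Y n)) (\<lambda>n. mmul n (X' n) (Y' n))"
  proof (rule uhf_relI[OF _ _ lim])
    fix n
    have "mmul n (X n) (Y n) - mmul n (X' n) (Y' n) = mmul n (X n - X' n) (Y n) + mmul n (X' n) (Y n - Y' n)"
      by (simp add: mmul_diff_left mmul_diff_right)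
    then show "mnorm n (mmul n (X n) (Y n) - mmul n (X' n) (Y' n))
        \<le> mnorm n (X n - X' n) * mnorm n (Y n) + mnorm n (X' n) * mnorm n (Y n - Y' n)"
      by (simp only:) (rule order_trans[OF mnorm_triangle add_mono[OF mnorm_mul mnorm_mul]])
  qed (use * in \<open>simp_all add: uhf_seq_mul uhf_relD\<close>)
qed

lift_definition uhf_scaleC :: "complex \<Rightarrow> uhf \<Rightarrow> uhf" is "\<lambda>c X n. mscale c (X n)"
proof -
  fix c X Y assume *: "uhf_rel X Y"
  show "uhf_rel (\<lambda>n. mscale c (X n)) (\<lambda>n. mscale c (Y n))"
    by (rule uhf_relI[OF _ _ tendsto_mult_right_zero[OF uhf_relD(3)[OF *], of "cmod c"]])
       (use * in \<open>simp_all add: uhf_seq_scale uhf_relD mscale_simps(2)[symmetric] mnorm_scale\<close>)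
qed

lift_definition norm_uhf :: "uhf \<Rightarrow> real" is "\<lambda>X. lim (\<lambda>n. mnorm n (X n))"
proof -
  fix X Y assume *: "uhf_rel X Y"
  have "(\<lambda>n. mnorm n (X n) - mnorm n (Y n)) \<longlonglongrightarrow> seqnorm X - seqnorm Y"
    using * by (intro tendsto_intros seqnorm_LIMSEQ uhf_relD) auto
  moreover have "(\<lambda>n. mnorm n (X n) - mnorm n (Y n)) \<longlonglongrightarrow> 0"
    by (rule Lim_null_comparison[OF _ uhf_relD(3)[OF *]]) (simp add: mnorm_abs_diff)
  ultimately show "lim (\<lambda>n. mnorm n (X n)) = lim (\<lambda>n. mnorm n (Y n))"
    using LIMSEQ_unique unfolding seqnorm_def by fastforce
qed

definition scaleR_uhf :: "real \<Rightarrow> uhf \<Rightarrow> uhf" where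
  "scaleR_uhf r = uhf_scaleC (complex_of_real r)"

definition sgn_uhf :: "uhf \<Rightarrow> uhf" where
  "sgn_uhf a = inverse (norm a) *\<^sub>R a"

definition dist_uhf :: "uhf \<Rightarrow> uhf \<Rightarrow> real" where
  "dist_uhf a b = norm (a - b)"

definition uniformity_uhf :: "(uhf \<times> uhf) filter" where
  "uniformity_uhf = (INF e\<in>{0<..}. principal {(a, b). dist a b < e})"

definition open_uhf :: "uhf set \<Rightarrow> bool" where
  "open_uhf U = (\<forall>a\<in>U. eventually (\<lambda>(a', b). a' = a \<longrightarrow> b \<in> U) uniformity)"

lemma uhf_scaleC_simps:
  "uhf_scaleC c (a + b) = uhf_scaleC c a + uhf_scaleC c b"
  "uhf_scaleC (c + d) a = uhf_scaleC c a + uhf_scaleC d a"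
  "uhf_scaleC c (uhf_scaleC d a) = uhf_scaleC (c * d) a"
  "uhf_scaleC 1 a = a"
  "uhf_scaleC c a * b = uhf_scaleC c (a * b)"
  "a * uhf_scaleC c b = uhf_scaleC c (a * b)"
  by (transfer, rule uhf_rel_eq, 
      simp_all add: uhf_rel_refl uhf_seq_scale uhf_seq_add uhf_seq_mul mscale_simps mmul_scale_left mmul_scale_right)+

lemma norm_uhf_scaleC: "norm (uhf_scaleC c a) = cmod c * norm a"
proof (transfer, fold seqnorm_def, rule seqnorm_eqI)
  fix c X assume "uhf_rel X X"
  then show "uhf_seq (\<lambda>n. mscale c (X n))"
    "(\<lambda>n. mnorm n (mscale c (X n))) \<longlonglongrightarrow> cmod c * seqnorm X"
    by (simp_all add: mnorm_scale uhf_rel_refl uhf_seq_scale seqnorm_LIMSEQ tendsto_mult_left)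
qed

instance
proof
  fix a b c :: uhf and r s :: real
  show "a + b + c = a + (b + c)"
    by (transfer, rule uhf_rel_eq, simp_all add: uhf_rel_refl uhf_seq_add add.assoc)
  show "a + b = b + a"
    by (transfer, rule uhf_rel_eq, simp_all add: uhf_rel_refl uhf_seq_add add.commute)
  show "0 + a = a"
    by (transfer, simp)
  show "- a + a = 0"
    by (transfer, simp add: uhf_rel_refl uhf_seq_0)
  show "a - b = a + - b"
    by (transfer, rule uhf_rel_eq, simp_all add: uhf_rel_refl uhf_seq_diff)
  show "r *\<^sub>R (a + b) = r *\<^sub>R a + r *\<^sub>R b" "(r + s) *\<^sub>R a = r *\<^sub>R a + s *\<^sub>R a"
    "r *\<^sub>R s *\<^sub>R a = (r * s) *\<^sub>R a" "1 *\<^sub>R a = a"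
    "r *\<^sub>R a * b = r *\<^sub>R (a * b)" "a * r *\<^sub>R b = r *\<^sub>R (a * b)"
    by (simp_all add: scaleR_uhf_def uhf_scaleC_simps)
  show "a * b * c = a * (b * c)"
    by (transfer, rule uhf_rel_eq, simp_all add: uhf_rel_refl uhf_seq_mul mmul_assoc)
  show "(a + b) * c = a * c + b * c"
    by (transfer, rule uhf_rel_eq, simp_all add: uhf_rel_refl uhf_seq_mul uhf_seq_add mmul_add_left)
  show "a * (b + c) = a * b + a * c"
    by (transfer, rule uhf_rel_eq, simp_all add: uhf_rel_refl uhf_seq_mul uhf_seq_add mmul_add_right)
  show "1 * a = a"
    by (transfer, rule uhf_rel_eq, simp_all add: uhf_rel_refl uhf_seq_mul uhf_seq_one mmul_one_left uhf_seqM)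
  show "a * 1 = a"
    by (transfer, rule uhf_rel_eq, simp_all add: uhf_rel_refl uhf_seq_mul uhf_seq_one mmul_one_right uhf_seqM)
  show "norm (1 :: uhf) = 1"
    by (transfer, fold seqnorm_def, rule seqnorm_eqI) (simp_all add: uhf_seq_one mnorm_one)
  then show "(0 :: uhf) \<noteq> 1"
  proof (rule contrapos_pn)
    assume "(0 :: uhf) = 1"
    moreover have "norm (0 :: uhf) = 0"
      by (transfer, fold seqnorm_def, rule seqnorm_eqI) (simp_all add: uhf_seq_0)
    ultimately show "norm (1 :: uhf) \<noteq> 1" by simp
  qed
  show "norm a = 0 \<longleftrightarrow> a = 0"
  proof (transfer, fold seqnorm_def)
    fix X assume "uhf_rel X X"
    then have X: "uhf_seq X" by (simp add: uhf_rel_refl)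
    show "seqnorm X = 0 \<longleftrightarrow> uhf_rel X (\<lambda>n. 0)"
    proof
      assume "seqnorm X = 0"
      then have "(\<lambda>n. mnorm n (X n)) \<longlonglongrightarrow> 0" using seqnorm_LIMSEQ[OF X] by simp
      then show "uhf_rel X (\<lambda>n. 0)" using X uhf_seq_0 by (simp add: uhf_rel_def)
    next
      assume "uhf_rel X (\<lambda>n. 0)"
      then have "(\<lambda>n. mnorm n (X n)) \<longlonglongrightarrow> 0" by (simp add: uhf_rel_def)
      then show "seqnorm X = 0" by (rule seqnorm_eqI[OF X])
    qed
  qed
  show "norm (a + b) \<le> norm a + norm b"
  proof (transfer, fold seqnorm_def)
    fix X Y assume "uhf_rel X X" "uhf_rel Y Y"
    then have "uhf_seq X" "uhf_seq Y" by (simp_all add: uhf_rel_refl)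
    then show "seqnorm (\<lambda>n. X n + Y n) \<le> seqnorm X + seqnorm Y"
      by (intro LIMSEQ_le[OF seqnorm_LIMSEQ tendsto_add[OF seqnorm_LIMSEQ seqnorm_LIMSEQ]])
         (auto intro: uhf_seq_add mnorm_triangle)
  qed
  show "norm (a * b) \<le> norm a * norm b"
  proof (transfer, fold seqnorm_def)
    fix X Y assume "uhf_rel X X" "uhf_rel Y Y"
    then have "uhf_seq X" "uhf_seq Y" by (simp_all add: uhf_rel_refl)
    then show "seqnorm (\<lambda>n. mmul n (X n) (Y n)) \<le> seqnorm X * seqnorm Y"
      by (intro LIMSEQ_le[OF seqnorm_LIMSEQ tendsto_mult[OF seqnorm_LIMSEQ seqnorm_LIMSEQ]])
         (auto intro: uhf_seq_mul mnorm_mul)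
  qed
  show "norm (r *\<^sub>R a) = \<bar>r\<bar> * norm a"
    by (simp add: scaleR_uhf_def norm_uhf_scaleC)
qed (simp_all add: sgn_uhf_def dist_uhf_def uniformity_uhf_def open_uhf_def)

end

text \<open>The canonical embedding of \<open>M3 m\<close> into the limit.\<close>

definition iota :: "nat \<Rightarrow> cmat \<Rightarrow> uhf" where
  "iota m x = abs_uhf (\<lambda>n. if n < m then 0 else amp m (n - m) x)"

lemma iota_diff:
  assumes "x \<in> M3 m" "y \<in> M3 m"
  shows "iota m x - iota m y = iota m (x - y)"
proof -
  have "iota m x - iota m y
      = abs_uhf (\<lambda>n. (if n < m then 0 else amp m (n - m) x) - (if n < m then 0 else amp m (n - m) y))"
    unfolding iota_def by (rule minus_uhf.abs_eq) (unfold uhf_rel_refl, (rule uhf_seq_amp, rule assms)+)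
  also have "\<dots> = iota m (x - y)"
    unfolding iota_def by (rule arg_cong[of _ _ abs_uhf], rule ext) (simp add: amp_diff)
  finally show ?thesis .
qed

lemma norm_abs_uhf: "uhf_seq X \<Longrightarrow> norm (abs_uhf X) = seqnorm X"
  by (simp add: norm_uhf.abs_eq uhf_rel_refl seqnorm_def)

lemma norm_iota:
  assumes "x \<in> M3 m"
  shows "norm (iota m x) = mnorm m x"
  unfolding iota_def norm_abs_uhf[OF uhf_seq_amp[OF assms]]
proof (rule seqnorm_eqI[OF uhf_seq_amp[OF assms]])
  have "eventually (\<lambda>n. mnorm n (if n < m then 0 else amp m (n - m) x) = mnorm m x) sequentially"
    using eventually_ge_at_top[of m] 
  proof eventually_elim
    case (elim n)
    then show ?case using mnorm_amp[of m "n - m" x] by simp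
  qed
  then show "(\<lambda>n. mnorm n (if n < m then 0 else amp m (n - m) x)) \<longlonglongrightarrow> mnorm m x"
    by (rule tendsto_eventually)
qed

lemma iota_amp:
  assumes "x \<in> M3 m"
  shows "iota (m + k) (amp m k x) = iota m x"
proof -
  let ?X = "\<lambda>n. if n < m + k then 0 else amp (m + k) (n - (m + k)) (amp m k x)"
  let ?Y = "\<lambda>n. if n < m then 0 else amp m (n - m) x"
  have diff: "mnorm n (?X n - ?Y n) = 0" if "m + k \<le> n" for n
  proof -
    from le_Suc_ex[OF that] obtain l where n: "n = m + k + l" by (elim exE)
    have "amp (m + k) (n - (m + k)) (amp m k x) = amp m (n - m) x"
    proof -
      have "n - (m + k) = l" "n - m = k + l" using n by simp_all
      then show ?thesis using amp_amp[OF assms, of k l] by (simp only:)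
    qed
    then have "?X n - ?Y n = 0" using that by simp
    then show ?thesis by (simp only: mnorm_0)
  qed
  have lim: "(\<lambda>n. mnorm n (?X n - ?Y n)) \<longlonglongrightarrow> 0"
    by (rule tendsto_eventually, rule eventually_sequentiallyI, rule diff)
  have X: "uhf_seq ?X"
    by (rule uhf_seq_amp) (simp add: assms)
  have Y: "uhf_seq ?Y"
    by (rule uhf_seq_amp) (rule assms)
  have "uhf_rel ?X ?Y"
    unfolding uhf_rel_def by (intro conjI X Y lim)
  then have "abs_uhf ?X = abs_uhf ?Y"
    by (rule abs_uhf_eqI)
  then show ?thesis
    by (simp only: iota_def)
qed

lemma iota_LIMSEQ:
  assumes X: "uhf_seq X"
  shows "(\<lambda>n. iota n (X n)) \<longlonglongrightarrow> abs_uhf X"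
proof (rule LIMSEQ_I)
  fix e :: real assume "e > 0"
  then have "e / 2 > 0" by simp
  from uhf_seqD[OF X this] obtain N
      where N: "\<And>n k. N \<le> n \<Longrightarrow> mnorm (n + k) (X (n + k) - amp n k (X n)) < e / 2" by blast
  show "\<exists>N. \<forall>n\<ge>N. norm (iota n (X n) - abs_uhf X) < e"
  proof (intro exI allI impI)
    fix m assume m: "N \<le> m"
    let ?Y = "\<lambda>n. if n < m then 0 else amp m (n - m) (X m)"
    have Y: "uhf_seq ?Y" by (rule uhf_seq_amp[OF uhf_seqM[OF X]])
    have "iota m (X m) - abs_uhf X = abs_uhf (\<lambda>n. ?Y n - X n)"
      unfolding iota_def by (rule minus_uhf.abs_eq) (use X Y in \<open>simp_all add: uhf_rel_refl\<close>)
    also have "norm \<dots> = seqnorm (\<lambda>n. ?Y n - X n)"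
      using X Y by (intro norm_abs_uhf uhf_seq_diff)
    also have "\<dots> \<le> e / 2"
    proof (rule LIMSEQ_le_const2[OF seqnorm_LIMSEQ[OF uhf_seq_diff[OF Y X]]])
      show "\<exists>N. \<forall>n\<ge>N. mnorm n (?Y n - X n) \<le> e / 2"
      proof (intro exI allI impI)
        fix n assume "m \<le> n"
        then obtain k where "n = m + k" using le_Suc_ex by blast
        then show "mnorm n (?Y n - X n) \<le> e / 2"
          using N[OF m, of k] by (simp add: mnorm_minus_commute)
      qed
    qed
    finally show "norm (iota m (X m) - abs_uhf X) < e" using \<open>e > 0\<close> by simp
  qed
qed

lemma iota_dense:
  fixes a :: uhf
  shows "\<exists>X. (\<forall>n. X n \<in> M3 n) \<and> (\<lambda>n. iota n (X n)) \<longlonglongrightarrow> a"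
proof -
  have "uhf_seq (rep_uhf a)" 
    using Quotient_rep_reflp[OF Quotient_uhf, of a] by (simp add: uhf_rel_refl)
  moreover have "abs_uhf (rep_uhf a) = a" by (rule Quotient_abs_rep[OF Quotient_uhf])
  ultimately show ?thesis using iota_LIMSEQ uhf_seqM by metis
qed

instance uhf :: complete_space
proof
  fix a :: "nat \<Rightarrow> uhf" assume "Cauchy a"
  define P where "P k n \<longleftrightarrow> (\<exists>y\<in>M3 n. norm (a k - iota n y) < 1 / real (Suc k))" for k n
  have P_ev: "\<exists>N. \<forall>n\<ge>N. P k n" for k
  proof -
    obtain X where X: "\<And>n. X n \<in> M3 n" "(\<lambda>n. iota n (X n)) \<longlonglongrightarrow> a k" using iota_dense by blast
    from LIMSEQ_D[OF X(2), of "1 / real (Suc k)"] obtain N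
      where "\<And>n. N \<le> n \<Longrightarrow> norm (iota n (X n) - a k) < 1 / real (Suc k)" by auto
    then show ?thesis unfolding P_def using X(1) norm_minus_commute by metis
  qed
  define f where "f n = Max (insert 0 {k. k \<le> n \<and> P k n})" for n
  have f_in: "f n = 0 \<or> P (f n) n" for n
    using Max_in[of "insert 0 {k. k \<le> n \<and> P k n}"] unfolding f_def by auto
  have f_ge: "k \<le> f n" if "k \<le> n" "P k n" for k n
    unfolding f_def using that by (intro Max_ge) auto
  have f_lim: "filterlim f at_top sequentially"
    unfolding filterlim_at_top
  proof
    fix k obtain N where "\<forall>n\<ge>N. P k n" using P_ev by blast
    then show "eventually (\<lambda>n. k \<le> f n) sequentially"
      unfolding eventually_sequentially by (intro exI[of _ "max N k"]) (auto intro: f_ge)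
  qed
  have "\<exists>y. y \<in> M3 n \<and> (P (f n) n \<longrightarrow> norm (a (f n) - iota n y) < 1 / real (Suc (f n)))" for n
    unfolding P_def by (metis M_0)
  then obtain Y where Y: "\<And>n. Y n \<in> M3 n"
    "\<And>n. P (f n) n \<Longrightarrow> norm (a (f n) - iota n (Y n)) < 1 / real (Suc (f n))" by metis
  have close: "(\<lambda>n. a (f n) - iota n (Y n)) \<longlonglongrightarrow> 0"
  proof (rule Lim_null_comparison)
    show "eventually (\<lambda>n. norm (a (f n) - iota n (Y n)) \<le> 1 / real (Suc (f n))) sequentially"
      using filterlim_at_top[THEN iffD1, OF f_lim, rule_format, of 1]
    proof eventually_elim
      case (elim n)
      then have "P (f n) n" using f_in[of n] by auto
      then show ?case by (intro less_imp_le Y(2))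
    qed
    show "(\<lambda>n. 1 / real (Suc (f n))) \<longlonglongrightarrow> 0"
      using filterlim_compose[OF lim_1_over_n[THEN LIMSEQ_Suc] f_lim] by simp
  qed
  have Cf: "\<exists>N. \<forall>m\<ge>N. \<forall>n\<ge>N. dist (a (f m)) (a (f n)) < e" if e: "e > 0" for e
  proof -
    obtain K where K: "\<And>m n. m \<ge> K \<Longrightarrow> n \<ge> K \<Longrightarrow> dist (a m) (a n) < e"
      using metric_CauchyD[OF \<open>Cauchy a\<close> e] by blast
    obtain N where "\<And>n. n \<ge> N \<Longrightarrow> K \<le> f n"
      using f_lim unfolding filterlim_at_top eventually_sequentially by blast
    then show ?thesis using K by blast
  qed
  have CY: "Cauchy (\<lambda>n. iota n (Y n))"
  proof (rule CauchyI)
    fix e :: real assume "0 < e"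
    then have e: "0 < e / 3" by simp
    obtain N1 where N1: "\<And>m n. N1 \<le> m \<Longrightarrow> N1 \<le> n \<Longrightarrow> dist (a (f m)) (a (f n)) < e / 3"
      using Cf[OF e] by blast
    obtain N2 where N2: "\<And>n. N2 \<le> n \<Longrightarrow> norm (a (f n) - iota n (Y n) - 0) < e / 3"
      using LIMSEQ_D[OF close e] by blast
    show "\<exists>N. \<forall>m\<ge>N. \<forall>n\<ge>N. norm (iota m (Y m) - iota n (Y n)) < e"
    proof (intro exI allI impI)
      fix m n assume mn: "max N1 N2 \<le> m" "max N1 N2 \<le> n"
      let ?x = "a (f m) - a (f n)" and ?y = "a (f n) - iota n (Y n)" and ?z = "a (f m) - iota m (Y m)"
      have "iota m (Y m) - iota n (Y n) = (?x + ?y) - ?z" by simp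
      then have "norm (iota m (Y m) - iota n (Y n)) \<le> norm ?x + norm ?y + norm ?z"
        using norm_triangle_ineq4[of "?x + ?y" ?z] norm_triangle_ineq[of ?x ?y] by simp
      then show "norm (iota m (Y m) - iota n (Y n)) < e"
        using N1[of m n] N2[of m] N2[of n] mn by (simp add: dist_norm)
    qed
  qed
  have "uhf_seq Y"
    unfolding uhf_seq_def
  proof (intro conjI allI impI Y)
    fix e :: real assume "e > 0"
    then obtain N where N: "\<And>m n. N \<le> m \<Longrightarrow> N \<le> n \<Longrightarrow> norm (iota m (Y m) - iota n (Y n)) < e"
      using CauchyD[OF CY] by blast
    show "\<exists>N. \<forall>n\<ge>N. \<forall>k. mnorm (n + k) (Y (n + k) - amp n k (Y n)) < e"
    proof (intro exI allI impI)
      fix n k assume "N \<le> n"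
      then have "norm (iota (n + k) (Y (n + k)) - iota (n + k) (amp n k (Y n))) < e"
        using N[of "n + k" n] by (simp add: iota_amp Y)
      then show "mnorm (n + k) (Y (n + k) - amp n k (Y n)) < e"
        by (simp add: iota_diff norm_iota Y)
    qed
  qed
  then have "(\<lambda>n. iota n (Y n)) \<longlonglongrightarrow> abs_uhf Y" by (rule iota_LIMSEQ)
  from tendsto_add[OF close this] have lim: "(\<lambda>n. a (f n)) \<longlonglongrightarrow> abs_uhf Y" by simp
  have "a \<longlonglongrightarrow> abs_uhf Y"
  proof (rule LIMSEQ_I)
    fix e :: real assume "e > 0"
    then have "e / 2 > 0" by simp
    obtain K where K: "\<And>m n. m \<ge> K \<Longrightarrow> n \<ge> K \<Longrightarrow> norm (a m - a n) < e / 2"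
      using CauchyD[OF \<open>Cauchy a\<close> \<open>e / 2 > 0\<close>] by blast
    obtain N1 where N1: "\<And>n. n \<ge> N1 \<Longrightarrow> K \<le> f n"
      using f_lim unfolding filterlim_at_top eventually_sequentially by blast
    obtain N2 where N2: "\<And>n. n \<ge> N2 \<Longrightarrow> norm (a (f n) - abs_uhf Y) < e / 2"
      using LIMSEQ_D[OF lim \<open>e / 2 > 0\<close>] by blast
    let ?m = "max N1 N2"
    show "\<exists>N. \<forall>n\<ge>N. norm (a n - abs_uhf Y) < e"
    proof (intro exI allI impI)
      fix n assume "K \<le> n"
      then have "norm (a n - a (f ?m)) < e / 2" using K N1[of ?m] by simp
      moreover have "norm (a (f ?m) - abs_uhf Y) < e / 2" using N2[of ?m] by simp
      ultimately show "norm (a n - abs_uhf Y) < e"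
        using norm_triangle_ineq[of "a n - a (f ?m)" "a (f ?m) - abs_uhf Y"] by simp
    qed
  qed
  then show "convergent a" by (rule convergentI)
qed

instantiation uhf :: unital_cstar_algebra
begin

definition scaleC_uhf :: "complex \<Rightarrow> uhf \<Rightarrow> uhf" where
  "scaleC_uhf = uhf_scaleC"

lift_definition star_uhf :: "uhf \<Rightarrow> uhf" is "\<lambda>X n. madj (X n)"
  by (auto simp: uhf_rel_def uhf_seq_adj madj_diff[symmetric] mnorm_adj)

instance
proof
  fix a b :: uhf and c d :: complex and r :: real
  show "c *\<^sub>C (a + b) = c *\<^sub>C a + c *\<^sub>C b" "(c + d) *\<^sub>C a = c *\<^sub>C a + d *\<^sub>C a"
    "c *\<^sub>C d *\<^sub>C a = (c * d) *\<^sub>C a" "(c *\<^sub>C a) * b = c *\<^sub>C (a * b)" "a * (c *\<^sub>C b) = c *\<^sub>C (a * b)"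
    by (simp_all add: scaleC_uhf_def uhf_scaleC_simps)
  show "r *\<^sub>R a = complex_of_real r *\<^sub>C a" by (simp add: scaleC_uhf_def scaleR_uhf_def)
  show "norm (c *\<^sub>C a) = cmod c * norm a" by (simp add: scaleC_uhf_def norm_uhf_scaleC)
  show "star (a + b) = star a + star b"
    by (transfer, rule uhf_rel_eq, simp_all add: uhf_rel_refl uhf_seq_adj uhf_seq_add madj_add)
  show "star (c *\<^sub>C a) = cnj c *\<^sub>C star a"
    unfolding scaleC_uhf_def
    by (transfer, rule uhf_rel_eq, simp_all add: uhf_rel_refl uhf_seq_adj uhf_seq_scale madj_scale)
  show "star (a * b) = star b * star a"
    by (transfer, rule uhf_rel_eq, simp_all add: uhf_rel_refl uhf_seq_adj uhf_seq_mul madj_mul)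
  show "star (star a) = a" by (transfer, simp)
  show "norm (star a * a) = (norm a)\<^sup>2"
  proof (transfer, fold seqnorm_def, rule seqnorm_eqI)
    fix X assume "uhf_rel X X"
    then have X: "uhf_seq X" by (simp add: uhf_rel_refl)
    then show "uhf_seq (\<lambda>n. mmul n (madj (X n)) (X n))" by (intro uhf_seq_mul uhf_seq_adj)
    show "(\<lambda>n. mnorm n (mmul n (madj (X n)) (X n))) \<longlonglongrightarrow> (seqnorm X)\<^sup>2"
      unfolding mnorm_cstar using X by (intro tendsto_power seqnorm_LIMSEQ)
  qed
qed

end

lemma mscale_zero: "mscale c 0 = 0" and madj_zero: "madj 0 = 0"
  by (auto simp: mscale_def madj_def fun_eq_iff)

lemma uhf_rel_eventually:
  assumes "uhf_seq X" "uhf_seq Y" "\<And>n. m \<le> n \<Longrightarrow> X n = Y n"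
  shows "uhf_rel X Y"
proof -
  have "(\<lambda>n. mnorm n (X n - Y n)) \<longlonglongrightarrow> 0"
  proof (rule tendsto_eventually, rule eventually_sequentiallyI)
    fix n assume "m \<le> n"
    then have "X n - Y n = 0" using assms(3) by simp
    then show "mnorm n (X n - Y n) = 0" by (simp only: mnorm_0)
  qed
  with assms show ?thesis by (simp add: uhf_rel_def)
qed

lemma iota_add:
  assumes "x \<in> M3 m" "y \<in> M3 m"
  shows "iota m (x + y) = iota m x + iota m y"
proof -
  have "iota m x + iota m y
      = abs_uhf (\<lambda>n. (if n < m then 0 else amp m (n - m) x) + (if n < m then 0 else amp m (n - m) y))"
    unfolding iota_def by (rule plus_uhf.abs_eq) (unfold uhf_rel_refl, (rule uhf_seq_amp, rule assms)+)
  also have "\<dots> = iota m (x + y)"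
    unfolding iota_def by (rule arg_cong[of _ _ abs_uhf], rule ext) (simp add: amp_add)
  finally show ?thesis by simp
qed

lemma iota_mul:
  assumes "x \<in> M3 m" "y \<in> M3 m"
  shows "iota m (mmul m x y) = iota m x * iota m y"
proof -
  let ?X = "\<lambda>n. if n < m then 0 else amp m (n - m) x" and ?Y = "\<lambda>n. if n < m then 0 else amp m (n - m) y"
  have X: "uhf_seq ?X" and Y: "uhf_seq ?Y" by (rule uhf_seq_amp, rule assms)+
  have "iota m x * iota m y = abs_uhf (\<lambda>n. mmul n (?X n) (?Y n))"
    unfolding iota_def by (rule times_uhf.abs_eq) (unfold uhf_rel_refl, rule X, rule Y)
  also have "\<dots> = iota m (mmul m x y)"
    unfolding iota_def
  proof (rule abs_uhf_eqI, rule uhf_rel_eventually)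
    show "uhf_seq (\<lambda>n. mmul n (?X n) (?Y n))" by (rule uhf_seq_mul[OF X Y])
    show "uhf_seq (\<lambda>n. if n < m then 0 else amp m (n - m) (mmul m x y))"
      by (rule uhf_seq_amp, rule M_mul, (rule assms)+)
    fix n assume "m \<le> n"
    then show "mmul n (?X n) (?Y n) = (if n < m then 0 else amp m (n - m) (mmul m x y))"
      using amp_mul[OF assms, of "n - m"] by simp
  qed
  finally show ?thesis by simp
qed

lemma iota_scale:
  assumes "x \<in> M3 m"
  shows "iota m (mscale c x) = c *\<^sub>C iota m x"
proof -
  have "uhf_scaleC c (iota m x) = abs_uhf (\<lambda>n. mscale c (if n < m then 0 else amp m (n - m) x))"
    unfolding iota_def by (rule uhf_scaleC.abs_eq) (unfold uhf_rel_refl, rule uhf_seq_amp, rule assms)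
  also have "\<dots> = iota m (mscale c x)"
    unfolding iota_def
    by (rule arg_cong[of _ _ abs_uhf], rule ext) (simp add: amp_scale mscale_zero)
  finally show ?thesis by (simp add: scaleC_uhf_def)
qed

lemma iota_adj:
  assumes "x \<in> M3 m"
  shows "iota m (madj x) = star (iota m x)"
proof -
  have "star (iota m x) = abs_uhf (\<lambda>n. madj (if n < m then 0 else amp m (n - m) x))"
    unfolding iota_def by (rule star_uhf.abs_eq) (unfold uhf_rel_refl, rule uhf_seq_amp, rule assms)
  also have "\<dots> = iota m (madj x)"
    unfolding iota_def
    by (rule arg_cong[of _ _ abs_uhf], rule ext) (simp add: amp_adj madj_zero)
  finally show ?thesis by simp
qed

lemma iota_one: "iota m (mone m) = 1"
  unfolding iota_def one_uhf_def
proof (rule abs_uhf_eqI, rule uhf_rel_eventually)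
  fix n assume "m \<le> n"
  then show "(if n < m then 0 else amp m (n - m) (mone m)) = mone n"
    using amp_one[of m "n - m"] by simp
qed (rule uhf_seq_amp, rule M_one, rule uhf_seq_one)

text \<open>The type \<open>uhf\<close> is the C*-inductive limit: the \<open>iota m\<close> are isometric unital
  *-homomorphisms compatible with the connecting maps (\<open>norm_iota\<close> to \<open>iota_one\<close> above), and
  their images have dense union.\<close>

lemma iota_union_dense: "closure (\<Union>m. iota m ` M3 m) = UNIV"
proof (rule UNIV_eq_I[symmetric])
  fix a :: uhf
  obtain X where "\<And>n. X n \<in> M3 n" "(\<lambda>n. iota n (X n)) \<longlonglongrightarrow> a" using iota_dense by blast
  then show "a \<in> closure (\<Union>m. iota m ` M3 m)"
    unfolding closure_sequential by (intro exI[of _ "\<lambda>n. iota n (X n)"]) auto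
qed

section \<open>Slice maps\<close>

text \<open>\<open>slice n m\<close> keeps the first \<open>n + 1\<close> factors of \<open>M3 m\<close> (\<open>m \<ge> n + 1\<close>) and evaluates each of the
  remaining ones in the state \<open>x \<mapsto> x\<^sub>2\<^sub>2\<close>; \<open>rho n\<close> is its continuous extension to the limit.\<close>

definition slice :: "nat \<Rightarrow> nat \<Rightarrow> cmat \<Rightarrow> cmat" where
  "slice n m x = (\<lambda>v w. if v \<in> words (n + 1) \<and> w \<in> words (n + 1)
     then x (v @ replicate (m - (n + 1)) 2) (w @ replicate (m - (n + 1)) 2) else 0)"

lift_definition rho :: "nat \<Rightarrow> uhf \<Rightarrow> cmat" is
  "\<lambda>n X v w. lim (\<lambda>m. slice n m (X m) v w)"
proof -
  fix n X Y assume *: "uhf_rel X Y"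
  have "lim (\<lambda>m. slice n m (X m) v w) = lim (\<lambda>m. slice n m (Y m) v w)" for v w
  proof -
    have "(\<lambda>m. slice n m (X m) v w - slice n m (Y m) v w) \<longlonglongrightarrow> 0"
    proof (rule Lim_null_comparison[OF eventually_sequentiallyI uhf_relD(3)[OF *]])
      fix m assume m: "n + 1 \<le> m"
      show "norm (slice n m (X m) v w - slice n m (Y m) v w) \<le> mnorm m (X m - Y m)"
      proof (cases "v \<in> words (n + 1) \<and> w \<in> words (n + 1)")
        case True
        let ?r = "replicate (m - (n + 1)) (2 :: 3)"
        have "v @ ?r \<in> words m" "w @ ?r \<in> words m" using True m by (simp_all add: words_def)
        then show ?thesis using True mnorm_entry[of "v @ ?r" m "w @ ?r" "X m - Y m"] by (simp add: slice_def)
      next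
        case False
        then have "slice n m (X m) v w = 0" "slice n m (Y m) v w = 0" by (auto simp: slice_def)
        then show ?thesis by simp
      qed
    qed
    then have "(\<lambda>m. slice n m (X m) v w) \<longlonglongrightarrow> l \<longleftrightarrow> (\<lambda>m. slice n m (Y m) v w) \<longlonglongrightarrow> l" for l
      by (rule Lim_transform_eq)
    then show ?thesis unfolding lim_def by simp
  qed
  then show "(\<lambda>v w. lim (\<lambda>m. slice n m (X m) v w)) = (\<lambda>v w. lim (\<lambda>m. slice n m (Y m) v w))"
    by (intro ext)
qed

lemma rho_iota:
  assumes "x \<in> M3 m" "n + 1 \<le> m"
  shows "rho n (iota m x) = slice n m x"
proof (intro ext)
  fix v w
  let ?X = "\<lambda>j. if j < m then 0 else amp m (j - m) x"
  have "slice n j (?X j) v w = slice n m x v w" if j: "m \<le> j" for j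
  proof (cases "v \<in> words (n + 1) \<and> w \<in> words (n + 1)")
    case True
    let ?r = "replicate (m - (n + 1)) (2 :: 3)" and ?s = "replicate (j - m) (2 :: 3)"
    have r: "v @ ?r \<in> words m" "w @ ?r \<in> words m" "?s \<in> words (j - m)"
      using True assms(2) by (simp_all add: words_def)
    have "j - (n + 1) = (m - (n + 1)) + (j - m)" using assms(2) j by simp
    then have "replicate (j - (n + 1)) (2 :: 3) = ?r @ ?s" by (simp only: replicate_add)
    then show ?thesis
      using True j amp_append[OF r(1) r(2) r(3) r(3), of x] by (simp add: slice_def)
  next
    case False
    then show ?thesis by (auto simp: slice_def)
  qed
  then have "(\<lambda>j. slice n j (?X j) v w) \<longlonglongrightarrow> slice n m x v w"
    by (intro tendsto_eventually eventually_sequentiallyI[of m])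
  then have "lim (\<lambda>j. slice n j (?X j) v w) = slice n m x v w" by (rule limI)
  moreover have "rho n (abs_uhf ?X) = (\<lambda>v w. lim (\<lambda>j. slice n j (?X j) v w))"
    by (rule rho.abs_eq) (unfold uhf_rel_refl, rule uhf_seq_amp, rule assms)
  ultimately show "rho n (iota m x) v w = slice n m x v w"
    by (simp only: iota_def)
qed

section \<open>The gasket algebra\<close>

definition munit :: "3 \<Rightarrow> 3 \<Rightarrow> cmat" where
  "munit i j = (\<lambda>v w. if v = [i] \<and> w = [j] then 1 else 0)"

primrec tpow :: "cmat \<Rightarrow> nat \<Rightarrow> cmat" where
  "tpow x 0 = mone 0"
| "tpow x (Suc n) = tens n (tpow x n) x"

definition alpha :: "nat \<Rightarrow> 3 \<Rightarrow> cmat" where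
  "alpha n j = tens 1 (munit j j) (tpow (munit 2 2) n)"

definition beta :: "nat \<Rightarrow> 3 \<Rightarrow> cmat" where
  "beta k j = tens 2 (tens 1 (munit j j) (munit 1 1) + tens 1 (munit (j + 2) (j + 2)) (munit 3 3))
     (tpow (munit 2 2) (k - 1))"

definition gasket_fin :: "nat \<Rightarrow> cmat set" where
  "gasket_fin n = module.span mscale
     (range (alpha n) \<union> {tens (n - k) x (beta k j) |k j x. 1 \<le> k \<and> k \<le> n \<and> x \<in> M3 (n - k)})"

definition gasket :: "uhf set" where
  "gasket = {a. \<exists>s. (\<forall>n. s n \<in> gasket_fin n) \<and> (\<lambda>n. iota (n + 1) (s n)) \<longlonglongrightarrow> a}"

section \<open>The Dirac operator and its commutators\<close>

definition offdiag :: "(complex^3^3) set" where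
  "offdiag = {x. \<forall>j. x $ j $ j = 0}"

type_synonym evec = "3 list \<Rightarrow> complex^3^3"

text \<open>A vector of the \<open>n\<close>-fold tensor power of \<open>\<complex>\<^sup>3\<close> tensored with \<open>offdiag\<close> is encoded as the
  \<open>offdiag\<close>-valued function of its coordinates on words of length \<open>n\<close>.\<close>

definition hilb :: "nat \<Rightarrow> evec set" where
  "hilb n = {z. \<forall>v. z v \<in> offdiag \<and> (v \<notin> words n \<longrightarrow> z v = 0)}"

definition hilb_inner :: "nat \<Rightarrow> evec \<Rightarrow> evec \<Rightarrow> complex" where
  "hilb_inner n y z = (\<Sum>v\<in>words n. trace (map_matrix cnj (transpose (y v)) ** z v))"

definition hilb_norm :: "nat \<Rightarrow> evec \<Rightarrow> real" where
  "hilb_norm n z = sqrt (Re (hilb_inner n z z))"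

definition hilb_opnorm :: "nat \<Rightarrow> (evec \<Rightarrow> evec) \<Rightarrow> ennreal" where
  "hilb_opnorm n T = (SUP z\<in>{z \<in> hilb n. hilb_norm n z \<le> 1}. ennreal (hilb_norm n (T z)))"

definition F_op :: "evec \<Rightarrow> evec" where
  "F_op z = (\<lambda>v. transpose (z v))"

definition D_op :: "nat \<Rightarrow> evec \<Rightarrow> evec" where
  "D_op n z = (\<lambda>v. 2 ^ n *\<^sub>R F_op z v)"

text \<open>The \<open>(v, w)\<close> entry of \<open>c \<in> M3 (n + 1)\<close> with respect to the first \<open>n\<close> factors is a 3 by 3 matrix,
  which multiplies the \<open>offdiag\<close> component from the left. For \<open>c\<close> in \<open>M3 n \<otimes> \<complex>\<^sup>3\<close> these matrices
  are diagonal, so that \<open>offdiag\<close> is preserved.\<close>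

definition act :: "nat \<Rightarrow> cmat \<Rightarrow> evec \<Rightarrow> evec" where
  "act n c z = (\<lambda>v. \<Sum>w\<in>words n. (\<chi> i k. c (v @ [i]) (w @ [k])) ** z w)"

definition pi_rep :: "nat \<Rightarrow> uhf \<Rightarrow> evec \<Rightarrow> evec" where
  "pi_rep n a = act n (rho n a)"

text \<open>Each summand of the commutator acts on a finite-dimensional space, so its norm is finite; the
  supremum over \<open>n\<close> is the possibly infinite norm on the direct sum.\<close>

definition gasket_L :: "uhf \<Rightarrow> ennreal" where
  "gasket_L a = (SUP n. hilb_opnorm n (\<lambda>z. D_op n (pi_rep n a z) - pi_rep n a (D_op n z)))"

end

theory Submission
  imports Defs
begin

text \<open>Write an element of \<open>gasket_fin n\<close> as a diagonal matrix over the last tensor factor, with blocks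
  \<open>blk i c\<close>. Transposition swaps the off-diagonal matrix units, so the norm of the commutator with
  \<open>D_op n\<close> is \<open>2 ^ n\<close> times the largest distance \<open>osc n c\<close> between two blocks. Since
  \<open>blk 2 (rho (Suc n) a) = rho n a\<close>, this oscillation dominates the distance from \<open>rho (Suc n) a\<close> to
  \<open>rho n a\<close>. Hence \<open>L a \<le> 1\<close> forces \<open>rho n a\<close> to approach \<open>a\<close> at the geometric rate \<open>2 ^ (- n)\<close>, uniformly in
  \<open>a\<close>; this gives compactness of the unit Lipschitz ball, the kernel, and a bound on its radius modulo
  scalars. For density, \<open>c \<in> gasket_fin n\<close> is continued one level by putting at each new vertex the mean of the
  two neighbouring old values. This midpoint rule halves the oscillation, so iterating it converges to an
  element of finite \<open>L\<close> within distance \<open>osc n c\<close> of \<open>c\<close>. Rieffel's criterion then yields the Lip-norm.\<close>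

section \<open>Rieffel's criterion for Lip-norms\<close>

\<comment> \<open>Think of the last letter of a word as a vertex of a triangle and of the letter
  before it as a subtriangle. Vertex 2 of subtriangle \<open>a\<close> is the old vertex
  \<open>a\<close>; \<open>beta 1 j\<close> glues vertex 1 of subtriangle \<open>j\<close> to vertex
  3 of subtriangle \<open>j + 2\<close>, giving a new point between the old vertices
  \<open>j\<close> and \<open>j + 2\<close>. The values at vertices are matrices. The span defining
  \<open>gasket_fin n\<close> shows neither products nor blocks. The recursion \<open>gblock\<close>
  replaces it by conditions on blocks that products, adjoints and entrywise limits inherit; on such
  elements evaluating the last factor in the state means taking block 2, which is why the slices are
  multiplicative. A lift of \<open>c\<close> is only \<open>osc n c\<close> away from
  \<open>c\<close>, which is not small for a fixed \<open>c\<close>. For \<open>c = rho n a\<close>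
  it tends to 0: convergence of these elements to \<open>a\<close> forces
  \<open>rho (Suc n) a\<close> close to the amplification of \<open>rho n a\<close>, and an
  amplification has equal blocks. On the side of states, no boundedness is assumed and the metric
  tests only self-adjoint elements, so continuity of states is derived from positivity and then
  carried over by real and imaginary parts.\<close>
subclass (in unital_cstar_algebra) banach ..

lemma scaleC_minus_one: "(- 1) *\<^sub>C x = - (x :: 'a::unital_cstar_algebra)"
  using scaleR_scaleC[of "- 1" x] by simp

lemma scaleC_one: "1 *\<^sub>C x = (x :: 'a::unital_cstar_algebra)"
  using scaleR_scaleC[of 1 x] by simp

lemma star_minus: "star (- x) = - star (x :: 'a::unital_cstar_algebra)"
  using star_scaleC[of "- 1" x] by (simp add: scaleC_minus_one)

lemma star_diff: "star (x - y) = star x - star (y :: 'a::unital_cstar_algebra)"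
  using star_add[of x "- y"] by (simp add: star_minus)

lemma star_scaleR: "star (r *\<^sub>R x) = r *\<^sub>R star (x :: 'a::unital_cstar_algebra)"
  by (simp add: scaleR_scaleC star_scaleC)

lemma star_one: "star 1 = (1 :: 'a::unital_cstar_algebra)"
  by (metis mult_1_right mult_1_left star_mult star_star)

lemma star_power: "star (x ^ n) = star (x :: 'a::unital_cstar_algebra) ^ n"
  by (induction n) (simp_all add: star_one star_mult power_commutes)

lemma norm_star: "norm (star x) = norm (x :: 'a::unital_cstar_algebra)"
proof -
  have le: "norm y \<le> norm (star y)" for y :: 'a
  proof (cases "y = 0")
    case False
    have "norm y * norm y \<le> norm (star y) * norm y"
      using norm_mult_ineq[of "star y" y] by (simp add: cstar_identity power2_eq_square)
    then show ?thesis using False by simp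
  qed simp
  show ?thesis using le[of x] le[of "star x"] by (simp add: star_star)
qed

lemma bounded_linear_star: "bounded_linear (star :: 'a \<Rightarrow> 'a::unital_cstar_algebra)"
  by (rule bounded_linear_intro[of _ 1]) (simp_all add: star_add star_scaleR norm_star)

lemma
  assumes "unital_cstar_subalgebra A"
  shows cstar_sub_zero: "0 \<in> A" and cstar_sub_one: "1 \<in> A" and cstar_sub_closed: "closed A"
    and cstar_sub_add: "a \<in> A \<Longrightarrow> b \<in> A \<Longrightarrow> a + b \<in> A"
    and cstar_sub_scaleC: "a \<in> A \<Longrightarrow> c *\<^sub>C a \<in> A"
    and cstar_sub_scaleR: "a \<in> A \<Longrightarrow> r *\<^sub>R a \<in> A"
    and cstar_sub_mult: "a \<in> A \<Longrightarrow> b \<in> A \<Longrightarrow> a * b \<in> A"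
    and cstar_sub_star: "a \<in> A \<Longrightarrow> star a \<in> A"
    and cstar_sub_minus: "a \<in> A \<Longrightarrow> - a \<in> A"
    and cstar_sub_diff: "a \<in> A \<Longrightarrow> b \<in> A \<Longrightarrow> a - b \<in> A"
  using assms unfolding unital_cstar_subalgebra_def star_subalgebra_def scaleR_scaleC
  by simp_all (metis scaleC_minus_one diff_conv_add_uminus)+

section \<open>Square roots from the binomial series\<close>

text \<open>Successive coefficients have ratio \<open>(1/2 - n) / (n + 1)\<close>, of absolute value
  at most 1. Hence the series for the square root of \<open>1 - h\<close> is dominated by the
  geometric series of \<open>norm h\<close>.\<close>

lemma gbinomial_half_bound: "\<bar>(1/2 :: real) gchoose n\<bar> \<le> 1"
proof (induction n)
  case (Suc n)
  have "\<bar>(1/2 :: real) gchoose Suc n\<bar> = \<bar>(1/2) gchoose n\<bar> * (\<bar>1/2 - real n\<bar> / (real n + 1))"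
  proof -
    have "(1/2 :: real) gchoose Suc n = ((1/2) gchoose n) * ((1/2 - real n) / (real n + 1))"
      using gbinomial_mult_1[of "1/2 :: real" n] by (simp add: field_simps)
    then show ?thesis by (simp add: abs_mult abs_divide)
  qed
  also have "\<dots> \<le> 1 * 1"
    using Suc by (intro mult_mono) (auto simp: divide_simps abs_if)
  finally show ?case by simp
qed simp

text \<open>The witness is the binomial series of exponent 1/2 at \<open>- h\<close>. Its partial
  sums stay in the closed set \<open>A\<close>, and its real coefficients give
  \<open>star k = k\<close>.\<close>

lemma sqrt_one_minus:
  fixes h :: "'a::unital_cstar_algebra"
  assumes A: "unital_cstar_subalgebra A" and h: "h \<in> A" "star h = h" "norm h < 1"
  obtains k where "k \<in> A" "star k = k" "k * k = 1 - h"
proof -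
  define a where "a n = ((1/2 :: real) gchoose n) *\<^sub>R (- h) ^ n" for n
  define k where "k = (\<Sum>n. a n)"
  have hA: "(- h) ^ n \<in> A" for n
    by (induction n) (simp_all add: cstar_sub_one[OF A] cstar_sub_mult[OF A] cstar_sub_minus[OF A] h)
  have norm_a: "norm (a n) \<le> norm h ^ n" for n
  proof -
    have "norm (a n) \<le> 1 * norm ((- h) ^ n)"
      unfolding a_def norm_scaleR by (intro mult_right_mono gbinomial_half_bound) simp
    also have "\<dots> \<le> norm h ^ n" using norm_power_ineq[of "- h" n] by simp
    finally show ?thesis .
  qed
  have sn: "summable (\<lambda>n. norm (a n))"
    by (rule summable_comparison_test'[OF summable_geometric[of "norm h"]]) (use h(3) norm_a in auto)
  then have s: "summable a" by (rule summable_norm_cancel)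
  have "k \<in> A"
  proof (rule closed_sequentially[OF cstar_sub_closed[OF A]])
    show "(\<lambda>n. \<Sum>i<n. a i) \<longlonglongrightarrow> k" unfolding k_def using s by (rule summable_LIMSEQ)
    show "(\<Sum>i<n. a i) \<in> A" for n
      by (induction n) (simp_all add: cstar_sub_zero[OF A] cstar_sub_add[OF A] a_def
          cstar_sub_scaleR[OF A hA])
  qed
  moreover have "star k = k"
  proof -
    have "star (a n) = a n" for n by (simp add: a_def star_scaleR star_power star_minus h)
    then show ?thesis unfolding k_def bounded_linear.suminf[OF bounded_linear_star s] by simp
  qed
  moreover have "k * k = 1 - h"
  proof -
    \<comment> \<open>By Vandermonde the Cauchy coefficients are those of exponent 1/2 + 1/2 = 1, so
      they vanish from degree 2 on.\<close>
    have c: "(\<Sum>i\<le>n. a i * a (n - i)) = (if n = 0 then 1 else if n = 1 then - h else 0)" for n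
    proof -
      have "(\<Sum>i\<le>n. a i * a (n - i))
          = (\<Sum>i\<le>n. (((1/2 :: real) gchoose i) * ((1/2) gchoose (n - i))) *\<^sub>R (- h) ^ n)"
        by (intro sum.cong refl) (simp add: a_def power_add[symmetric])
      also have "\<dots> = ((1 :: real) gchoose n) *\<^sub>R (- h) ^ n"
        using gbinomial_Vandermonde[of "1/2 :: real" "1/2" n]
        by (simp add: scaleR_sum_left[symmetric] atLeast0AtMost)
      also have "(1 :: real) gchoose n = of_nat (1 choose n)"
        using binomial_gbinomial[of 1 n, where ?'a = real] by simp
      finally show ?thesis by (cases n) (auto simp: binomial_eq_0 gr0_conv_Suc)
    qed
    have "(\<lambda>n. \<Sum>i\<le>n. a i * a (n - i)) sums (k * k)"
      unfolding k_def by (rule Cauchy_product_sums[OF sn sn])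
    moreover have "(\<lambda>n. \<Sum>i\<le>n. a i * a (n - i)) sums (\<Sum>n\<in>{0,1}. \<Sum>i\<le>n. a i * a (n - i))"
      by (rule sums_finite) (auto simp: c)
    ultimately show ?thesis
      using sums_unique2 by (fastforce simp: c)
  qed
  ultimately show ?thesis using that by blast
qed

section \<open>Boundedness of states\<close>

lemma
  assumes "\<phi> \<in> states A"
  shows state_add: "a \<in> A \<Longrightarrow> b \<in> A \<Longrightarrow> \<phi> (a + b) = \<phi> a + \<phi> b"
    and state_scaleC: "a \<in> A \<Longrightarrow> \<phi> (c *\<^sub>C a) = c * \<phi> a"
    and state_pos: "a \<in> A \<Longrightarrow> \<phi> (star a * a) \<in> \<real>\<^sub>\<ge>\<^sub>0"
    and state_one: "\<phi> 1 = 1"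
  using assms by (auto simp: states_def)

lemma state_diff:
  assumes "unital_cstar_subalgebra A" "\<phi> \<in> states A" "a \<in> A" "b \<in> A"
  shows "\<phi> (a - b) = \<phi> a - \<phi> b"
  using state_add[OF assms(2,3), of "(- 1) *\<^sub>C b"] state_scaleC[OF assms(2,4), of "- 1"] assms
  by (simp add: scaleC_minus_one cstar_sub_minus)

text \<open>Positivity of a state is only assumed on squares, hence the square root of \<open>1 - h\<close>.\<close>

lemma state_bound_selfadjoint:
  assumes A: "unital_cstar_subalgebra A" and \<phi>: "\<phi> \<in> states A" and h: "h \<in> A" "star h = h"
  shows "cmod (\<phi> h) \<le> norm h"
proof (rule dense_ge)
  fix t assume t: "norm h < t"
  then have t0: "t > 0" using norm_ge_zero[of h] by linarith
  have pos: "1 - \<phi> g \<in> \<real>\<^sub>\<ge>\<^sub>0" if g: "g \<in> A" "star g = g" "norm g < 1" for g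
  proof -
    obtain k where k: "k \<in> A" "star k = k" "k * k = 1 - g" using sqrt_one_minus[OF A g] by blast
    then show ?thesis
      using state_pos[OF \<phi> k(1)] state_diff[OF A \<phi> cstar_sub_one[OF A] g(1)] state_one[OF \<phi>] by simp
  qed
  \<comment> \<open>Dividing by some \<open>t\<close> above \<open>norm h\<close> makes the norm
    strictly less than 1, as the series requires. Applying \<open>pos\<close> to both signs of
    \<open>?g\<close> confines \<open>\<phi> ?g\<close> to the real interval from -1 to 1.\<close>
  let ?g = "inverse t *\<^sub>R h"
  have g: "?g \<in> A" "star ?g = ?g" "norm ?g < 1" "- ?g \<in> A" "star (- ?g) = - ?g" "norm (- ?g) < 1"
    using h t t0 by (simp_all add: star_minus cstar_sub_scaleR[OF A] cstar_sub_minus[OF A] star_scaleR field_simps)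
  have "\<phi> (- ?g) = - \<phi> ?g" "\<phi> ?g = inverse t * \<phi> h"
    using state_scaleC[OF \<phi> g(1), of "- 1"] state_scaleC[OF \<phi> h(1), of "inverse t"]
    by (simp_all add: scaleC_minus_one scaleR_scaleC)
  then have "1 - \<phi> ?g \<in> \<real>\<^sub>\<ge>\<^sub>0" "1 + \<phi> ?g \<in> \<real>\<^sub>\<ge>\<^sub>0" and *: "\<phi> ?g = inverse t * \<phi> h"
    using pos[OF g(1-3)] pos[OF g(4-6)] by simp_all
  then have "Im (\<phi> ?g) = 0" "\<bar>Re (\<phi> ?g)\<bar> \<le> 1"
    by (auto simp: complex_nonneg_Reals_iff)
  then have "cmod (\<phi> ?g) \<le> 1" by (simp add: cmod_eq_Re)
  then show "cmod (\<phi> h) \<le> t" unfolding * using t0 by (simp add: norm_mult norm_divide field_simps)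
qed

text \<open>The Cartesian decomposition carries estimates that are available only for self-adjoint
  elements over to all elements.\<close>

lemma selfadjoint_parts:
  fixes a :: "'a::unital_cstar_algebra"
  defines "h \<equiv> (1/2) *\<^sub>C (a + star a)" and "k \<equiv> (- \<i>/2) *\<^sub>C (a - star a)"
  shows "star h = h" "star k = k" "a = h + \<i> *\<^sub>C k" "norm h \<le> norm a" "norm k \<le> norm a"
proof -
  show "star h = h" by (simp add: h_def star_scaleC star_add star_star add.commute)
  have neg: "(- c) *\<^sub>C x = c *\<^sub>C (- x)" for c and x :: 'a
    using scaleC_scaleC[of c "- 1" x] by (simp add: scaleC_minus_one)
  show "star k = k" using neg[of "\<i>/2" "a - star a"]
    by (simp add: k_def star_scaleC star_diff star_star)
  have "h + \<i> *\<^sub>C k = (1/2) *\<^sub>C (a + star a) + (1/2) *\<^sub>C (a - star a)"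
    by (simp add: h_def k_def scaleC_scaleC)
  also have "\<dots> = (1/2) *\<^sub>C (a + a)" by (simp add: scaleC_add_right[symmetric])
  also have "\<dots> = a" using scaleC_add_left[of "1/2" "1/2" a] by (simp add: scaleC_add_right scaleC_one)
  finally show "a = h + \<i> *\<^sub>C k" ..
  show "norm h \<le> norm a" "norm k \<le> norm a"
    using norm_triangle_ineq[of a "star a"] norm_triangle_ineq4[of a "star a"]
    by (simp_all add: h_def k_def norm_scaleC norm_star norm_divide)
qed

text \<open>Each of the two self-adjoint parts contributes \<open>norm a\<close>. The constant 2 is
  not sharp, but it is the same for all states.\<close>

lemma state_bound:
  assumes A: "unital_cstar_subalgebra A" and \<phi>: "\<phi> \<in> states A" and a: "a \<in> A"
  shows "cmod (\<phi> a) \<le> 2 * norm a"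
proof -
  let ?h = "(1/2) *\<^sub>C (a + star a)" and ?k = "(- \<i>/2) *\<^sub>C (a - star a)"
  note p = selfadjoint_parts[of a]
  have A': "?h \<in> A" "?k \<in> A" "\<i> *\<^sub>C ?k \<in> A"
    using a A by (simp_all add: cstar_sub_add cstar_sub_diff cstar_sub_star cstar_sub_scaleC)
  have "\<phi> a = \<phi> ?h + \<i> * \<phi> ?k"
    using state_add[OF \<phi> A'(1,3)] state_scaleC[OF \<phi> A'(2), of \<i>] p(3) by simp
  then have "cmod (\<phi> a) \<le> cmod (\<phi> ?h) + cmod (\<phi> ?k)"
    using norm_triangle_ineq[of "\<phi> ?h" "\<i> * \<phi> ?k"] by (simp add: norm_mult)
  then show ?thesis
    using state_bound_selfadjoint[OF A \<phi> A'(1) p(1)] state_bound_selfadjoint[OF A \<phi> A'(2) p(2)] p(4,5)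
    by linarith
qed


section \<open>From a compact Lipschitz ball to the weak star topology\<close>

lemma seminorm_scalar_shift:
  assumes A: "unital_cstar_subalgebra A" and L: "seminorm_on A L" and "L 1 = 0" "a \<in> A"
  shows "L (a - c *\<^sub>C 1) \<le> L a"
proof -
  have "L (a + (- c) *\<^sub>C 1) \<le> L a + ennreal (cmod (- c)) * L 1"
    using L cstar_sub_one[OF A] cstar_sub_scaleC[OF A cstar_sub_one[OF A], of "- c"] \<open>a \<in> A\<close>
    unfolding seminorm_on_def by metis
  moreover have "(- c) *\<^sub>C 1 = - (c *\<^sub>C (1 :: 'a))"
    using scaleC_scaleC[of "- 1" c "1 :: 'a"] by (simp add: scaleC_minus_one)
  ultimately show ?thesis using \<open>L 1 = 0\<close> by simp
qed

text \<open>Differences of states ignore scalars, and modulo scalars the Lipschitz ball lies in a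
  multiple of the compact set of \<open>cpt\<close>. Finitely many evaluations therefore control the
  metric. Conversely, density makes every evaluation continuous for the metric.\<close>

theorem rieffel_criterion:
  fixes A :: "'a::unital_cstar_algebra set"
  assumes A: "unital_cstar_subalgebra A" and L: "seminorm_on A L"
    and L_star: "\<And>a. a \<in> A \<Longrightarrow> L (star a) = L a"
    and dense: "A \<subseteq> closure {a \<in> A. L a < \<infinity>}"
    and kernel: "\<forall>a\<in>A. L a = 0 \<longleftrightarrow> (\<exists>c. a = c *\<^sub>C 1)"
    and radius: "\<And>a. a \<in> A \<Longrightarrow> L a \<le> 1 \<Longrightarrow> \<exists>c. norm (a - c *\<^sub>C 1) \<le> r"
    and cpt: "compact (closure {a \<in> A. norm a \<le> 1 \<and> L a \<le> 1})"
  shows "lip_norm A L"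
proof -
  define d where "d \<phi> \<psi> = enn2real (lip_dist A L \<phi> \<psi>)" for \<phi> \<psi>
  have oneA: "1 \<in> A" by (rule cstar_sub_one[OF A])
  have L1: "L 1 = 0" using kernel oneA scaleC_one[of "1 :: 'a"] by metis
  have L_add: "L (a + b) \<le> L a + L b" if "a \<in> A" "b \<in> A" for a b
    using L that by (simp add: seminorm_on_def)
  have L_scale: "L (c *\<^sub>C a) = ennreal (cmod c) * L a" if "a \<in> A" for c a
    using L that by (simp add: seminorm_on_def)
  have st_diff: "\<phi> (a - b) = \<phi> a - \<phi> b" if "\<phi> \<in> states A" "a \<in> A" "b \<in> A" for \<phi> a b
    using state_diff[OF A that] .
  \<comment> \<open>Both states take the value \<open>c\<close> at \<open>c *\<^sub>C 1\<close>, so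
    a scalar may be removed before the norm is used.\<close>
  have shift: "\<phi> a - \<psi> a = \<phi> (a - c *\<^sub>C 1) - \<psi> (a - c *\<^sub>C 1)"
    if "\<phi> \<in> states A" "\<psi> \<in> states A" "a \<in> A" for \<phi> \<psi> a c
    using that oneA by (simp add: st_diff cstar_sub_scaleC[OF A] state_scaleC state_one)
  have bound2: "cmod (\<phi> b - \<psi> b) \<le> 4 * norm b" if "\<phi> \<in> states A" "\<psi> \<in> states A" "b \<in> A" for \<phi> \<psi> b
    using state_bound[OF A that(1,3)] state_bound[OF A that(2,3)] norm_triangle_ineq4[of "\<phi> b" "\<psi> b"]
    by linarith

  have dist_least: "lip_dist A L \<phi> \<psi> \<le> ennreal e"
    if "\<And>a. a \<in> A \<Longrightarrow> star a = a \<Longrightarrow> L a \<le> 1 \<Longrightarrow> cmod (\<phi> a - \<psi> a) \<le> e" for \<phi> \<psi> e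
    unfolding lip_dist_def by (rule SUP_least) (auto intro!: ennreal_leI that)
  have d_least: "d \<phi> \<psi> \<le> e"
    if "0 \<le> e" "\<And>a. a \<in> A \<Longrightarrow> star a = a \<Longrightarrow> L a \<le> 1 \<Longrightarrow> cmod (\<phi> a - \<psi> a) \<le> e" for \<phi> \<psi> e
    unfolding d_def using dist_least[OF that(2)] that(1) by (intro enn2real_leI)
  have finite_dist: "lip_dist A L \<phi> \<psi> < \<infinity>" if st: "\<phi> \<in> states A" "\<psi> \<in> states A" for \<phi> \<psi>
  proof -
    have "lip_dist A L \<phi> \<psi> \<le> ennreal (4 * r)"
    proof (rule dist_least)
      fix a assume a: "a \<in> A" "star a = a" "L a \<le> 1"
      then obtain c where c: "norm (a - c *\<^sub>C 1) \<le> r" using radius by blast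
      have "a - c *\<^sub>C 1 \<in> A" using a(1) oneA A by (simp add: cstar_sub_diff cstar_sub_scaleC)
      then show "cmod (\<phi> a - \<psi> a) \<le> 4 * r"
        using bound2[OF st] c shift[OF st a(1), of c] by fastforce
    qed
    then show ?thesis using ennreal_less_top order_le_less_trans unfolding infinity_ennreal_def by blast
  qed
  have d_upper: "cmod (\<phi> a - \<psi> a) \<le> d \<phi> \<psi>"
    if "\<phi> \<in> states A" "\<psi> \<in> states A" "a \<in> A" "star a = a" "L a \<le> 1" for \<phi> \<psi> a
  proof -
    have "ennreal (cmod (\<phi> a - \<psi> a)) \<le> lip_dist A L \<phi> \<psi>"
      unfolding lip_dist_def by (rule SUP_upper) (use that in auto)
    also have "\<dots> = ennreal (d \<phi> \<psi>)"
      unfolding d_def using finite_dist[OF that(1,2)] by simp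
    finally show ?thesis by (simp add: d_def ennreal_le_iff)
  qed
  have d_nonneg: "0 \<le> d \<phi> \<psi>" for \<phi> \<psi> by (simp add: d_def)

  have lip_selfadjoint: "cmod (\<phi> a - \<psi> a) \<le> (enn2real (L a) + 1) * d \<phi> \<psi>"
    if st: "\<phi> \<in> states A" "\<psi> \<in> states A" and a: "a \<in> A" "star a = a" "L a < \<infinity>" for \<phi> \<psi> a
  proof -
    \<comment> \<open>The added 1 keeps \<open>l\<close> positive when \<open>L a = 0\<close>, so
      that dividing by \<open>l\<close> normalises \<open>a\<close> in every case.\<close>
    define l where "l = enn2real (L a) + 1"
    have l: "l > 0" by (simp add: l_def add_nonneg_pos)
    let ?b = "complex_of_real (inverse l) *\<^sub>C a"
    have b: "?b \<in> A" "star ?b = ?b"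
      using a cstar_sub_scaleC[OF A a(1)] by (simp_all add: star_scaleC)
    have "L a = ennreal (enn2real (L a))" using a(3) by simp
    also have "\<dots> \<le> ennreal l" by (intro ennreal_leI) (simp add: l_def)
    finally have "L ?b \<le> ennreal (inverse l) * ennreal l"
      using l by (simp add: L_scale[OF a(1)] norm_inverse mult_left_mono)
    also have "\<dots> = 1" using l by (simp add: ennreal_mult[symmetric])
    finally have "cmod (\<phi> ?b - \<psi> ?b) \<le> d \<phi> \<psi>" using d_upper[OF st b] by blast
    also have "\<phi> ?b - \<psi> ?b = complex_of_real (inverse l) * (\<phi> a - \<psi> a)"
      using st a(1) by (simp add: state_scaleC algebra_simps)
    finally show ?thesis
      unfolding l_def[symmetric] using l by (simp add: norm_mult norm_divide field_simps)
  qed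
  have fin_scale: "L (c *\<^sub>C a) < \<infinity>" if "a \<in> A" "L a < \<infinity>" for c a
    using that by (simp add: L_scale ennreal_mult_less_top)
  have L_parts: "L ((1/2) *\<^sub>C (a + star a)) < \<infinity>" "L ((- \<i>/2) *\<^sub>C (a - star a)) < \<infinity>"
    if a: "a \<in> A" "L a < \<infinity>" for a
  proof -
    have s: "star a \<in> A" "(- 1) *\<^sub>C star a \<in> A"
      using a(1) cstar_sub_scaleC[OF A] by (simp_all add: cstar_sub_star[OF A])
    have "L (a + star a) < \<infinity>" "L (a + (- 1) *\<^sub>C star a) < \<infinity>"
      using L_add[OF a(1) s(1)] L_add[OF a(1) s(2)] L_scale[OF s(1), of "- 1"] L_star[OF a(1)] a(2)
      by (auto intro: order_le_less_trans)
    then show "L ((1/2) *\<^sub>C (a + star a)) < \<infinity>" "L ((- \<i>/2) *\<^sub>C (a - star a)) < \<infinity>"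
      using a(1) s by (intro fin_scale; simp add: cstar_sub_add[OF A] cstar_sub_diff[OF A] scaleC_minus_one)+
  qed
  \<comment> \<open>Replace \<open>a\<close> by a nearby \<open>b\<close> with finite
    \<open>L\<close>. The error \<open>e / 4\<close> becomes \<open>e\<close> through the constant 4
    of \<open>bound2\<close>, and the two self-adjoint parts of \<open>b\<close> supply
    \<open>K\<close>, which does not depend on the states.\<close>
  have cont: "\<exists>K\<ge>0. \<forall>\<phi>\<in>states A. \<forall>\<psi>\<in>states A. cmod (\<phi> a - \<psi> a) \<le> e + K * d \<phi> \<psi>"
    if a: "a \<in> A" and e: "e > 0" for a e
  proof -
    have "e / 4 > 0" using e by simp
    then obtain b where b: "b \<in> A" "L b < \<infinity>" "dist b a < e / 4"
      using dense a unfolding closure_approachable subset_iff by blast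
    let ?h = "(1/2) *\<^sub>C (b + star b)" and ?k = "(- \<i>/2) *\<^sub>C (b - star b)"
    let ?K = "(enn2real (L ?h) + 1) + (enn2real (L ?k) + 1)"
    note p = selfadjoint_parts[of b]
    have A': "?h \<in> A" "?k \<in> A" "\<i> *\<^sub>C ?k \<in> A"
      using b(1) A by (simp_all add: cstar_sub_add cstar_sub_diff cstar_sub_star cstar_sub_scaleC)
    have "cmod (\<phi> a - \<psi> a) \<le> e + ?K * d \<phi> \<psi>" if st: "\<phi> \<in> states A" "\<psi> \<in> states A" for \<phi> \<psi>
    proof -
      have "\<theta> b = \<theta> ?h + \<i> * \<theta> ?k" if "\<theta> \<in> states A" for \<theta>
        using state_add[OF that A'(1,3)] state_scaleC[OF that A'(2), of \<i>] p(3) by simp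
      then have "\<phi> b - \<psi> b = (\<phi> ?h - \<psi> ?h) + \<i> * (\<phi> ?k - \<psi> ?k)"
        using st by (simp add: algebra_simps)
      then have "cmod (\<phi> b - \<psi> b) \<le> cmod (\<phi> ?h - \<psi> ?h) + cmod (\<phi> ?k - \<psi> ?k)"
        using norm_triangle_ineq[of "\<phi> ?h - \<psi> ?h" "\<i> * (\<phi> ?k - \<psi> ?k)"] by (simp add: norm_mult)
      also have "\<dots> \<le> ?K * d \<phi> \<psi>"
        using lip_selfadjoint[OF st A'(1) p(1) L_parts(1)[OF b(1,2)]]
          lip_selfadjoint[OF st A'(2) p(2) L_parts(2)[OF b(1,2)]]
        by (simp only: distrib_right)
      finally have 1: "cmod (\<phi> b - \<psi> b) \<le> ?K * d \<phi> \<psi>" .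
      have ab: "a - b \<in> A" using a b(1) by (rule cstar_sub_diff[OF A])
      have "cmod (\<phi> (a - b) - \<psi> (a - b)) \<le> e"
        using bound2[OF st ab] b(3) by (simp add: dist_norm norm_minus_commute)
      moreover have "\<phi> a - \<psi> a = (\<phi> (a - b) - \<psi> (a - b)) + (\<phi> b - \<psi> b)"
        using st a b(1) by (simp add: st_diff)
      ultimately show ?thesis
        using 1 by (simp only: norm_triangle_mono)
    qed
    then show ?thesis by (intro exI[of _ ?K]) auto
  qed

  have metric: "Metric_space (states A) d"
  proof
    fix \<phi> \<psi> \<theta>
    show "0 \<le> d \<phi> \<psi>" by (rule d_nonneg)
    show "d \<phi> \<psi> = d \<psi> \<phi>" unfolding d_def lip_dist_def by (simp add: norm_minus_commute)
    assume st: "\<phi> \<in> states A" "\<psi> \<in> states A"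
    show "d \<phi> \<psi> = 0 \<longleftrightarrow> \<phi> = \<psi>"
    proof
      assume d0: "d \<phi> \<psi> = 0"
      show "\<phi> = \<psi>"
      proof (rule extensionalityI[of _ A])
        show "\<phi> \<in> extensional A" "\<psi> \<in> extensional A" using st by (auto simp: states_def)
        fix a assume a: "a \<in> A"
        have "cmod (\<phi> a - \<psi> a) \<le> e" if "e > 0" for e
          using cont[OF a that] st d0 by force
        then have "cmod (\<phi> a - \<psi> a) \<le> 0" by (rule field_le_epsilon[of _ 0, simplified])
        then show "\<phi> a = \<psi> a" by simp
      qed
    next
      assume "\<phi> = \<psi>"
      then show "d \<phi> \<psi> = 0" using d_least[of 0 \<phi> \<psi>] d_nonneg[of \<phi> \<psi>] by simp
    qed
    assume st': "\<theta> \<in> states A"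
    show "d \<phi> \<theta> \<le> d \<phi> \<psi> + d \<psi> \<theta>"
    proof (rule d_least)
      fix a assume a: "a \<in> A" "star a = a" "L a \<le> 1"
      show "cmod (\<phi> a - \<theta> a) \<le> d \<phi> \<psi> + d \<psi> \<theta>"
        using d_upper[OF st a] d_upper[OF st(2) st' a] norm_triangle_ineq[of "\<phi> a - \<psi> a" "\<psi> a - \<theta> a"]
        by simp
    qed (simp add: d_nonneg)
  qed
  interpret Metric_space "states A" d by (rule metric)

  have net: "\<exists>F. finite F \<and> F \<subseteq> A \<and> (\<forall>a\<in>A. L a \<le> 1 \<longrightarrow> (\<exists>c. \<exists>b\<in>F. norm (a - c *\<^sub>C 1 - b) < e))"
    if e: "e > 0" for e
  proof -
    \<comment> \<open>After removal of a scalar the norm is at most \<open>r\<close>, so dividing by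
      \<open>R\<close> leads into the unit ball; \<open>R \<ge> 1\<close> keeps \<open>L\<close> at
      most 1. A net of mesh \<open>e / R\<close> is then scaled back by \<open>R\<close>.\<close>
    define R where "R = max r 1"
    have R: "R \<ge> 1" "r \<le> R" "R > 0" by (simp_all add: R_def less_max_iff_disj)
    let ?S = "{a \<in> A. norm a \<le> 1 \<and> L a \<le> 1}"
    have "closure ?S \<subseteq> (\<Union>x\<in>?S. ball x (e / R))"
      using e R by (auto simp: closure_approachable intro: divide_pos_pos)
    from compactE_image[OF cpt _ this] obtain G
      where G: "G \<subseteq> ?S" "finite G" "closure ?S \<subseteq> (\<Union>x\<in>G. ball x (e / R))" by auto
    have "\<exists>c. \<exists>b\<in>scaleR R ` G. norm (a - c *\<^sub>C 1 - b) < e" if a: "a \<in> A" "L a \<le> 1" for a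
    proof -
      obtain c where c: "norm (a - c *\<^sub>C 1) \<le> r" using radius[OF a] by blast
      let ?x = "a - c *\<^sub>C 1" and ?y = "complex_of_real (inverse R) *\<^sub>C (a - c *\<^sub>C 1)"
      have x: "?x \<in> A" using a(1) oneA A by (simp add: cstar_sub_diff cstar_sub_scaleC)
      have "L ?x \<le> 1" using seminorm_scalar_shift[OF A L L1 a(1), of c] a(2) by (rule order_trans)
      then have "L ?y \<le> ennreal (inverse R) * 1"
        using R by (simp only: L_scale[OF x] norm_of_real abs_inverse abs_of_pos mult_left_mono zero_le)
      also have "\<dots> \<le> 1" using R ennreal_leI[of "inverse R" 1] by (simp add: inverse_le_1_iff)
      finally have "L ?y \<le> 1" .
      moreover have "norm ?y = norm ?x / R" using R by (simp add: norm_scaleC norm_inverse divide_inverse)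
      then have "norm ?y \<le> 1" using c R by simp
      ultimately have "?y \<in> closure ?S"
        using closure_subset[of ?S] cstar_sub_scaleC[OF A x] by blast
      then obtain z where z: "z \<in> G" "dist z ?y < e / R" using G(3) by auto
      have "?x - R *\<^sub>R z = R *\<^sub>R (?y - z)"
        using R(3) by (simp add: scaleR_diff_right scaleR_scaleC[of R "_ *\<^sub>C _"] scaleC_scaleC scaleC_one)
      then have "norm (?x - R *\<^sub>R z) = R * dist z ?y"
        using R by (simp add: dist_norm norm_minus_commute)
      also have "\<dots> < e" using z(2) R by (simp add: field_simps)
      finally show ?thesis using z(1) by blast
    qed
    moreover have "scaleR R ` G \<subseteq> A" using G(1) cstar_sub_scaleR[OF A] by blast
    ultimately show ?thesis using G(2) by (intro exI[of _ "scaleR R ` G"]) auto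
  qed

  have ev: "continuous_map (weak_star A) euclidean (\<lambda>\<phi>. \<phi> a)" if "a \<in> A" for a
    unfolding weak_star_def
    by (intro continuous_map_from_subtopology continuous_map_product_projection that)
  have top_ws: "topspace (weak_star A) = states A"
    by (auto simp: weak_star_def states_def PiE_def)
  have states_ext: "states A \<subseteq> extensional A" by (auto simp: states_def)
  have "mtopology = weak_star A"
  proof (rule topology_eq[THEN iffD2], intro allI iffI)
    fix U assume U: "openin mtopology U"
    show "openin (weak_star A) U"
    proof (subst openin_subopen, intro ballI)
      fix \<phi> assume \<phi>: "\<phi> \<in> U"
      then obtain e where e: "e > 0" "mball \<phi> e \<subseteq> U" and st: "\<phi> \<in> states A"
        using U unfolding openin_mtopology by blast
      \<comment> \<open>The estimate below yields 4 + 1 = 5 times \<open>e'\<close>, hence a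
        distance of at most \<open>5 * e / 12\<close>, strictly below \<open>e\<close>.\<close>
      define e' where "e' = e / 12"
      have e': "e' > 0" using e by (simp add: e'_def)
      obtain F where F: "finite F" "F \<subseteq> A"
        "\<And>a. a \<in> A \<Longrightarrow> L a \<le> 1 \<Longrightarrow> \<exists>c. \<exists>b\<in>F. norm (a - c *\<^sub>C 1 - b) < e'"
        using net[OF e'] by blast
      \<comment> \<open>A basic weak star neighbourhood of \<open>\<phi>\<close>, cut out by the
        finitely many net elements.\<close>
      define T where "T = (\<Inter>b\<in>F. {\<psi> \<in> topspace (weak_star A). \<psi> b \<in> ball (\<phi> b) e'}) \<inter> topspace (weak_star A)"
      have "openin (weak_star A) T"
        unfolding T_def using F(1,2)
        by (intro openin_INT openin_continuous_map_preimage[OF ev]) auto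
      moreover have "\<phi> \<in> T" using st e' by (auto simp: T_def top_ws)
      moreover have "T \<subseteq> U"
      proof
        fix \<psi> assume "\<psi> \<in> T"
        then have \<psi>: "\<psi> \<in> states A" "\<And>b. b \<in> F \<Longrightarrow> cmod (\<phi> b - \<psi> b) < e'"
          by (auto simp: T_def top_ws dist_norm)
        have "d \<phi> \<psi> \<le> 5 * e'"
        proof (rule d_least)
          fix a assume a: "a \<in> A" "star a = a" "L a \<le> 1"
          obtain c b where b: "b \<in> F" "norm (a - c *\<^sub>C 1 - b) < e'" using F(3)[OF a(1,3)] by blast
          have A': "a - c *\<^sub>C 1 \<in> A" "b \<in> A"
            using a(1) oneA A F(2) b(1) by (auto simp: cstar_sub_diff cstar_sub_scaleC)
          then have A'': "a - c *\<^sub>C 1 - b \<in> A" by (rule cstar_sub_diff[OF A])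
          have "\<phi> a - \<psi> a = (\<phi> (a - c *\<^sub>C 1 - b) - \<psi> (a - c *\<^sub>C 1 - b)) + (\<phi> b - \<psi> b)"
            unfolding shift[OF st \<psi>(1) a(1), of c] st_diff[OF st A'] st_diff[OF \<psi>(1) A'] by simp
          then have "cmod (\<phi> a - \<psi> a) \<le> 4 * norm (a - c *\<^sub>C 1 - b) + e'"
            using bound2[OF st \<psi>(1) A''] \<psi>(2)[OF b(1)] by (simp only: norm_triangle_mono less_imp_le)
          then show "cmod (\<phi> a - \<psi> a) \<le> 5 * e'" using b(2) by linarith
        qed (use e' in simp)
        then have "\<psi> \<in> mball \<phi> e" using st \<psi>(1) e(1) by (simp add: e'_def)
        then show "\<psi> \<in> U" using e(2) by blast
      qed
      ultimately show "\<exists>T. openin (weak_star A) T \<and> \<phi> \<in> T \<and> T \<subseteq> U" by blast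
    qed
  next
    fix U assume U: "openin (weak_star A) U"
    \<comment> \<open>The weak star topology is initial for the evaluations, so continuity of each
      of them makes the identity map continuous.\<close>
    have "continuous_map mtopology euclidean (\<lambda>\<phi>. \<phi> a)" if a: "a \<in> A" for a
      unfolding continuous_map_def
    proof (intro conjI allI impI)
      fix V :: "complex set" assume "openin euclidean V"
      then have V: "open V" by simp
      show "openin mtopology {\<phi> \<in> topspace mtopology. \<phi> a \<in> V}"
        unfolding openin_mtopology topspace_mtopology
      proof (intro conjI allI impI)
        fix \<phi> assume "\<phi> \<in> {\<phi> \<in> states A. \<phi> a \<in> V}"
        then obtain e where e: "e > 0" "ball (\<phi> a) e \<subseteq> V" and st: "\<phi> \<in> states A"
          using V open_contains_ball by blast
        from e(1) have "e / 2 > 0" by simp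
        from cont[OF a this] obtain K where K: "K \<ge> 0"
          "\<And>\<phi> \<psi>. \<phi> \<in> states A \<Longrightarrow> \<psi> \<in> states A \<Longrightarrow> cmod (\<phi> a - \<psi> a) \<le> e / 2 + K * d \<phi> \<psi>" by blast
        \<comment> \<open>The denominator uses \<open>K + 1\<close> because \<open>K\<close> may be
          0; the two halves of \<open>e\<close> come from approximation and from the metric.\<close>
        have "\<psi> a \<in> V" if \<psi>: "\<psi> \<in> mball \<phi> (e / (2 * (K + 1)))" for \<psi>
        proof -
          have "K * d \<phi> \<psi> \<le> (K + 1) * d \<phi> \<psi>" by (intro mult_right_mono d_nonneg) simp
          also have "\<dots> < e / 2" using \<psi> K(1) by (simp add: field_simps)
          finally have "dist (\<phi> a) (\<psi> a) < e"
            using K(2)[OF st, of \<psi>] \<psi> by (simp add: dist_norm)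
          then show ?thesis using e(2) by auto
        qed
        then show "\<exists>r>0. mball \<phi> r \<subseteq> {\<phi> \<in> states A. \<phi> a \<in> V}"
          using e(1) K(1) by (intro exI[of _ "e / (2 * (K + 1))"]) auto
      qed auto
    qed auto
    then have "continuous_map mtopology (weak_star A) id"
      unfolding weak_star_def continuous_map_in_subtopology continuous_map_componentwise
      using states_ext by (auto simp: o_def)
    from openin_continuous_map_preimage[OF this U] show "openin mtopology U"
      using openin_subset[OF U] by (simp add: top_ws Collect_conj_eq Int_absorb1)
  qed
  then show ?thesis
    unfolding lip_norm_def d_def[symmetric]
    using L dense kernel finite_dist metric by simp
qed

section \<open>Blocks over the last tensor factor\<close>

definition blk :: "3 \<Rightarrow> cmat \<Rightarrow> cmat" where
  "blk i c = (\<lambda>v w. c (v @ [i]) (w @ [i]))"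

text \<open>The tensor product of \<open>M3 n\<close> with the diagonal matrices, as a subalgebra of
  \<open>M3 (Suc n)\<close>.\<close>

definition ldiag :: "nat \<Rightarrow> cmat set" where
  "ldiag n = {c \<in> M3 (Suc n). \<forall>v w i k. i \<noteq> k \<longrightarrow> c (v @ [i]) (w @ [k]) = 0}"

lemma blk_add: "blk i (c + d) = blk i c + blk i d"
  and blk_diff: "blk i (c - d) = blk i c - blk i d"
  and blk_scale: "blk i (mscale r c) = mscale r (blk i c)"
  and blk_adj: "blk i (madj c) = madj (blk i c)"
  by (simp_all add: blk_def mscale_def madj_def fun_eq_iff)

lemma words_Suc_append [simp]: "v @ [i] \<in> words (Suc n) \<longleftrightarrow> v \<in> words n"
  by (simp add: words_def)

lemma words_SucE:
  assumes "w \<in> words (Suc n)"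
  obtains v i where "w = v @ [i]" "v \<in> words n"
proof (rule that)
  have "w \<noteq> []" using assms by (auto simp: words_def)
  then show "w = butlast w @ [last w]" by simp
  show "butlast w \<in> words n" using assms by (simp add: words_def)
qed

lemma words_Suc_0: "words (Suc 0) = range (\<lambda>i. [i])"
proof (intro set_eqI iffI)
  fix w :: "3 list" assume "w \<in> words (Suc 0)"
  then obtain i where "w = [i]" by (auto simp: words_def length_Suc_conv)
  then show "w \<in> range (\<lambda>i. [i])" by simp
qed (auto simp: words_def)

lemma sum_words_Suc_0: "(\<Sum>u\<in>words (Suc 0). f u) = (\<Sum>i\<in>UNIV. f [i])"
  unfolding words_Suc_0 by (subst sum.reindex) (auto simp: inj_on_def)

lemma sum_words_Suc: "(\<Sum>w\<in>words (Suc n). f w) = (\<Sum>v\<in>words n. \<Sum>i\<in>UNIV. f (v @ [i]))"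
  using sum_words_add[of f n 1] by (simp add: sum_words_Suc_0)

lemma vnorm_Suc_sq: "(vnorm (Suc n) z)\<^sup>2 = (\<Sum>i\<in>UNIV. (vnorm n (\<lambda>w. z (w @ [i])))\<^sup>2)"
  using vnorm_add_sq[of n 1 z] by (simp add: sum_words_Suc_0)

lemma blk_M3 [simp]: "c \<in> M3 (Suc n) \<Longrightarrow> blk i c \<in> M3 n"
  using M_outside[of c "Suc n"] by (intro M_I) (simp add: blk_def)

lemma ldiag_M3 [simp]: "c \<in> ldiag n \<Longrightarrow> c \<in> M3 (Suc n)"
  and ldiag_off: "c \<in> ldiag n \<Longrightarrow> i \<noteq> k \<Longrightarrow> c (v @ [i]) (w @ [k]) = 0"
  by (simp_all add: ldiag_def)

lemma ldiagI:
  assumes "c \<in> M3 (Suc n)"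
    "\<And>v w i k. v \<in> words n \<Longrightarrow> w \<in> words n \<Longrightarrow> i \<noteq> k \<Longrightarrow> c (v @ [i]) (w @ [k]) = 0"
  shows "c \<in> ldiag n"
proof -
  have "c (v @ [i]) (w @ [k]) = 0" if "i \<noteq> k" for v w i k
    using assms(2)[of v w i k] that M_outside[OF assms(1), of "v @ [i]" "w @ [k]"]
    by (cases "v \<in> words n \<and> w \<in> words n") auto
  then show ?thesis using assms(1) unfolding ldiag_def by blast
qed

lemma ldiag_eqI:
  assumes "c \<in> ldiag n" "d \<in> ldiag n" "\<And>i. blk i c = blk i d"
  shows "c = d"
proof (rule M_eqI[of _ "Suc n"])
  fix v w assume vw: "v \<in> words (Suc n)" "w \<in> words (Suc n)"
  obtain v' i where "v = v' @ [i]" using vw(1) by (rule words_SucE)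
  moreover obtain w' k where "w = w' @ [k]" using vw(2) by (rule words_SucE)
  ultimately have *: "v = v' @ [i]" "w = w' @ [k]" .
  show "c v w = d v w"
  proof (cases "i = k")
    case True
    then show ?thesis using assms(3)[of i] * by (simp add: blk_def fun_eq_iff)
  next
    case False
    then show ?thesis using * assms(1,2) by (simp add: ldiag_off)
  qed
qed (use assms in simp_all)

lemma ldiag_add: "c \<in> ldiag n \<Longrightarrow> d \<in> ldiag n \<Longrightarrow> c + d \<in> ldiag n"
  by (rule ldiagI) (simp_all add: ldiag_off)

lemma ldiag_diff: "c \<in> ldiag n \<Longrightarrow> d \<in> ldiag n \<Longrightarrow> c - d \<in> ldiag n"
  by (rule ldiagI) (simp_all add: ldiag_off)

lemma ldiag_scale: "c \<in> ldiag n \<Longrightarrow> mscale r c \<in> ldiag n"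
  by (rule ldiagI, simp) (simp add: mscale_def ldiag_off)

lemma ldiag_adj: "c \<in> ldiag n \<Longrightarrow> madj c \<in> ldiag n"
  by (rule ldiagI, simp) (simp add: madj_def ldiag_off)

lemma ldiag_one: "mone (Suc n) \<in> ldiag n"
  by (rule ldiagI, simp) (simp add: mone_def)

lemma mmul_ldiag_entry:
  assumes "c \<in> ldiag n"
  shows "mmul (Suc n) c d (v @ [i]) w = (\<Sum>u\<in>words n. c (v @ [i]) (u @ [i]) * d (u @ [i]) w)"
proof -
  have "(\<Sum>l\<in>UNIV. c (v @ [i]) (u @ [l]) * d (u @ [l]) w) = c (v @ [i]) (u @ [i]) * d (u @ [i]) w" for u
  proof (subst sum.remove[of _ i])
    have "(\<Sum>l\<in>UNIV - {i}. c (v @ [i]) (u @ [l]) * d (u @ [l]) w) = 0"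
      by (rule sum.neutral) (use ldiag_off[OF assms] in auto)
    then show "c (v @ [i]) (u @ [i]) * d (u @ [i]) w + (\<Sum>l\<in>UNIV - {i}. c (v @ [i]) (u @ [l]) * d (u @ [l]) w)
        = c (v @ [i]) (u @ [i]) * d (u @ [i]) w" by simp
  qed simp_all
  then show ?thesis unfolding mmul_def sum_words_Suc by simp
qed

lemma blk_mul: "c \<in> ldiag n \<Longrightarrow> blk i (mmul (Suc n) c d) = mmul n (blk i c) (blk i d)"
  by (intro ext) (simp add: blk_def mmul_ldiag_entry, simp add: mmul_def)

lemma ldiag_mul:
  assumes "c \<in> ldiag n" "d \<in> ldiag n"
  shows "mmul (Suc n) c d \<in> ldiag n"
  by (rule ldiagI) (use assms in \<open>simp_all add: mmul_ldiag_entry ldiag_off\<close>)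

lemma blk_one: "blk i (mone (Suc n)) = mone n"
  by (auto simp: blk_def mone_def fun_eq_iff)

lemma
  assumes "d \<in> M3 n"
  shows ldiag_amp: "amp n 1 d \<in> ldiag n" and blk_amp: "blk i (amp n 1 d) = d"
proof -
  have M: "amp n 1 d \<in> M3 (Suc n)" using M_amp[OF assms, of 1] by (simp only: Suc_eq_plus1)
  have app: "amp n 1 d (v @ [i]) (w @ [k]) = (if i = k then d v w else 0)"
    if "v \<in> words n" "w \<in> words n" for v w i k
    using amp_append[OF that, of "[i]" 1 "[k]" d] by (auto simp: words_def)
  show "amp n 1 d \<in> ldiag n" by (rule ldiagI[OF M]) (simp only: app if_False)
  show "blk i (amp n 1 d) = d"
  proof (rule M_eqI[of _ n])
    show "blk i (amp n 1 d) \<in> M3 n" by (rule blk_M3[OF M])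
    show "blk i (amp n 1 d) v w = d v w" if "v \<in> words n" "w \<in> words n" for v w
      unfolding blk_def using app[OF that] by (simp only: if_True simp_thms)
  qed (rule assms)
qed

section \<open>Norms of compressions and of block-diagonal matrices\<close>

lemma mnorm_cong:
  assumes "\<And>v w. v \<in> words n \<Longrightarrow> w \<in> words n \<Longrightarrow> x v w = y v w"
  shows "mnorm n x = mnorm n y"
proof -
  have "vnorm n (mapv n x z) = vnorm n (mapv n y z)" for z
    by (rule vnorm_cong) (simp add: mapv_def assms)
  then show ?thesis by (simp add: mnorm_def)
qed

text \<open>Extending \<open>z\<close> by the basis vector of \<open>r\<close> is isometric, and the
  compressed image is one slice of the full image, so it is no longer. Taking \<open>r = [i]\<close>
  gives blocks, \<open>r\<close> a string of 2s gives the slice maps.\<close>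

lemma mnorm_compress: "mnorm n (\<lambda>v w. y (v @ r) (w @ r)) \<le> mnorm (n + length r) y"
proof (rule mnorm_least)
  fix z :: "3 list \<Rightarrow> complex"
  let ?k = "length r"
  define z' where "z' w = (if drop n w = r then z (take n w) else 0)" for w
  have z': "z' (w @ u) = (if u = r then z w else 0)" if "w \<in> words n" for w u
    using that by (auto simp: z'_def words_def)
  have r: "r \<in> words ?k" by (simp add: words_def)
  have "mapv (n + ?k) y z' (v @ r) = mapv n (\<lambda>v w. y (v @ r) (w @ r)) z v" for v
  proof -
    have "mapv (n + ?k) y z' (v @ r) = (\<Sum>w\<in>words n. \<Sum>u\<in>words ?k. if u = r then y (v @ r) (w @ u) * z w else 0)"
      unfolding mapv_def sum_words_add by (intro sum.cong refl) (simp add: z')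
    then show ?thesis using r by (simp add: mapv_def)
  qed
  then have "(vnorm n (mapv n (\<lambda>v w. y (v @ r) (w @ r)) z))\<^sup>2
      = (vnorm n (\<lambda>v. mapv (n + ?k) y z' (v @ r)))\<^sup>2" by simp
  also have "\<dots> \<le> (vnorm (n + ?k) (mapv (n + ?k) y z'))\<^sup>2"
    unfolding vnorm_add_sq using r
    by (intro member_le_sum[of r "words ?k" "\<lambda>u. (vnorm n (\<lambda>w. mapv (n + ?k) y z' (w @ u)))\<^sup>2"]) simp_all
  finally have "vnorm n (mapv n (\<lambda>v w. y (v @ r) (w @ r)) z) \<le> vnorm (n + ?k) (mapv (n + ?k) y z')"
    by (rule power2_le_imp_le) simp
  also have "\<dots> \<le> mnorm (n + ?k) y * vnorm (n + ?k) z'" by (rule vnorm_mapv)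
  also have "vnorm (n + ?k) z' = vnorm n z"
  proof -
    have "vnorm n (\<lambda>w. z' (w @ u)) = (if u = r then vnorm n z else 0)" for u
      using vnorm_cong[of n "\<lambda>w. z' (w @ u)" "\<lambda>w. if u = r then z w else 0"]
      by (auto simp: z') (auto simp: vnorm_def)
    then have "(vnorm (n + ?k) z')\<^sup>2 = (\<Sum>u\<in>words ?k. if u = r then (vnorm n z)\<^sup>2 else 0)"
      unfolding vnorm_add_sq by (intro sum.cong) auto
    then show ?thesis using r by simp
  qed
  finally show "vnorm n (mapv n (\<lambda>v w. y (v @ r) (w @ r)) z) \<le> mnorm (n + ?k) y * vnorm n z" .
qed simp

lemma mnorm_blk: "mnorm n (blk i c) \<le> mnorm (Suc n) c"
  using mnorm_compress[of n c "[i]"] by (simp add: blk_def)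

lemma mapv_ldiag:
  assumes "c \<in> ldiag n"
  shows "mapv (Suc n) c z (v @ [i]) = mapv n (blk i c) (\<lambda>w. z (w @ [i])) v"
  using mmul_ldiag_entry[OF assms, of "\<lambda>v w. z v" v i "[]"]
  by (simp add: mmul_def mapv_def blk_def)

text \<open>The square of the vector norm splits over the last letter, and each block acts on its
  own summand.\<close>

lemma mnorm_ldiag:
  assumes "c \<in> ldiag n" "\<And>i. mnorm n (blk i c) \<le> K"
  shows "mnorm (Suc n) c \<le> K"
proof (rule mnorm_least)
  show K: "0 \<le> K" using assms(2) mnorm_ge0 order_trans by blast
  fix z
  have "(vnorm (Suc n) (mapv (Suc n) c z))\<^sup>2 = (\<Sum>i\<in>UNIV. (vnorm n (mapv n (blk i c) (\<lambda>w. z (w @ [i]))))\<^sup>2)"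
    unfolding vnorm_Suc_sq mapv_ldiag[OF assms(1)] ..
  also have "\<dots> \<le> (\<Sum>i\<in>UNIV. (K * vnorm n (\<lambda>w. z (w @ [i])))\<^sup>2)"
    by (intro sum_mono power_mono order_trans[OF vnorm_mapv] mult_right_mono assms(2)) simp_all
  also have "\<dots> = (K * vnorm (Suc n) z)\<^sup>2"
    by (simp add: power_mult_distrib vnorm_Suc_sq sum_distrib_left)
  finally show "vnorm (Suc n) (mapv (Suc n) c z) \<le> K * vnorm (Suc n) z"
    by (rule power2_le_imp_le) (simp add: K)
qed

section \<open>Recursive description of the algebras \<open>gasket_fin n\<close>\<close>

text \<open>Block 2 collects the generators ending in \<open>munit 2 2\<close>, which come from the
  previous level. Blocks 1 and 3 come from the elements \<open>beta 1 j\<close>, which put one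
  coefficient at place \<open>j\<close> of block 1 and at place \<open>j + 2\<close> of block 3;
  this is the matching condition.\<close>

primrec gblock :: "nat \<Rightarrow> cmat set" where
  "gblock 0 = ldiag 0"
| "gblock (Suc n) = {c \<in> ldiag (Suc n). blk 2 c \<in> gblock n \<and> blk 1 c \<in> ldiag n \<and> blk 3 c \<in> ldiag n \<and>
     (\<forall>j. blk j (blk 1 c) = blk (j + 2) (blk 3 c))}"

lemma gblock_ldiag: "c \<in> gblock n \<Longrightarrow> c \<in> ldiag n"
  by (cases n) simp_all

lemma gblock_M3 [simp]: "c \<in> gblock n \<Longrightarrow> c \<in> M3 (Suc n)"
  by (simp add: gblock_ldiag)

lemma gblock_one: "mone (Suc n) \<in> gblock n"
  by (induction n) (simp_all add: blk_one ldiag_one)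

lemma gblock_add: "c \<in> gblock n \<Longrightarrow> d \<in> gblock n \<Longrightarrow> c + d \<in> gblock n"
  by (induction n arbitrary: c d) (simp_all add: blk_add ldiag_add)

lemma gblock_scale: "c \<in> gblock n \<Longrightarrow> mscale r c \<in> gblock n"
  by (induction n arbitrary: c) (simp_all add: blk_scale ldiag_scale)

lemma gblock_zero: "0 \<in> gblock n"
proof -
  have "mscale 0 (mone (Suc n)) = 0" by (simp add: mscale_def fun_eq_iff)
  then show ?thesis using gblock_scale[OF gblock_one, of 0 n] by simp
qed

lemma gblock_adj: "c \<in> gblock n \<Longrightarrow> madj c \<in> gblock n"
  by (induction n arbitrary: c) (simp_all add: blk_adj ldiag_adj)

lemma gblock_mul: "c \<in> gblock n \<Longrightarrow> d \<in> gblock n \<Longrightarrow> mmul (Suc n) c d \<in> gblock n"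
  by (induction n arbitrary: c d) (simp_all add: blk_mul ldiag_mul)

lemma M3_limit:
  assumes "\<And>k. s k \<in> M3 n" "\<And>v w. (\<lambda>k::nat. s k v w) \<longlonglongrightarrow> c v w"
  shows "c \<in> M3 n"
proof (rule M_I)
  fix v w assume "v \<notin> words n \<or> w \<notin> words n"
  then have "(\<lambda>k. s k v w) = (\<lambda>k. 0)" using M_outside[OF assms(1)] by auto
  then show "c v w = 0" using assms(2)[of v w] by (simp add: LIMSEQ_const_iff)
qed

lemma ldiag_limit:
  assumes "\<And>k. s k \<in> ldiag n" "\<And>v w. (\<lambda>k::nat. s k v w) \<longlonglongrightarrow> c v w"
  shows "c \<in> ldiag n"
proof (rule ldiagI)
  show "c \<in> M3 (Suc n)" by (rule M3_limit[OF _ assms(2)]) (simp add: assms(1))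
  fix v w and i k :: 3 assume "i \<noteq> k"
  then have "(\<lambda>l. s l (v @ [i]) (w @ [k])) = (\<lambda>l. 0)" using ldiag_off[OF assms(1)] by auto
  then show "c (v @ [i]) (w @ [k]) = 0"
    using assms(2)[of "v @ [i]" "w @ [k]"] by (simp add: LIMSEQ_const_iff)
qed

lemma gblock_limit:
  assumes "\<And>k. s k \<in> gblock n" "\<And>v w. (\<lambda>k::nat. s k v w) \<longlonglongrightarrow> c v w"
  shows "c \<in> gblock n"
  using assms
proof (induction n arbitrary: s c)
  case 0
  then show ?case using ldiag_limit[of s 0 c] by simp
next
  case (Suc n)
  have l: "(\<lambda>k. blk i (s k) v w) \<longlonglongrightarrow> blk i c v w" for i v w
    unfolding blk_def by (rule Suc.prems)
  have "blk j (blk 1 c) v w = blk (j + 2) (blk 3 c) v w" for j v w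
  proof (rule LIMSEQ_unique)
    show "(\<lambda>k. blk j (blk 1 (s k)) v w) \<longlonglongrightarrow> blk j (blk 1 c) v w"
      unfolding blk_def by (rule Suc.prems)
    have "(\<lambda>k. blk (j + 2) (blk 3 (s k)) v w) \<longlonglongrightarrow> blk (j + 2) (blk 3 c) v w"
      unfolding blk_def by (rule Suc.prems)
    then show "(\<lambda>k. blk j (blk 1 (s k)) v w) \<longlonglongrightarrow> blk (j + 2) (blk 3 c) v w"
      using Suc.prems(1) by simp
  qed
  moreover have "blk 2 c \<in> gblock n"
    by (rule Suc.IH[of "\<lambda>k. blk 2 (s k)"]) (use Suc.prems(1) l in auto)
  moreover have "blk i c \<in> ldiag n" if "i = 1 \<or> i = 3" for i
    by (rule ldiag_limit[of "\<lambda>k. blk i (s k)"]) (use Suc.prems(1) l that in auto)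
  moreover have "c \<in> ldiag (Suc n)"
    by (rule ldiag_limit[of s]) (use Suc.prems in auto)
  ultimately show ?case by (simp add: fun_eq_iff)
qed

section \<open>Tensor generators in terms of blocks\<close>

lemma M_tens:
  assumes "x \<in> M3 m" "y \<in> M3 n"
  shows "tens m x y \<in> M3 (m + n)"
proof (rule M_I, rule ccontr)
  fix v w assume vw: "v \<notin> words (m + n) \<or> w \<notin> words (m + n)" and "tens m x y v w \<noteq> 0"
  then have "x (take m v) (take m w) \<noteq> 0" "y (drop m v) (drop m w) \<noteq> 0" by (auto simp: tens_def)
  then have "take m v \<in> words m" "take m w \<in> words m" "drop m v \<in> words n" "drop m w \<in> words n"
    using M_outside[OF assms(1)] M_outside[OF assms(2)] by metis+
  then have "length v = m + n" "length w = m + n"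
    using append_take_drop_id[of m v] append_take_drop_id[of m w]
    by (metis (mono_tags) length_append mem_Collect_eq words_def)+
  then show False using vw by (simp add: words_def)
qed

lemma tens_append: "v \<in> words m \<Longrightarrow> w \<in> words m \<Longrightarrow> tens m x y (v @ s) (w @ t) = x v w * y s t"
  by (simp add: tens_def words_def)

lemma tens_assoc: "tens m x (tens n y z) = tens (m + n) (tens m x y) z"
  by (simp add: tens_def fun_eq_iff drop_take add.commute min_def)

lemma munit_M3: "munit i j \<in> M3 1"
  by (rule M_I) (auto simp: munit_def words_def)

lemma tens_munit: "tens 1 (munit a a) (munit b b) s t = (if s = [a, b] \<and> t = [a, b] then 1 else 0)"
proof -
  have "take 1 s = [a] \<and> drop 1 s = [b] \<longleftrightarrow> s = [a, b]" for s :: "3 list"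
    by (cases s) auto
  from this[of s] this[of t] show ?thesis by (auto simp: tens_def munit_def)
qed

lemma beta_1_entry: "beta 1 j s t = (if s = t \<and> (s = [j, 1] \<or> s = [j + 2, 3]) then 1 else 0)"
proof -
  \<comment> \<open>The two summands of \<open>beta 1 j\<close> have disjoint supports, so no entry
    becomes 2.\<close>
  have ne: "(1 :: 3) \<noteq> 3" by simp
  have T: "take 2 s = [a, b] \<and> drop 2 s = [] \<longleftrightarrow> s = [a, b]" for s :: "3 list" and a b
    using append_take_drop_id[of 2 s] by auto
  have "beta 1 j s t = (tens 1 (munit j j) (munit 1 1) (take 2 s) (take 2 t)
      + tens 1 (munit (j + 2) (j + 2)) (munit 3 3) (take 2 s) (take 2 t)) * mone 0 (drop 2 s) (drop 2 t)"
    by (simp add: beta_def tens_def[of 2])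
  also have "mone 0 (drop 2 s) (drop 2 t) = (if drop 2 s = [] \<and> drop 2 t = [] then 1 else 0)"
    by (auto simp: mone_def words_def)
  finally show ?thesis
    unfolding tens_munit using T[of s] T[of t] ne by auto
qed

lemma beta_1_M3: "beta 1 j \<in> M3 2"
  by (rule M_I) (auto simp: beta_1_entry[unfolded One_nat_def] words_def)

text \<open>Assembles an element of level \<open>Suc n\<close> from its values \<open>d\<close> at
  old vertices and \<open>m j\<close> at new ones. Writing it with the generators makes membership
  in the span immediate.\<close>

definition glue :: "nat \<Rightarrow> cmat \<Rightarrow> (3 \<Rightarrow> cmat) \<Rightarrow> cmat" where
  "glue n d m = tens (Suc n) d (munit 2 2) + (\<Sum>j\<in>UNIV. tens n (m j) (beta 1 j))"

lemma sum_M3: "(\<And>j. j \<in> J \<Longrightarrow> f j \<in> M3 n) \<Longrightarrow> sum f J \<in> M3 n"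
  by (induction J rule: infinite_finite_induct) auto

lemma sum_cmat_apply: "(\<Sum>j\<in>J. f j :: cmat) v w = (\<Sum>j\<in>J. f j v w)"
  by (induction J rule: infinite_finite_induct) simp_all

context
  fixes n :: nat and d :: cmat and m :: "3 \<Rightarrow> cmat"
  assumes d: "d \<in> ldiag n" and m: "\<And>j. m j \<in> M3 n"
begin

lemma glue_M3: "glue n d m \<in> M3 (Suc (Suc n))"
proof -
  have "tens (Suc n) d (munit 2 2) \<in> M3 (Suc (Suc n))"
    using M_tens[OF ldiag_M3[OF d] munit_M3] by simp
  moreover have "tens n (m j) (beta 1 j) \<in> M3 (Suc (Suc n))" for j
    using M_tens[OF m beta_1_M3, of j j] by simp
  ultimately show ?thesis unfolding glue_def by (intro M_add sum_M3)
qed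

text \<open>The index \<open>a + 1\<close> arises because the word \<open>[a, 3]\<close> belongs to
  \<open>beta 1 j\<close> when \<open>a = j + 2\<close>, which modulo 3 means
  \<open>j = a + 1\<close>.\<close>

lemma glue_entry:
  assumes "v \<in> words n" "w \<in> words n"
  shows "glue n d m (v @ [a, b]) (w @ [a', b']) =
    (if b \<noteq> b' then 0 else if b = 2 then d (v @ [a]) (w @ [a'])
     else if a \<noteq> a' then 0 else if b = 1 then m a v w else m (a + 1) v w)"
proof -
  have j: "[a, b] = [j, 1] \<or> [a, b] = [j + 2, 3] \<longleftrightarrow> j = a \<and> b = 1 \<or> j = a + 1 \<and> b = 3" for j :: 3
  proof -
    have "a = j + 2 \<longleftrightarrow> j = a + 1"
      using exhaust_3[of j] exhaust_3[of a] by (elim disjE; simp)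
    then show ?thesis by (simp only: list.inject simp_thms eq_commute[of a j])
  qed
  have d: "tens (Suc n) d (munit 2 2) ((v @ [a]) @ [b]) ((w @ [a']) @ [b'])
      = (if b = 2 \<and> b' = 2 then d (v @ [a]) (w @ [a']) else 0)"
  proof -
    have "tens (Suc n) d (munit 2 2) ((v @ [a]) @ [b]) ((w @ [a']) @ [b'])
        = d (v @ [a]) (w @ [a']) * munit 2 2 [b] [b']"
      using assms by (intro tens_append) simp_all
    then show ?thesis by (simp add: munit_def)
  qed
  have b: "tens n (m j) (beta 1 j) ((v @ [a]) @ [b]) ((w @ [a']) @ [b'])
      = (if (a = a' \<and> b = b') \<and> (j = a \<and> b = 1 \<or> j = a + 1 \<and> b = 3) then m j v w else 0)" for j
  proof -
    have "tens n (m j) (beta 1 j) (v @ [a, b]) (w @ [a', b']) = m j v w * beta 1 j [a, b] [a', b']"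
      by (rule tens_append[OF assms])
    moreover have "beta 1 j [a, b] [a', b']
        = (if (a = a' \<and> b = b') \<and> (j = a \<and> b = 1 \<or> j = a + 1 \<and> b = 3) then 1 else 0)"
      unfolding beta_1_entry j by simp
    ultimately show ?thesis by (simp only: if_mult_simps append_assoc append_Cons append_Nil)
  qed
  have "glue n d m ((v @ [a]) @ [b]) ((w @ [a']) @ [b'])
      = (if b = 2 \<and> b' = 2 then d (v @ [a]) (w @ [a']) else 0) +
        (\<Sum>j\<in>UNIV. if (a = a' \<and> b = b') \<and> (j = a \<and> b = 1 \<or> j = a + 1 \<and> b = 3) then m j v w else 0)"
    unfolding glue_def plus_fun_apply sum_cmat_apply d b ..
  then have e: "glue n d m (v @ [a, b]) (w @ [a', b'])
      = (if b = 2 \<and> b' = 2 then d (v @ [a]) (w @ [a']) else 0) +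
        (\<Sum>j\<in>UNIV. if (a = a' \<and> b = b') \<and> (j = a \<and> b = 1 \<or> j = a + 1 \<and> b = 3) then m j v w else 0)"
    by (simp only: append_assoc append_Cons append_Nil)
  consider "b = 1" | "b = 2" | "b = 3" using exhaust_3[of b] by blast
  then show ?thesis
  proof cases
    case 1
    then show ?thesis unfolding e by (cases "a = a' \<and> b = b'") auto
  next
    case 2
    then show ?thesis unfolding e by (cases "b = b'") auto
  next
    case 3
    then show ?thesis unfolding e by (cases "a = a' \<and> b = b'") auto
  qed
qed

lemma glue_ldiag: "glue n d m \<in> ldiag (Suc n)"
proof (rule ldiagI[OF glue_M3])
  fix v w and i k :: 3 assume vw: "v \<in> words (Suc n)" "w \<in> words (Suc n)" "i \<noteq> k"
  from vw(1) obtain v' a where v: "v = v' @ [a]" "v' \<in> words n" by (rule words_SucE)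
  from vw(2) obtain w' b where w: "w = w' @ [b]" "w' \<in> words n" by (rule words_SucE)
  show "glue n d m (v @ [i]) (w @ [k]) = 0" unfolding v w using glue_entry v w vw(3) by simp
qed

lemma blk_2_glue: "blk 2 (glue n d m) = d"
proof (rule M_eqI[of _ "Suc n"])
  show "blk 2 (glue n d m) \<in> M3 (Suc n)" by (rule blk_M3[OF glue_M3])
  show "d \<in> M3 (Suc n)" using d by simp
  fix v w assume vw: "v \<in> words (Suc n)" "w \<in> words (Suc n)"
  from vw(1) obtain v' a where v: "v = v' @ [a]" "v' \<in> words n" by (rule words_SucE)
  from vw(2) obtain w' b where w: "w = w' @ [b]" "w' \<in> words n" by (rule words_SucE)
  show "blk 2 (glue n d m) v w = d v w"
    unfolding v w blk_def using glue_entry v w by simp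
qed

lemma blk_glue_ldiag: "i \<noteq> 2 \<Longrightarrow> blk i (glue n d m) \<in> ldiag n"
  by (rule ldiagI[OF blk_M3[OF glue_M3]]) (simp add: blk_def glue_entry)

lemma blk_blk_glue:
  "blk j (blk 1 (glue n d m)) = m j" "blk j (blk 3 (glue n d m)) = m (j + 1)"
  by (rule M_eqI[OF blk_M3[OF blk_M3[OF glue_M3]] m], simp add: blk_def glue_entry)+

end

lemma three_cycle: "j + 2 + 1 = (j :: 3)" "j + 1 + 2 = j"
  using exhaust_3[of j] by (elim disjE; simp)+

lemma glue_gblock:
  assumes "d \<in> gblock n" "\<And>j. m j \<in> M3 n"
  shows "glue n d m \<in> gblock (Suc n)"
proof -
  note d = gblock_ldiag[OF assms(1)]
  have "blk j (blk 1 (glue n d m)) = blk (j + 2) (blk 3 (glue n d m))" for j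
    unfolding blk_blk_glue[OF d assms(2)] three_cycle ..
  moreover have "blk 1 (glue n d m) \<in> ldiag n" "blk 3 (glue n d m) \<in> ldiag n"
    by (rule blk_glue_ldiag[OF d assms(2)], simp)+
  ultimately show ?thesis
    using glue_ldiag[OF d assms(2)] blk_2_glue[OF d assms(2)] assms(1) by simp
qed

text \<open>The matching condition recovers block 3 from block 1, so block 2 and the blocks of block
  1 are complete data.\<close>

lemma gblock_eq_glue:
  assumes "c \<in> gblock (Suc n)"
  shows "c = glue n (blk 2 c) (\<lambda>j. blk j (blk 1 c))" (is "_ = ?g")
proof -
  have c: "c \<in> ldiag (Suc n)" "blk 2 c \<in> gblock n" "blk 1 c \<in> ldiag n" "blk 3 c \<in> ldiag n"
    "\<And>j. blk j (blk 1 c) = blk (j + 2) (blk 3 c)"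
    using assms by simp_all
  note d = gblock_ldiag[OF c(2)]
  have m: "blk j (blk 1 c) \<in> M3 n" for j using c(3) by simp
  note g = glue_ldiag[OF d m] blk_2_glue[OF d m] blk_glue_ldiag[OF d m] blk_blk_glue[OF d m]
  have b1: "blk 1 c = blk 1 ?g" by (rule ldiag_eqI[OF c(3) g(3)]) (simp_all add: g)
  have b3: "blk 3 c = blk 3 ?g"
  proof (rule ldiag_eqI[OF c(4) g(3)])
    fix i :: 3
    show "blk i (blk 3 c) = blk i (blk 3 ?g)" using c(5)[of "i + 1"] by (simp only: g three_cycle)
  qed simp
  show ?thesis
  proof (rule ldiag_eqI[OF c(1) g(1)])
    fix i :: 3 consider "i = 1" | "i = 2" | "i = 3" using exhaust_3[of i] by blast
    then show "blk i c = blk i ?g" using b1 b3 g(2) by cases simp_all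
  qed
qed

lemma module_mscale: "module mscale"
  by unfold_locales (simp_all add: mscale_simps)

lemma tens_zero: "tens m 0 y = 0" "tens m x 0 = 0"
  by (simp_all add: tens_def fun_eq_iff)

lemma tens_add_left: "tens m (x + x') y = tens m x y + tens m x' y"
  and tens_scale_left: "tens m (mscale r x) y = mscale r (tens m x y)"
  by (simp_all add: tens_def mscale_def fun_eq_iff algebra_simps)

lemma glue_zero_right: "glue n d (\<lambda>_. 0) = tens (Suc n) d (munit 2 2)"
  by (simp add: glue_def tens_zero)

lemma glue_zero_left: "glue n 0 (\<lambda>i. if i = j then x else 0) = tens n x (beta 1 j)"
proof -
  have "tens n (if i = j then x else 0) (beta 1 i) = (if i = j then tens n x (beta 1 j) else 0)" for i
    by (simp add: tens_zero)
  then show ?thesis by (simp add: glue_def tens_zero)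
qed

lemma alpha_Suc: "alpha (Suc n) j = tens (Suc n) (alpha n j) (munit 2 2)"
  unfolding alpha_def tpow.simps tens_assoc by simp

text \<open>By truncated subtraction \<open>beta 0\<close> and \<open>beta 1\<close> coincide, hence
  the recursion starts at \<open>k = 1\<close>.\<close>

lemma beta_Suc: "1 \<le> k \<Longrightarrow> beta (Suc k) j = tens (Suc k) (beta k j) (munit 2 2)"
  unfolding beta_def by (cases k) (simp_all add: tens_assoc)

lemma alpha_0: "alpha 0 j = munit j j"
  unfolding alpha_def tpow.simps using amp_0_id[OF munit_M3] by (simp add: amp_def)

lemma tens_beta_Suc:
  "1 \<le> k \<Longrightarrow> k \<le> n \<Longrightarrow> tens (Suc n - Suc k) x (beta (Suc k) j) = tens (Suc n) (tens (n - k) x (beta k j)) (munit 2 2)"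
  by (simp add: beta_Suc tens_assoc)

lemma munit_ldiag: "munit j j \<in> ldiag 0"
proof (rule ldiagI)
  show "munit j j \<in> M3 (Suc 0)" using munit_M3[of j j] by simp
qed (auto simp: munit_def words_def)

lemma alpha_gblock: "alpha n j \<in> gblock n"
proof (induction n)
  case 0
  then show ?case by (simp add: alpha_0 munit_ldiag)
next
  case (Suc n)
  then show ?case
    unfolding alpha_Suc glue_zero_right[symmetric] by (intro glue_gblock) simp_all
qed

lemma tens_beta_gblock:
  "1 \<le> k \<Longrightarrow> k \<le> n \<Longrightarrow> x \<in> M3 (n - k) \<Longrightarrow> tens (n - k) x (beta k j) \<in> gblock n"
proof (induction n arbitrary: k)
  case 0
  then show ?case by simp
next
  case (Suc n)
  show ?case
  proof (cases "k = 1")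
    case True
    then have "tens (Suc n - k) x (beta k j) = glue n 0 (\<lambda>i. if i = j then x else 0)"
      unfolding glue_zero_left by simp
    also have "\<dots> \<in> gblock (Suc n)"
      using Suc.prems(3) True by (intro glue_gblock gblock_zero) auto
    finally show ?thesis .
  next
    case False
    then obtain k' where k': "k = Suc k'" "1 \<le> k'" "k' \<le> n" using Suc.prems by (cases k) auto
    have "glue n (tens (n - k') x (beta k' j)) (\<lambda>_. 0) \<in> gblock (Suc n)"
      using Suc.IH[OF k'(2,3)] Suc.prems(3) k'(1) by (intro glue_gblock) simp_all
    then show ?thesis using k' unfolding glue_zero_right by (simp only: tens_beta_Suc)
  qed
qed

text \<open>At level \<open>Suc n\<close> the \<open>alpha\<close> generators and those with
  \<open>k > 1\<close> are generators of level \<open>n\<close> tensored with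
  \<open>munit 2 2\<close>, while those with \<open>k = 1\<close> are new. These are the two terms
  of \<open>glue\<close>, so both inclusions follow by induction.\<close>

theorem gasket_fin_eq_gblock: "gasket_fin n = gblock n"
proof
  have "module.subspace mscale (gblock n)"
    by (rule module.subspaceI[OF module_mscale]) (auto intro: gblock_zero gblock_add gblock_scale)
  then show "gasket_fin n \<subseteq> gblock n"
    unfolding gasket_fin_def
    by (intro module.span_minimal[OF module_mscale]) (auto intro: alpha_gblock tens_beta_gblock)
next
  let ?gen = "\<lambda>n. range (alpha n) \<union> {tens (n - k) x (beta k j) |k j x. 1 \<le> k \<and> k \<le> n \<and> x \<in> M3 (n - k)}"
  note span_base = module.span_base[OF module_mscale] and span_sum = module.span_sum[OF module_mscale]
    and span_add = module.span_add[OF module_mscale] and span_scale = module.span_scale[OF module_mscale]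
  have up: "tens (Suc n) c (munit 2 2) \<in> gasket_fin (Suc n)" if "c \<in> gasket_fin n" for c n
    using that unfolding gasket_fin_def
  proof (induction rule: module.span_induct_alt[OF module_mscale, consumes 1])
    case 1
    show ?case unfolding tens_zero by (rule module.span_zero[OF module_mscale])
  next
    case (2 r x y)
    have "tens (Suc n) x (munit 2 2) \<in> ?gen (Suc n)"
      using 2(1)
    proof
      assume "x \<in> range (alpha n)"
      then obtain j where "x = alpha n j" by blast
      then show ?thesis using alpha_Suc[of n j, symmetric] by blast
    next
      assume "x \<in> {tens (n - k) x (beta k j) |k j x. 1 \<le> k \<and> k \<le> n \<and> x \<in> M3 (n - k)}"
      then obtain k j z where z: "x = tens (n - k) z (beta k j)" "1 \<le> k" "k \<le> n" "z \<in> M3 (n - k)" by blast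
      have "tens (Suc n) x (munit 2 2) = tens (Suc n - Suc k) z (beta (Suc k) j)"
        unfolding z(1) tens_beta_Suc[OF z(2,3)] ..
      moreover have "1 \<le> Suc k" "Suc k \<le> Suc n" "z \<in> M3 (Suc n - Suc k)" using z by simp_all
      ultimately show ?thesis by blast
    qed
    then show ?case
      unfolding tens_add_left tens_scale_left by (intro span_add span_scale 2 span_base)
  qed
  show "gblock n \<subseteq> gasket_fin n"
  proof (induction n)
    case 0
    show ?case
    proof
      fix c assume "c \<in> gblock 0"
      then have c: "c \<in> ldiag 0" by simp
      have "c = (\<Sum>j\<in>UNIV. mscale (c [j] [j]) (alpha 0 j))"
      proof (rule M_eqI[of _ "Suc 0"])
        show "(\<Sum>j\<in>UNIV. mscale (c [j] [j]) (alpha 0 j)) \<in> M3 (Suc 0)"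
          by (intro sum_M3 M_scale) (simp add: alpha_0 munit_ldiag)
        fix v w assume "v \<in> words (Suc 0)" "w \<in> words (Suc 0)"
        then obtain a b where vw: "v = [a]" "w = [b]" by (auto simp: words_Suc_0)
        have "(\<Sum>j\<in>UNIV. mscale (c [j] [j]) (alpha 0 j)) v w = (\<Sum>j\<in>UNIV. if j = a then if a = b then c [a] [a] else 0 else 0)"
          unfolding sum_cmat_apply by (rule sum.cong) (auto simp: vw alpha_0 mscale_def munit_def)
        also have "\<dots> = c v w" using ldiag_off[OF c, of a b "[]" "[]"] by (simp add: vw)
        finally show "c v w = (\<Sum>j\<in>UNIV. mscale (c [j] [j]) (alpha 0 j)) v w" ..
      qed (use c in simp)
      also have "\<dots> \<in> gasket_fin 0"
        unfolding gasket_fin_def by (intro span_sum span_scale span_base) simp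
      finally show "c \<in> gasket_fin 0" .
    qed
  next
    case (Suc n)
    show ?case
    proof
      fix c assume c: "c \<in> gblock (Suc n)"
      have "tens (Suc n) (blk 2 c) (munit 2 2) \<in> gasket_fin (Suc n)"
        using c Suc by (intro up) auto
      moreover have "tens n (blk j (blk 1 c)) (beta 1 j) \<in> gasket_fin (Suc n)" for j
        unfolding gasket_fin_def
      proof (rule span_base, rule UnI2, intro CollectI exI conjI)
        show "tens n (blk j (blk 1 c)) (beta 1 j) = tens (Suc n - 1) (blk j (blk 1 c)) (beta 1 j)" by simp
        show "blk j (blk 1 c) \<in> M3 (Suc n - 1)" using c by simp
      qed simp_all
      ultimately have "glue n (blk 2 c) (\<lambda>j. blk j (blk 1 c)) \<in> gasket_fin (Suc n)"
        unfolding glue_def gasket_fin_def by (intro span_add span_sum)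
      then show "c \<in> gasket_fin (Suc n)" using gblock_eq_glue[OF c] by simp
    qed
  qed
qed

section \<open>The norm of the commutator\<close>

definition osc :: "nat \<Rightarrow> cmat \<Rightarrow> real" where
  "osc n c = Max ((\<lambda>(i, k). mnorm n (blk i c - blk k c)) ` UNIV)"

lemma osc_ge: "mnorm n (blk i c - blk k c) \<le> osc n c"
  unfolding osc_def by (rule Max_ge) (auto intro: image_eqI[of _ _ "(i, k)"])

lemma osc_attained: obtains i k where "osc n c = mnorm n (blk i c - blk k c)"
proof -
  have "osc n c \<in> (\<lambda>(i, k). mnorm n (blk i c - blk k c)) ` UNIV"
    unfolding osc_def by (rule Max_in) auto
  then show ?thesis using that by auto
qed

lemma osc_le: "(\<And>i k. mnorm n (blk i c - blk k c) \<le> K) \<Longrightarrow> osc n c \<le> K"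
  by (metis osc_attained)

lemma osc_nonneg [simp]: "0 \<le> osc n c"
  using osc_ge[of n 1 c 1] mnorm_ge0 order_trans by blast

lemma act_entry:
  assumes "c \<in> ldiag n"
  shows "act n c z v $ i $ k = mapv n (blk i c) (\<lambda>w. z w $ i $ k) v"
proof -
  have "(\<Sum>l\<in>UNIV. c (v @ [i]) (w @ [l]) * z w $ l $ k) = c (v @ [i]) (w @ [i]) * z w $ i $ k" for w
  proof -
    have "(\<Sum>l\<in>UNIV. c (v @ [i]) (w @ [l]) * z w $ l $ k)
        = (\<Sum>l\<in>UNIV. if l = i then c (v @ [i]) (w @ [i]) * z w $ i $ k else 0)"
      by (rule sum.cong) (auto simp: ldiag_off[OF assms])
    then show ?thesis by simp
  qed
  then show ?thesis by (simp add: act_def mapv_def blk_def matrix_matrix_mult_def)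
qed

lemma hilb_norm_eq: "hilb_norm n z = sqrt (\<Sum>i\<in>UNIV. \<Sum>k\<in>UNIV. (vnorm n (\<lambda>v. z v $ i $ k))\<^sup>2)"
proof -
  have "Re (hilb_inner n z z) = (\<Sum>v\<in>words n. \<Sum>i\<in>UNIV. \<Sum>k\<in>UNIV. (cmod (z v $ i $ k))\<^sup>2)"
    unfolding hilb_inner_def Re_sum trace_def
  proof (rule sum.cong[OF refl])
    fix v
    have "(\<Sum>i\<in>UNIV. Re ((map_matrix cnj (transpose (z v)) ** z v) $ i $ i))
        = (\<Sum>k\<in>UNIV. \<Sum>i\<in>UNIV. (cmod (z v $ i $ k))\<^sup>2)"
      unfolding matrix_matrix_mult_def map_matrix_def transpose_def
      by (simp add: cmod_power2 flip: power2_eq_square)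
    also have "\<dots> = (\<Sum>i\<in>UNIV. \<Sum>k\<in>UNIV. (cmod (z v $ i $ k))\<^sup>2)" by (rule sum.swap)
    finally show "(\<Sum>i\<in>UNIV. Re ((map_matrix cnj (transpose (z v)) ** z v) $ i $ i))
        = (\<Sum>i\<in>UNIV. \<Sum>k\<in>UNIV. (cmod (z v $ i $ k))\<^sup>2)" .
  qed
  also have "\<dots> = (\<Sum>i\<in>UNIV. \<Sum>v\<in>words n. \<Sum>k\<in>UNIV. (cmod (z v $ i $ k))\<^sup>2)" by (rule sum.swap)
  also have "\<dots> = (\<Sum>i\<in>UNIV. \<Sum>k\<in>UNIV. \<Sum>v\<in>words n. (cmod (z v $ i $ k))\<^sup>2)"
    by (rule sum.cong[OF refl], rule sum.swap)
  finally show ?thesis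
    unfolding hilb_norm_def vnorm_sq by simp
qed

lemma hilb_norm_sq: "(hilb_norm n z)\<^sup>2 = (\<Sum>i\<in>UNIV. \<Sum>k\<in>UNIV. (vnorm n (\<lambda>v. z v $ i $ k))\<^sup>2)"
  by (simp add: hilb_norm_eq sum_nonneg)

lemma hilb_norm_nonneg [simp]: "0 \<le> hilb_norm n z"
  by (simp add: hilb_norm_eq sum_nonneg)

text \<open>Both orders of the product read the component \<open>(k, i)\<close> of \<open>z\<close>:
  acting before the transposition applies block \<open>k\<close> to it, acting after it applies
  block \<open>i\<close>.\<close>

lemma commutator_entry:
  assumes "c \<in> ldiag n"
  shows "(D_op n (act n c z) - act n c (D_op n z)) v $ i $ k
    = 2 ^ n * mapv n (blk k c - blk i c) (\<lambda>w. z w $ k $ i) v"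
  by (simp add: D_op_def F_op_def transpose_def act_entry[OF assms])
     (simp add: mapv_def sum_distrib_left sum_subtractf[symmetric] algebra_simps scaleR_conv_of_real)

lemma hilb_opnorm_commutator:
  assumes c: "c \<in> ldiag n"
  shows "hilb_opnorm n (\<lambda>z. D_op n (act n c z) - act n c (D_op n z)) = ennreal (2 ^ n * osc n c)"
proof (rule antisym)
  let ?T = "\<lambda>z. D_op n (act n c z) - act n c (D_op n z)"
  have norm_T: "(hilb_norm n (?T z))\<^sup>2
      = (\<Sum>i\<in>UNIV. \<Sum>k\<in>UNIV. (2 ^ n * vnorm n (mapv n (blk k c - blk i c) (\<lambda>w. z w $ k $ i)))\<^sup>2)" for z
    unfolding hilb_norm_sq commutator_entry[OF c] vnorm_scale by (simp add: norm_power)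
  show "hilb_opnorm n ?T \<le> ennreal (2 ^ n * osc n c)"
    unfolding hilb_opnorm_def
  proof (rule SUP_least, rule ennreal_leI)
    fix z assume "z \<in> {z \<in> hilb n. hilb_norm n z \<le> 1}"
    then have z: "hilb_norm n z \<le> 1" by simp
    have "(hilb_norm n (?T z))\<^sup>2
        \<le> (\<Sum>i\<in>UNIV. \<Sum>k\<in>UNIV. (2 ^ n * (osc n c * vnorm n (\<lambda>w. z w $ k $ i)))\<^sup>2)"
      unfolding norm_T
      by (intro sum_mono power_mono mult_left_mono order_trans[OF vnorm_mapv] mult_right_mono osc_ge) simp_all
    also have "\<dots> = (\<Sum>k\<in>UNIV. \<Sum>i\<in>UNIV. (2 ^ n * (osc n c * vnorm n (\<lambda>w. z w $ k $ i)))\<^sup>2)"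
      by (rule sum.swap)
    also have "\<dots> = (2 ^ n * osc n c * hilb_norm n z)\<^sup>2"
      by (simp add: power_mult_distrib hilb_norm_sq sum_distrib_left mult.assoc)
    finally have "hilb_norm n (?T z) \<le> 2 ^ n * osc n c * hilb_norm n z"
      by (rule power2_le_imp_le) simp
    also have "\<dots> \<le> 2 ^ n * osc n c * 1" by (intro mult_left_mono z) simp
    finally show "hilb_norm n (?T z) \<le> 2 ^ n * osc n c" by simp
  qed
  show "ennreal (2 ^ n * osc n c) \<le> hilb_opnorm n ?T"
  proof (cases "hilb_opnorm n ?T")
    case (real s)
    obtain i k where ik: "osc n c = mnorm n (blk i c - blk k c)" by (rule osc_attained)
    show ?thesis
    \<comment> \<open>Equal indices mean oscillation 0, where nothing is to be shown. Otherwise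
      \<open>(i, k)\<close> is an off-diagonal place, where a test vector may live.\<close>
    proof (cases "i = k")
      case True
      then show ?thesis using ik by simp
    next
      case False
      have "mnorm n (blk i c - blk k c) \<le> s / 2 ^ n"
        unfolding mnorm_def
      proof (rule cSUP_least)
        show "{z. vnorm n z \<le> 1} \<noteq> {}"
          by (auto intro!: exI[of _ "\<lambda>_. 0"] simp: vnorm_def)
        fix \<zeta> :: "3 list \<Rightarrow> complex" assume "\<zeta> \<in> {z. vnorm n z \<le> 1}"
        then have \<zeta>: "vnorm n \<zeta> \<le> 1" by simp
        \<comment> \<open>Only the component \<open>(i, k)\<close> is occupied. Cutting off outside
          \<open>words n\<close> puts \<open>z\<close> in \<open>hilb n\<close>, since
          \<open>\<zeta>\<close> is an arbitrary function.\<close>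
        define z :: evec where "z v = (\<chi> p q. if p = i \<and> q = k \<and> v \<in> words n then \<zeta> v else 0)" for v
        have z_hilb: "z \<in> hilb n" using False by (auto simp: hilb_def offdiag_def z_def vec_eq_iff)
        have comp: "vnorm n (\<lambda>v. z v $ p $ q) = (if p = i \<and> q = k then vnorm n \<zeta> else 0)" for p q
          by (auto simp: vnorm_def z_def)
        have "(hilb_norm n z)\<^sup>2 = (\<Sum>p\<in>UNIV. \<Sum>q\<in>UNIV. if p = i then if q = k then (vnorm n \<zeta>)\<^sup>2 else 0 else 0)"
          unfolding hilb_norm_sq comp by (intro sum.cong) auto
        also have "\<dots> = (vnorm n \<zeta>)\<^sup>2" by (simp add: sum.If_cases if_distrib[of "sum _"] cong: if_cong)
        finally have "(hilb_norm n z)\<^sup>2 \<le> 1\<^sup>2" using \<zeta> by (simp add: power_le_one)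
        then have "hilb_norm n z \<le> 1" by (rule power2_le_imp_le) simp
        then have "ennreal (hilb_norm n (?T z)) \<le> ennreal s"
          unfolding real(2)[symmetric] hilb_opnorm_def using z_hilb by (intro SUP_upper) simp
        then have T: "hilb_norm n (?T z) \<le> s" using real by (simp add: ennreal_le_iff)
        let ?f = "\<lambda>p q. (2 ^ n * vnorm n (mapv n (blk q c - blk p c) (\<lambda>w. z w $ q $ p)))\<^sup>2"
        have "mapv n (blk i c - blk k c) (\<lambda>w. z w $ i $ k) = mapv n (blk i c - blk k c) \<zeta>"
          by (auto simp: mapv_def z_def)
        then have "(2 ^ n * vnorm n (mapv n (blk i c - blk k c) \<zeta>))\<^sup>2 = ?f k i" by simp
        also have "\<dots> \<le> (\<Sum>q\<in>UNIV. ?f k q)" by (rule member_le_sum[of i UNIV "?f k"]) simp_all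
        also have "\<dots> \<le> (\<Sum>p\<in>UNIV. \<Sum>q\<in>UNIV. ?f p q)"
          by (rule member_le_sum[of k UNIV "\<lambda>p. \<Sum>q\<in>UNIV. ?f p q"]) (simp_all add: sum_nonneg)
        also have "\<dots> = (hilb_norm n (?T z))\<^sup>2" by (rule norm_T[symmetric])
        finally have "2 ^ n * vnorm n (mapv n (blk i c - blk k c) \<zeta>) \<le> hilb_norm n (?T z)"
          by (rule power2_le_imp_le) simp
        then show "vnorm n (mapv n (blk i c - blk k c) \<zeta>) \<le> s / 2 ^ n"
          using T by (simp add: field_simps)
      qed
      then show ?thesis using real by (simp add: ik field_simps ennreal_leI)
    qed
  qed simp
qed

section \<open>Slice maps on the gasket algebra\<close>

lemma slice_append:
  assumes "v \<in> words (Suc n)" "w \<in> words (Suc n)"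
  shows "slice n m x v w = x (v @ replicate (m - Suc n) 2) (w @ replicate (m - Suc n) 2)"
  using assms by (simp add: slice_def)

lemma slice_outside: "v \<notin> words (Suc n) \<or> w \<notin> words (Suc n) \<Longrightarrow> slice n m x v w = 0"
  by (auto simp: slice_def)

lemma slice_M3 [simp]: "slice n m x \<in> M3 (Suc n)"
  by (rule M_I) (rule slice_outside)

lemma slice_add: "slice n m (x + y) = slice n m x + slice n m y"
  and slice_diff: "slice n m (x - y) = slice n m x - slice n m y"
  and slice_scale: "slice n m (mscale c x) = mscale c (slice n m x)"
  and slice_adj: "slice n m (madj x) = madj (slice n m x)"
  by (auto simp: slice_def mscale_def madj_def fun_eq_iff)

lemma mnorm_slice:
  assumes "Suc n \<le> m"
  shows "mnorm (Suc n) (slice n m x) \<le> mnorm m x"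
proof -
  let ?r = "replicate (m - Suc n) (2 :: 3)"
  have "mnorm (Suc n) (slice n m x) = mnorm (Suc n) (\<lambda>v w. x (v @ ?r) (w @ ?r))"
    by (rule mnorm_cong) (rule slice_append)
  then show ?thesis using mnorm_compress[of "Suc n" x ?r] assms by simp
qed

lemma slice_entry_le:
  assumes "Suc n \<le> m"
  shows "cmod (slice n m x v w) \<le> mnorm m x"
proof (cases "v \<in> words (Suc n) \<and> w \<in> words (Suc n)")
  case True
  then show ?thesis using mnorm_entry[of v "Suc n" w "slice n m x"] mnorm_slice[OF assms, of x] by simp
next
  case False
  then show ?thesis using slice_outside[of v n w m x] by auto
qed

text \<open>The state has value 1 at the unit, so appended unit factors disappear.\<close>

lemma slice_amp:
  assumes "Suc n \<le> m"
  shows "slice n (m + k) (amp m k x) = slice n m x"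
proof (intro ext)
  fix v w
  show "slice n (m + k) (amp m k x) v w = slice n m x v w"
  proof (cases "v \<in> words (Suc n) \<and> w \<in> words (Suc n)")
    case True
    let ?r = "replicate (m - Suc n) (2 :: 3)" and ?s = "replicate k (2 :: 3)"
    have r: "v @ ?r \<in> words m" "w @ ?r \<in> words m" "?s \<in> words k"
      using True assms by (simp_all add: words_def)
    have "m + k - Suc n = (m - Suc n) + k" using assms by simp
    then have "replicate (m + k - Suc n) (2 :: 3) = ?r @ ?s" by (simp only: replicate_add)
    then show ?thesis
      using True amp_append[OF r(1,2) r(3) r(3), of x] by (simp add: slice_append)
  next
    case False
    then show ?thesis using slice_outside[of v n w] by auto
  qed
qed

text \<open>Evaluating the last factor first reduces facts about slices to facts about block 2 and
  an induction on the level.\<close>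

lemma slice_blk_2:
  assumes "n \<le> m"
  shows "slice n (Suc (Suc m)) c = slice n (Suc m) (blk 2 c)"
proof (intro ext)
  fix v w
  have "replicate (Suc (Suc m) - Suc n) (2 :: 3) = replicate (Suc m - Suc n) 2 @ [2]"
    using assms by (simp add: Suc_diff_le replicate_append_same)
  then show "slice n (Suc (Suc m)) c v w = slice n (Suc m) (blk 2 c) v w"
    unfolding slice_def blk_def by (simp only: append_assoc Suc_eq_plus1[symmetric])
qed

lemma blk_2_slice:
  assumes "Suc (Suc n) \<le> m"
  shows "blk 2 (slice (Suc n) m x) = slice n m x"
proof (intro ext)
  fix v w
  have "m - Suc n = Suc (m - Suc (Suc n))" using assms by simp
  then have "replicate (m - Suc n) (2 :: 3) = 2 # replicate (m - Suc (Suc n)) 2" by simp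
  then show "blk 2 (slice (Suc n) m x) v w = slice n m x v w"
    unfolding slice_def blk_def by simp
qed

lemma slice_same: "c \<in> M3 (Suc n) \<Longrightarrow> slice n (Suc n) c = c"
  by (rule M_eqI[of _ "Suc n"]) (simp_all add: slice_append)

lemma slice_gblock:
  assumes "n \<le> m" "c \<in> gblock m"
  shows "slice n (Suc m) c \<in> gblock n"
  using assms
proof (induction m arbitrary: c rule: dec_induct)
  case base
  then show ?case by (simp add: slice_same)
next
  case (step m)
  then show ?case by (simp add: slice_blk_2)
qed

text \<open>A slice by a vector state is not multiplicative on all matrices. Here each evaluated
  factor is diagonal, and taking a block of block-diagonal matrices respects products.\<close>

lemma slice_mul:
  assumes "n \<le> m" "c \<in> gblock m" "d \<in> gblock m"
  shows "slice n (Suc m) (mmul (Suc m) c d) = mmul (Suc n) (slice n (Suc m) c) (slice n (Suc m) d)"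
  using assms
proof (induction m arbitrary: c d rule: dec_induct)
  case base
  then show ?case by (simp add: slice_same)
next
  case (step m)
  then have "c \<in> ldiag (Suc m)" by simp
  with step show ?case by (simp add: slice_blk_2 blk_mul)
qed

section \<open>Slice maps on the inductive limit\<close>

lemma uhf_repr:
  fixes a :: uhf
  obtains X where "uhf_seq X" "a = abs_uhf X"
proof -
  have "uhf_seq (rep_uhf a)"
    using Quotient_rep_reflp[OF Quotient_uhf, of a] by (simp add: uhf_rel_refl)
  moreover have "a = abs_uhf (rep_uhf a)" by (rule Quotient_abs_rep[OF Quotient_uhf, symmetric])
  ultimately show ?thesis using that by blast
qed

text \<open>The definition of \<open>rho\<close> by \<open>lim\<close> carries information only once
  convergence is known. It holds because slices are contractive and do not change under
  amplification.\<close>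

lemma rho_LIMSEQ:
  assumes X: "uhf_seq X"
  shows "(\<lambda>m. slice n m (X m) v w) \<longlonglongrightarrow> rho n (abs_uhf X) v w"
proof -
  have "Cauchy (\<lambda>m. slice n m (X m) v w)"
    unfolding Cauchy_altdef
  proof (intro allI impI)
    fix e :: real assume "e > 0"
    from uhf_seqD[OF X this] obtain N
      where N: "\<And>m k. N \<le> m \<Longrightarrow> mnorm (m + k) (X (m + k) - amp m k (X m)) < e" by blast
    show "\<exists>N. \<forall>m\<ge>N. \<forall>l>m. dist (slice n m (X m) v w) (slice n l (X l) v w) < e"
    proof (intro exI allI impI)
      fix m l assume m: "max N (Suc n) \<le> m" and "m < l"
      then obtain k where l: "l = m + k" using less_imp_add_positive by blast
      have "slice n l (X l) v w - slice n m (X m) v w = slice n (m + k) (X (m + k) - amp m k (X m)) v w"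
        using m by (simp add: l slice_diff slice_amp)
      then show "dist (slice n m (X m) v w) (slice n l (X l) v w) < e"
        using slice_entry_le[of n "m + k" "X (m + k) - amp m k (X m)" v w] N[of m k] m
        by (simp add: dist_norm norm_minus_commute)
    qed
  qed
  then have "convergent (\<lambda>m. slice n m (X m) v w)" by (rule Cauchy_convergent)
  moreover have "rho n (abs_uhf X) = (\<lambda>v w. lim (\<lambda>m. slice n m (X m) v w))"
    by (rule rho.abs_eq) (simp add: uhf_rel_refl X)
  ultimately show ?thesis by (simp add: convergent_LIMSEQ_iff)
qed

lemma rho_M3 [simp]: "rho n a \<in> M3 (Suc n)"
proof -
  obtain X where X: "uhf_seq X" "a = abs_uhf X" by (rule uhf_repr)
  show ?thesis
    by (rule M3_limit[of "\<lambda>m. slice n m (X m)"]) (use rho_LIMSEQ[OF X(1)] X(2) in simp_all)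
qed

lemma rho_add: "rho n (a + b) = rho n a + rho n b"
proof (intro ext)
  fix v w
  obtain X where X: "uhf_seq X" "a = abs_uhf X" by (rule uhf_repr)
  obtain Y where Y: "uhf_seq Y" "b = abs_uhf Y" by (rule uhf_repr)
  have "a + b = abs_uhf (\<lambda>n. X n + Y n)"
    unfolding X(2) Y(2) by (rule plus_uhf.abs_eq) (simp_all add: uhf_rel_refl X Y)
  then have "(\<lambda>m. slice n m (X m + Y m) v w) \<longlonglongrightarrow> rho n (a + b) v w"
    using rho_LIMSEQ[OF uhf_seq_add[OF X(1) Y(1)]] by simp
  moreover have "(\<lambda>m. slice n m (X m) v w + slice n m (Y m) v w) \<longlonglongrightarrow> rho n a v w + rho n b v w"
    unfolding X(2) Y(2) by (intro tendsto_add rho_LIMSEQ X Y)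
  ultimately show "rho n (a + b) v w = (rho n a + rho n b) v w"
    by (simp add: slice_add LIMSEQ_unique)
qed

lemma rho_scaleC: "rho n (c *\<^sub>C a) = mscale c (rho n a)"
proof (intro ext)
  fix v w
  obtain X where X: "uhf_seq X" "a = abs_uhf X" by (rule uhf_repr)
  have "c *\<^sub>C a = abs_uhf (\<lambda>n. mscale c (X n))"
    unfolding X(2) scaleC_uhf_def by (rule uhf_scaleC.abs_eq) (simp add: uhf_rel_refl X)
  then have "(\<lambda>m. slice n m (mscale c (X m)) v w) \<longlonglongrightarrow> rho n (c *\<^sub>C a) v w"
    using rho_LIMSEQ[OF uhf_seq_scale[OF X(1)]] by simp
  moreover have "(\<lambda>m. mscale c (slice n m (X m)) v w) \<longlonglongrightarrow> mscale c (rho n a) v w"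
    unfolding X(2) mscale_def by (intro tendsto_mult_left rho_LIMSEQ X)
  ultimately show "rho n (c *\<^sub>C a) v w = mscale c (rho n a) v w"
    unfolding slice_scale by (rule LIMSEQ_unique)
qed

lemma rho_star: "rho n (star a) = madj (rho n a)"
proof (intro ext)
  fix v w
  obtain X where X: "uhf_seq X" "a = abs_uhf X" by (rule uhf_repr)
  have "star a = abs_uhf (\<lambda>n. madj (X n))"
    unfolding X(2) by (rule star_uhf.abs_eq) (simp add: uhf_rel_refl X)
  then have "(\<lambda>m. slice n m (madj (X m)) v w) \<longlonglongrightarrow> rho n (star a) v w"
    using rho_LIMSEQ[OF uhf_seq_adj[OF X(1)]] by simp
  moreover have "(\<lambda>m. madj (slice n m (X m)) v w) \<longlonglongrightarrow> madj (rho n a) v w"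
    unfolding X(2) madj_def by (intro tendsto_cnj rho_LIMSEQ X)
  ultimately show "rho n (star a) v w = madj (rho n a) v w"
    unfolding slice_adj by (rule LIMSEQ_unique)
qed

lemma rho_diff: "rho n (a - b) = rho n a - rho n b"
proof -
  have "rho n (- b) = - rho n b"
    using rho_scaleC[of n "- 1" b] by (simp only: scaleC_minus_one mscale_minus1)
  then show ?thesis using rho_add[of n a "- b"] by (simp only: diff_conv_add_uminus)
qed

lemma mnorm_le_entries: "mnorm n x \<le> (\<Sum>v\<in>words n. \<Sum>w\<in>words n. cmod (x v w))"
  by (rule mnorm_least[OF _ vnorm_mapv_bound]) (intro sum_nonneg norm_ge_zero)

text \<open>For matrices of fixed size the sum of the entries of the difference bounds its norm, so
  entrywise convergence is enough.\<close>

lemma mnorm_limit_le: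
  assumes "\<And>v w. (\<lambda>k::nat. s k v w) \<longlonglongrightarrow> c v w" "B \<longlonglongrightarrow> b" "\<And>k. N \<le> k \<Longrightarrow> mnorm n (s k) \<le> B k"
  shows "mnorm n c \<le> b"
proof (rule LIMSEQ_le_const)
  have "(\<lambda>k. (\<Sum>v\<in>words n. \<Sum>w\<in>words n. cmod (c v w - s k v w)) + B k)
      \<longlonglongrightarrow> (\<Sum>v\<in>words n. \<Sum>w\<in>words n. cmod (c v w - c v w)) + b"
    by (intro tendsto_intros assms)
  then show "(\<lambda>k. (\<Sum>v\<in>words n. \<Sum>w\<in>words n. cmod (c v w - s k v w)) + B k) \<longlonglongrightarrow> b" by simp
  show "\<exists>N. \<forall>k\<ge>N. mnorm n c \<le> (\<Sum>v\<in>words n. \<Sum>w\<in>words n. cmod (c v w - s k v w)) + B k"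
  proof (intro exI allI impI)
    fix k assume "N \<le> k"
    then show "mnorm n c \<le> (\<Sum>v\<in>words n. \<Sum>w\<in>words n. cmod (c v w - s k v w)) + B k"
      using mnorm_triangle[of n "c - s k" "s k"] mnorm_le_entries[of n "c - s k"] assms(3)[of k] by simp
  qed
qed

lemma mnorm_rho: "mnorm (Suc n) (rho n a) \<le> norm a"
proof -
  obtain X where X: "uhf_seq X" "a = abs_uhf X" by (rule uhf_repr)
  show ?thesis
  proof (rule mnorm_limit_le)
    show "(\<lambda>m. slice n m (X m) v w) \<longlonglongrightarrow> rho n a v w" for v w unfolding X(2) by (rule rho_LIMSEQ[OF X(1)])
    show "(\<lambda>m. mnorm m (X m)) \<longlonglongrightarrow> norm a"
      unfolding X(2) norm_abs_uhf[OF X(1)] by (rule seqnorm_LIMSEQ[OF X(1)])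
    show "mnorm (Suc n) (slice n m (X m)) \<le> mnorm m (X m)" if "Suc n \<le> m" for m
      using that by (rule mnorm_slice)
  qed
qed

lemma rho_tendsto:
  assumes "f \<longlonglongrightarrow> a"
  shows "(\<lambda>k. rho n (f k) v w) \<longlonglongrightarrow> rho n a v w"
proof (rule Lim_transform)
  show "(\<lambda>k. rho n a v w) \<longlonglongrightarrow> rho n a v w" by simp
  have "(\<lambda>k. norm (f k - a)) \<longlonglongrightarrow> 0" using assms by (simp add: LIM_zero tendsto_norm_zero)
  then show "(\<lambda>k. rho n (f k) v w - rho n a v w) \<longlonglongrightarrow> 0"
  proof (rule Lim_null_comparison[rotated], intro eventuallyI[rule_format] always_eventually allI)
    fix k
    have "cmod (rho n (f k - a) v w) \<le> norm (f k - a)"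
    proof (cases "v \<in> words (Suc n) \<and> w \<in> words (Suc n)")
      case True
      then show ?thesis using mnorm_entry[of v "Suc n" w] mnorm_rho order_trans by blast
    next
      case False
      then show ?thesis using M_outside[OF rho_M3] by simp
    qed
    then show "norm (rho n (f k) v w - rho n a v w) \<le> norm (f k - a)" by (simp add: rho_diff)
  qed
qed

lemma blk_2_rho: "blk 2 (rho (Suc n) a) = rho n a"
proof (intro ext)
  fix v w
  obtain X where X: "uhf_seq X" "a = abs_uhf X" by (rule uhf_repr)
  have "(\<lambda>m. blk 2 (slice (Suc n) m (X m)) v w) \<longlonglongrightarrow> blk 2 (rho (Suc n) a) v w"
    unfolding blk_def X(2) by (rule rho_LIMSEQ[OF X(1)])
  then have "(\<lambda>m. slice n m (X m) v w) \<longlonglongrightarrow> blk 2 (rho (Suc n) a) v w"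
    by (rule Lim_transform_eventually)
       (auto simp: blk_2_slice intro!: eventually_sequentiallyI[of "Suc (Suc n)"])
  then show "blk 2 (rho (Suc n) a) v w = rho n a v w"
    using rho_LIMSEQ[OF X(1), of n v w] unfolding X(2) by (rule LIMSEQ_unique)
qed

lemma rho_iota_gblock: "s \<in> gblock m \<Longrightarrow> n \<le> m \<Longrightarrow> rho n (iota (Suc m) s) = slice n (Suc m) s"
  by (rule rho_iota) simp_all

lemma slice_rho: "n \<le> m \<Longrightarrow> slice n (Suc m) (rho m a) = rho n a"
  by (induction m rule: dec_induct) (simp_all add: slice_same slice_blk_2 blk_2_rho)

lemma gasketI: "(\<And>n. s n \<in> gblock n) \<Longrightarrow> (\<lambda>n. iota (Suc n) (s n)) \<longlonglongrightarrow> a \<Longrightarrow> a \<in> gasket"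
  by (auto simp: gasket_def gasket_fin_eq_gblock)

lemma gasketE:
  assumes "a \<in> gasket"
  obtains s where "\<And>n. s n \<in> gblock n" "(\<lambda>n. iota (Suc n) (s n)) \<longlonglongrightarrow> a"
  using assms by (auto simp: gasket_def gasket_fin_eq_gblock)

lemma rho_gblock:
  assumes "a \<in> gasket"
  shows "rho n a \<in> gblock n"
proof -
  obtain s where s: "\<And>n. s n \<in> gblock n" "(\<lambda>n. iota (Suc n) (s n)) \<longlonglongrightarrow> a"
    using gasketE[OF assms] by blast
  \<comment> \<open>The shift by \<open>n\<close> puts every term at a level where the slice of
    index \<open>n\<close> is available.\<close>
  let ?t = "\<lambda>k. iota (Suc (k + n)) (s (k + n))"
  have t: "rho n (?t k) = slice n (Suc (k + n)) (s (k + n))" for k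
    using s(1) by (rule rho_iota_gblock) simp
  show ?thesis
  proof (rule gblock_limit)
    show "rho n (?t k) \<in> gblock n" for k unfolding t by (rule slice_gblock) (simp_all add: s(1))
    show "(\<lambda>k. rho n (?t k) v w) \<longlonglongrightarrow> rho n a v w" for v w
      by (rule rho_tendsto, rule LIMSEQ_ignore_initial_segment[OF s(2)])
  qed
qed

lemma norm_iota_rho_diff: "norm (iota (Suc n) (rho n a) - iota (Suc n) (rho n b)) \<le> norm (a - b)"
  using mnorm_rho[of n "a - b"] by (simp add: iota_diff norm_iota rho_diff)

text \<open>Since \<open>rho n\<close> fixes \<open>s n\<close> and is contractive,
  \<open>rho n a\<close> is at least as close to \<open>s n\<close> as \<open>a\<close> is. Thus any
  approximating sequence may be replaced by this canonical one.\<close>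

lemma iota_rho_tendsto:
  assumes "a \<in> gasket"
  shows "(\<lambda>n. iota (Suc n) (rho n a)) \<longlonglongrightarrow> a"
proof -
  obtain s where s: "\<And>n. s n \<in> gblock n" "(\<lambda>n. iota (Suc n) (s n)) \<longlonglongrightarrow> a"
    using gasketE[OF assms] by blast
  have s': "(\<lambda>n. norm (a - iota (Suc n) (s n))) \<longlonglongrightarrow> 0"
    using tendsto_norm_zero[OF LIM_zero[OF s(2)]] by (simp add: norm_minus_commute)
  have "rho n (iota (Suc n) (s n)) = s n" for n
    using s(1)[of n] rho_iota_gblock[of "s n" n n] by (simp add: slice_same)
  then have "norm (iota (Suc n) (rho n a) - iota (Suc n) (s n)) \<le> norm (a - iota (Suc n) (s n))" for n
    using norm_iota_rho_diff[of n a "iota (Suc n) (s n)"] by simp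
  then have "(\<lambda>n. iota (Suc n) (rho n a) - iota (Suc n) (s n)) \<longlonglongrightarrow> 0"
    by (intro Lim_null_comparison[OF _ s']) simp
  from tendsto_add[OF this s(2)] show ?thesis by simp
qed

text \<open>Approximate both factors by their own slices at level \<open>m\<close>. From
  \<open>m = n\<close> on, multiplicativity at finite level makes the sliced product constant in
  \<open>m\<close>.\<close>

lemma rho_mul:
  assumes a: "a \<in> gasket" and b: "b \<in> gasket"
  shows "rho n (a * b) = mmul (Suc n) (rho n a) (rho n b)"
proof (intro ext)
  fix v w
  let ?f = "\<lambda>m. iota (Suc m) (rho m a) * iota (Suc m) (rho m b)"
  have "?f \<longlonglongrightarrow> a * b" by (intro tendsto_mult iota_rho_tendsto a b)
  then have "(\<lambda>m. rho n (?f m) v w) \<longlonglongrightarrow> rho n (a * b) v w" by (rule rho_tendsto)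
  moreover have "rho n (?f m) = mmul (Suc n) (rho n a) (rho n b)" if m: "n \<le> m" for m
  proof -
    have "rho n (?f m) = rho n (iota (Suc m) (mmul (Suc m) (rho m a) (rho m b)))"
      by (simp add: iota_mul)
    also have "\<dots> = slice n (Suc m) (mmul (Suc m) (rho m a) (rho m b))"
      using m by (intro rho_iota_gblock gblock_mul rho_gblock a b)
    also have "\<dots> = mmul (Suc n) (rho n a) (rho n b)"
      using slice_mul[OF m rho_gblock[OF a] rho_gblock[OF b]] m by (simp add: slice_rho)
    finally show ?thesis .
  qed
  then have "(\<lambda>m. rho n (?f m) v w) \<longlonglongrightarrow> mmul (Suc n) (rho n a) (rho n b) v w"
    by (intro tendsto_eventually eventually_sequentiallyI[of n]) simp
  ultimately show "rho n (a * b) v w = mmul (Suc n) (rho n a) (rho n b) v w"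
    by (rule LIMSEQ_unique)
qed

lemma rho_one: "rho n 1 = mone (Suc n)"
  using rho_iota[of "mone (Suc n)" "Suc n" n] by (simp add: iota_one slice_same)

section \<open>The gasket algebra as a unital C*-subalgebra\<close>

lemma tendsto_star: "f \<longlonglongrightarrow> a \<Longrightarrow> (\<lambda>k. star (f k)) \<longlonglongrightarrow> star (a :: 'a::unital_cstar_algebra)"
  by (rule bounded_linear.tendsto[OF bounded_linear_star])

lemma bounded_linear_scaleC_right: "bounded_linear (\<lambda>x. c *\<^sub>C (x :: 'a::unital_cstar_algebra))"
  by (rule bounded_linear_intro[of _ "cmod c"])
     (simp_all add: scaleC_add_right scaleR_scaleC scaleC_scaleC norm_scaleC mult.commute)

text \<open>The slices of the limit serve as approximating sequence. They converge by an
  \<open>e / 3\<close> argument, because passing to slices is contractive uniformly in the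
  level.\<close>

lemma closed_gasket: "closed gasket"
  unfolding closed_sequential_limits
proof (intro allI impI, elim conjE)
  fix x a assume x: "\<forall>k. x k \<in> gasket" and lim: "x \<longlonglongrightarrow> a"
  show "a \<in> gasket"
  proof (rule gasketI)
    show "rho n a \<in> gblock n" for n
      by (rule gblock_limit[OF _ rho_tendsto[OF lim]]) (simp add: rho_gblock x)
    show "(\<lambda>n. iota (Suc n) (rho n a)) \<longlonglongrightarrow> a"
    proof (rule LIMSEQ_I)
      fix e :: real assume "e > 0"
      then have e: "e / 3 > 0" by simp
      obtain k where k: "norm (x k - a) < e / 3" using LIMSEQ_D[OF lim e] by blast
      obtain N where N: "\<And>n. N \<le> n \<Longrightarrow> norm (iota (Suc n) (rho n (x k)) - x k) < e / 3"
        using LIMSEQ_D[OF iota_rho_tendsto e] x by blast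
      show "\<exists>N. \<forall>n\<ge>N. norm (iota (Suc n) (rho n a) - a) < e"
      proof (intro exI allI impI)
        fix n assume n: "N \<le> n"
        let ?p = "iota (Suc n) (rho n a) - iota (Suc n) (rho n (x k))" and ?q = "iota (Suc n) (rho n (x k)) - x k"
        have "norm (iota (Suc n) (rho n a) - a) = norm (?p + ?q + (x k - a))" by simp
        also have "\<dots> \<le> norm ?p + norm ?q + norm (x k - a)"
          by (intro order_trans[OF norm_triangle_ineq] add_mono norm_triangle_ineq) simp
        also have "\<dots> < e"
          using norm_iota_rho_diff[of n a "x k"] N[OF n] k by (simp add: norm_minus_commute)
        finally show "norm (iota (Suc n) (rho n a) - a) < e" .
      qed
    qed
  qed
qed

lemma unital_cstar_subalgebra_gasket: "unital_cstar_subalgebra gasket"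
proof -
  have one: "1 \<in> gasket"
  proof (rule gasketI)
    show "mone (Suc n) \<in> gblock n" for n by (rule gblock_one)
    show "(\<lambda>n. iota (Suc n) (mone (Suc n))) \<longlonglongrightarrow> 1" unfolding iota_one by (rule tendsto_const)
  qed
  have add: "a + b \<in> gasket" if "a \<in> gasket" "b \<in> gasket" for a b
  proof (rule gasketI)
    show "(\<lambda>n. iota (Suc n) (rho n a + rho n b)) \<longlonglongrightarrow> a + b"
      using tendsto_add[OF iota_rho_tendsto[OF that(1)] iota_rho_tendsto[OF that(2)]] by (simp add: iota_add)
  qed (intro gblock_add rho_gblock that)
  have scale: "c *\<^sub>C a \<in> gasket" if "a \<in> gasket" for c a
  proof (rule gasketI)
    show "(\<lambda>n. iota (Suc n) (mscale c (rho n a))) \<longlonglongrightarrow> c *\<^sub>C a"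
      using bounded_linear.tendsto[OF bounded_linear_scaleC_right iota_rho_tendsto[OF that]]
      by (simp add: iota_scale)
  qed (intro gblock_scale rho_gblock that)
  have mult: "a * b \<in> gasket" if "a \<in> gasket" "b \<in> gasket" for a b
  proof (rule gasketI)
    show "(\<lambda>n. iota (Suc n) (mmul (Suc n) (rho n a) (rho n b))) \<longlonglongrightarrow> a * b"
      using tendsto_mult[OF iota_rho_tendsto[OF that(1)] iota_rho_tendsto[OF that(2)]] by (simp add: iota_mul)
  qed (intro gblock_mul rho_gblock that)
  have st: "star a \<in> gasket" if "a \<in> gasket" for a
  proof (rule gasketI)
    show "(\<lambda>n. iota (Suc n) (madj (rho n a))) \<longlonglongrightarrow> star a"
      using tendsto_star[OF iota_rho_tendsto[OF that]] by (simp add: iota_adj)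
  qed (intro gblock_adj rho_gblock that)
  have "0 \<in> gasket" using add[OF one scale[OF one, of "- 1"]] unfolding scaleC_minus_one by simp
  then show ?thesis
    unfolding unital_cstar_subalgebra_def star_subalgebra_def
    using one add scale mult st closed_gasket by simp
qed

section \<open>Estimates for the Lipschitz seminorm\<close>

lemma osc_add: "osc n (c + d) \<le> osc n c + osc n d"
proof (rule osc_le)
  fix i k
  have "blk i (c + d) - blk k (c + d) = (blk i c - blk k c) + (blk i d - blk k d)"
    by (simp add: blk_add)
  then show "mnorm n (blk i (c + d) - blk k (c + d)) \<le> osc n c + osc n d"
    by (simp only:) (rule order_trans[OF mnorm_triangle add_mono[OF osc_ge osc_ge]])
qed

lemma osc_scale_le: "osc n (mscale r c) \<le> cmod r * osc n c"
proof (rule osc_le)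
  fix i k
  show "mnorm n (blk i (mscale r c) - blk k (mscale r c)) \<le> cmod r * osc n c"
    unfolding blk_scale mscale_simps(2)[symmetric] mnorm_scale by (intro mult_left_mono osc_ge) simp
qed

lemma osc_scale: "osc n (mscale r c) = cmod r * osc n c"
proof (rule antisym[OF osc_scale_le])
  obtain i k where ik: "osc n c = mnorm n (blk i c - blk k c)" by (rule osc_attained)
  have "cmod r * osc n c = mnorm n (blk i (mscale r c) - blk k (mscale r c))"
    unfolding ik blk_scale mscale_simps(2)[symmetric] mnorm_scale ..
  then show "cmod r * osc n c \<le> osc n (mscale r c)" using osc_ge by simp
qed

lemma osc_adj: "osc n (madj c) = osc n c"
  unfolding osc_def blk_adj madj_diff[symmetric] mnorm_adj ..

text \<open>The Leibniz rule, from \<open>x y - x' y' = (x - x') y + x' (y - y')\<close> applied to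
  blocks. It makes the elements of finite \<open>gasket_L\<close> closed under products.\<close>

lemma osc_mul:
  assumes "c \<in> ldiag n" "d \<in> ldiag n"
  shows "osc n (mmul (Suc n) c d) \<le> osc n c * mnorm (Suc n) d + mnorm (Suc n) c * osc n d"
proof (rule osc_le)
  fix i k
  have "blk i (mmul (Suc n) c d) - blk k (mmul (Suc n) c d)
      = mmul n (blk i c - blk k c) (blk i d) + mmul n (blk k c) (blk i d - blk k d)"
    using assms by (simp add: blk_mul mmul_diff_left mmul_diff_right)
  then have "mnorm n (blk i (mmul (Suc n) c d) - blk k (mmul (Suc n) c d))
      \<le> mnorm n (blk i c - blk k c) * mnorm n (blk i d) + mnorm n (blk k c) * mnorm n (blk i d - blk k d)"
    by (simp only:) (rule order_trans[OF mnorm_triangle add_mono[OF mnorm_mul mnorm_mul]])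
  also have "\<dots> \<le> osc n c * mnorm (Suc n) d + mnorm (Suc n) c * osc n d"
    by (intro add_mono mult_mono osc_ge mnorm_blk) simp_all
  finally show "mnorm n (blk i (mmul (Suc n) c d) - blk k (mmul (Suc n) c d))
      \<le> osc n c * mnorm (Suc n) d + mnorm (Suc n) c * osc n d" .
qed

text \<open>All blocks of an amplification are equal, and each of the two compared blocks of
  \<open>c\<close> differs from that common value by at most the distance.\<close>

lemma osc_le_dist_amp:
  assumes "d \<in> M3 n"
  shows "osc n c \<le> 2 * mnorm (Suc n) (c - amp n 1 d)"
proof (rule osc_le)
  fix i k
  let ?e = "c - amp n 1 d"
  have "mnorm n (blk i c - blk k c) \<le> mnorm n (blk i c - d) + mnorm n (d - blk k c)"
    by (rule mnorm_diff_triangle)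
  also have "\<dots> = mnorm n (blk i ?e) + mnorm n (blk k ?e)"
    unfolding blk_diff blk_amp[OF assms] mnorm_minus_commute[of n d] ..
  also have "\<dots> \<le> mnorm (Suc n) ?e + mnorm (Suc n) ?e"
    by (intro add_mono mnorm_blk)
  also have "\<dots> = 2 * mnorm (Suc n) ?e" by (rule mult_2[symmetric])
  finally show "mnorm n (blk i c - blk k c) \<le> 2 * mnorm (Suc n) ?e" .
qed

lemma osc_le_norm: "osc n c \<le> 2 * mnorm (Suc n) c"
  using osc_le_dist_amp[OF M_0, of n c] unfolding amp_0 diff_zero .

text \<open>In the limit algebra \<open>blk i c\<close> is the same as its amplification, and
  subtracting the latter from \<open>c\<close> leaves the blocks
  \<open>blk k c - blk i c\<close>.\<close>

lemma norm_iota_blk_diff: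
  assumes "c \<in> ldiag n"
  shows "norm (iota (Suc n) c - iota n (blk i c)) \<le> osc n c"
proof -
  have b: "blk i c \<in> M3 n" using assms by simp
  have "mnorm (Suc n) (c - amp n 1 (blk i c)) \<le> osc n c"
    by (rule mnorm_ldiag[OF ldiag_diff[OF assms ldiag_amp[OF b]]])
       (simp only: blk_diff blk_amp[OF b] osc_ge)
  moreover have "amp n 1 (blk i c) \<in> M3 (Suc n)" using ldiag_amp[OF b] by (rule ldiag_M3)
  moreover have "iota n (blk i c) = iota (Suc n) (amp n 1 (blk i c))"
    using iota_amp[OF b, of 1] by simp
  ultimately show ?thesis using assms by (simp add: iota_diff norm_iota)
qed

lemma gasket_L_eq:
  assumes "a \<in> gasket"
  shows "gasket_L a = (SUP n. ennreal (2 ^ n * osc n (rho n a)))"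
  unfolding gasket_L_def pi_rep_def
  by (rule SUP_cong[OF refl]) (rule hilb_opnorm_commutator[OF gblock_ldiag[OF rho_gblock[OF assms]]])

lemma gasket_L_le_iff:
  assumes "a \<in> gasket" "0 \<le> l"
  shows "gasket_L a \<le> ennreal l \<longleftrightarrow> (\<forall>n. 2 ^ n * osc n (rho n a) \<le> l)"
  unfolding gasket_L_eq[OF assms(1)] by (simp add: SUP_le_iff ennreal_le_iff assms(2))

lemma gasket_L_finiteE:
  assumes "a \<in> gasket" "gasket_L a < \<infinity>"
  obtains l where "0 \<le> l" "\<And>n. 2 ^ n * osc n (rho n a) \<le> l"
proof (cases "gasket_L a")
  case (real l)
  then show ?thesis using gasket_L_le_iff[OF assms(1), of l] that by simp
qed (use assms in simp)

lemma gasket_L_finiteI: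
  assumes "a \<in> gasket" "\<And>n. 2 ^ n * osc n (rho n a) \<le> l"
  shows "gasket_L a < \<infinity>"
proof -
  have "0 \<le> 2 ^ 0 * osc 0 (rho 0 a)" by simp
  also have "\<dots> \<le> l" by (rule assms(2))
  finally have "gasket_L a \<le> ennreal l" using assms gasket_L_le_iff by blast
  then show ?thesis using ennreal_less_top order_le_less_trans unfolding infinity_ennreal_def by blast
qed

lemma seminorm_gasket_L: "seminorm_on gasket gasket_L"
  unfolding seminorm_on_def
proof (intro conjI ballI allI)
  note sub = unital_cstar_subalgebra_gasket
  fix a assume a: "a \<in> gasket"
  show "gasket_L (c *\<^sub>C a) = ennreal (cmod c) * gasket_L a" for c
  proof -
    have "gasket_L (c *\<^sub>C a) = (SUP n. ennreal (2 ^ n * osc n (rho n (c *\<^sub>C a))))"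
      by (rule gasket_L_eq[OF cstar_sub_scaleC[OF sub a]])
    also have "\<dots> = (SUP n. ennreal (cmod c) * ennreal (2 ^ n * osc n (rho n a)))"
      by (simp add: rho_scaleC osc_scale ennreal_mult[symmetric] mult.left_commute)
    also have "\<dots> = ennreal (cmod c) * gasket_L a"
      unfolding gasket_L_eq[OF a] by (rule SUP_mult_left_ennreal[symmetric])
    finally show ?thesis .
  qed
  fix b assume b: "b \<in> gasket"
  show "gasket_L (a + b) \<le> gasket_L a + gasket_L b"
    unfolding gasket_L_eq[OF cstar_sub_add[OF sub a b]]
  proof (rule SUP_least)
    fix n
    have "ennreal (2 ^ n * osc n (rho n (a + b))) \<le> ennreal (2 ^ n * osc n (rho n a) + 2 ^ n * osc n (rho n b))"
      unfolding rho_add distrib_left[symmetric] by (intro ennreal_leI mult_left_mono osc_add) simp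
    also have "\<dots> = ennreal (2 ^ n * osc n (rho n a)) + ennreal (2 ^ n * osc n (rho n b))"
      by (rule ennreal_plus) simp_all
    also have "\<dots> \<le> gasket_L a + gasket_L b"
      unfolding gasket_L_eq[OF a] gasket_L_eq[OF b] by (intro add_mono SUP_upper) simp_all
    finally show "ennreal (2 ^ n * osc n (rho n (a + b))) \<le> gasket_L a + gasket_L b" .
  qed
qed

lemma gasket_L_star: "a \<in> gasket \<Longrightarrow> gasket_L (star a) = gasket_L a"
  using cstar_sub_star[OF unital_cstar_subalgebra_gasket] by (simp add: gasket_L_eq rho_star osc_adj)

lemma star_subalgebra_gasket_L_finite: "star_subalgebra {a \<in> gasket. gasket_L a < \<infinity>}"
proof -
  note sub = unital_cstar_subalgebra_gasket
  have L: "gasket_L (a + b) \<le> gasket_L a + gasket_L b" "gasket_L (c *\<^sub>C a) = ennreal (cmod c) * gasket_L a"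
    if "a \<in> gasket" "b \<in> gasket" for a b c
    using seminorm_gasket_L that unfolding seminorm_on_def by simp_all
  have zero: "gasket_L 0 < \<infinity>"
    using L(2)[OF cstar_sub_zero[OF sub] cstar_sub_zero[OF sub], of 0] norm_scaleC[of 0 "0 :: uhf"] by simp
  have add: "gasket_L (a + b) < \<infinity>" if "a \<in> gasket" "gasket_L a < \<infinity>" "b \<in> gasket" "gasket_L b < \<infinity>" for a b
    using L(1)[OF that(1,3)] that by (auto intro: order_le_less_trans)
  have scale: "gasket_L (c *\<^sub>C a) < \<infinity>" if "a \<in> gasket" "gasket_L a < \<infinity>" for a c
    using that by (simp add: L(2) ennreal_mult_less_top)
  have mult: "gasket_L (a * b) < \<infinity>"
    if a: "a \<in> gasket" "gasket_L a < \<infinity>" and b: "b \<in> gasket" "gasket_L b < \<infinity>" for a b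
  proof -
    obtain l where l: "0 \<le> l" "\<And>n. 2 ^ n * osc n (rho n a) \<le> l" using gasket_L_finiteE[OF a] by blast
    obtain k where k: "0 \<le> k" "\<And>n. 2 ^ n * osc n (rho n b) \<le> k" using gasket_L_finiteE[OF b] by blast
    show ?thesis
    proof (rule gasket_L_finiteI[OF cstar_sub_mult[OF sub a(1) b(1)]])
      fix n
      have "2 ^ n * osc n (rho n (a * b))
          \<le> 2 ^ n * (osc n (rho n a) * mnorm (Suc n) (rho n b) + mnorm (Suc n) (rho n a) * osc n (rho n b))"
        unfolding rho_mul[OF a(1) b(1)]
        by (intro mult_left_mono osc_mul gblock_ldiag rho_gblock a b) simp
      also have "\<dots> = (2 ^ n * osc n (rho n a)) * mnorm (Suc n) (rho n b)
          + mnorm (Suc n) (rho n a) * (2 ^ n * osc n (rho n b))"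
        by (simp add: algebra_simps)
      also have "\<dots> \<le> l * norm b + norm a * k"
        using l k by (intro add_mono mult_mono mnorm_rho) simp_all
      finally show "2 ^ n * osc n (rho n (a * b)) \<le> l * norm b + norm a * k" .
    qed
  qed
  show ?thesis
    unfolding star_subalgebra_def using zero add scale mult gasket_L_star sub
    by (auto simp: cstar_sub_zero cstar_sub_add cstar_sub_scaleC cstar_sub_mult cstar_sub_star)
qed

section \<open>Geometric approximation and the kernel of the seminorm\<close>

text \<open>The steps are normalised so that the tail after \<open>n\<close> sums to
  \<open>K / 2 ^ n\<close>; keeping the exact partial sum lets the induction close.\<close>

lemma geometric_steps:
  fixes x :: "nat \<Rightarrow> 'a::real_normed_vector"
  assumes "\<And>n. norm (x (Suc n) - x n) \<le> K / 2 ^ Suc n"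
  shows "norm (x (n + k) - x n) \<le> K / 2 ^ n - K / 2 ^ (n + k)"
proof (induction k)
  case (Suc k)
  have "norm (x (n + Suc k) - x n) \<le> norm (x (Suc (n + k)) - x (n + k)) + norm (x (n + k) - x n)"
    using norm_triangle_ineq[of "x (Suc (n + k)) - x (n + k)" "x (n + k) - x n"] by simp
  also have "\<dots> \<le> K / 2 ^ Suc (n + k) + (K / 2 ^ n - K / 2 ^ (n + k))"
    by (intro add_mono assms Suc.IH)
  also have "\<dots> = K / 2 ^ n - K / 2 ^ (n + Suc k)" by (simp add: field_simps)
  finally show ?case .
qed simp

lemma
  fixes x :: "nat \<Rightarrow> 'a::real_normed_vector"
  assumes x: "\<And>n. norm (x (Suc n) - x n) \<le> K / 2 ^ Suc n"
  shows geometric_steps_limit: "x \<longlonglongrightarrow> a \<Longrightarrow> norm (a - x n) \<le> K / 2 ^ n"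
    and geometric_steps_Cauchy: "Cauchy x"
proof -
  have K: "0 \<le> K" using order_trans[OF norm_ge_zero x[of 0]] by simp
  have le: "norm (x (n + k) - x n) \<le> K / 2 ^ n" for n k
    using geometric_steps[of x K n k, OF x] K by (simp add: order_trans)
  show "norm (a - x n) \<le> K / 2 ^ n" if "x \<longlonglongrightarrow> a"
  proof (rule Lim_bounded)
    show "(\<lambda>m. norm (x m - x n)) \<longlonglongrightarrow> norm (a - x n)" by (intro tendsto_intros that)
    show "\<forall>m\<ge>n. norm (x m - x n) \<le> K / 2 ^ n" using le by (metis le_iff_add)
  qed
  show "Cauchy x"
    unfolding Cauchy_altdef2
  proof (intro allI impI)
    fix e :: real assume "e > 0"
    have "(\<lambda>n. K * (1/2) ^ n) \<longlonglongrightarrow> K * 0" by (intro tendsto_mult_left LIMSEQ_power_zero) simp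
    then have "(\<lambda>n. K / 2 ^ n) \<longlonglongrightarrow> 0" by (simp add: power_divide)
    from LIMSEQ_D[OF this \<open>e > 0\<close>] obtain N where "K / 2 ^ N < e" using K by auto
    then show "\<exists>N. \<forall>n\<ge>N. dist (x n) (x N) < e"
      using le[of N] by (intro exI[of _ N]) (auto simp: dist_norm le_iff_add intro: order_le_less_trans)
  qed
qed

text \<open>Using \<open>blk 2 (rho n a)\<close>, which lies in \<open>M3 n\<close>, includes level
  0, where the approximant is a scalar. So one estimate serves compactness for large
  \<open>n\<close> and the radius for \<open>n = 0\<close>. The factor 2 arises by writing the step
  bound \<open>l / 2 ^ n\<close> as \<open>2 * l / 2 ^ Suc n\<close>.\<close>

lemma gasket_L_approx:
  assumes a: "a \<in> gasket" and l: "0 \<le> l" "gasket_L a \<le> ennreal l"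
  shows "norm (a - iota n (blk 2 (rho n a))) \<le> 2 * l / 2 ^ n"
proof (rule geometric_steps_limit[of "\<lambda>n. iota n (blk 2 (rho n a))"])
  fix n
  have "norm (iota (Suc n) (rho n a) - iota n (blk 2 (rho n a))) \<le> osc n (rho n a)"
    by (rule norm_iota_blk_diff[OF gblock_ldiag[OF rho_gblock[OF a]]])
  also have "\<dots> \<le> 2 * l / 2 ^ Suc n"
    using gasket_L_le_iff[OF a l(1)] l(2) by (simp add: pos_le_divide_eq mult.commute)
  finally show "norm (iota (Suc n) (blk 2 (rho (Suc n) a)) - iota n (blk 2 (rho n a))) \<le> 2 * l / 2 ^ Suc n"
    unfolding blk_2_rho .
next
  show "(\<lambda>n. iota n (blk 2 (rho n a))) \<longlonglongrightarrow> a"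
    by (rule LIMSEQ_imp_Suc) (unfold blk_2_rho, rule iota_rho_tendsto[OF a])
qed

lemma iota_0: "x \<in> M3 0 \<Longrightarrow> iota 0 x = x [] [] *\<^sub>C 1"
proof -
  assume x: "x \<in> M3 0"
  have "x = mscale (x [] []) (mone 0)"
    by (rule M_eqI[OF x M_scale[OF M_one]]) (simp add: words_def mscale_def mone_def)
  then have "iota 0 x = iota 0 (mscale (x [] []) (mone 0))" by simp
  then show ?thesis by (simp add: iota_scale iota_one)
qed

lemma gasket_L_radius:
  assumes "a \<in> gasket" "0 \<le> l" "gasket_L a \<le> ennreal l"
  shows "\<exists>c. norm (a - c *\<^sub>C 1) \<le> 2 * l"
  using gasket_L_approx[OF assms, of 0] iota_0[of "blk 2 (rho 0 a)"] by auto

lemma gasket_L_kernel: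
  assumes "a \<in> gasket"
  shows "gasket_L a = 0 \<longleftrightarrow> (\<exists>c. a = c *\<^sub>C 1)"
proof
  assume "gasket_L a = 0"
  \<comment> \<open>With \<open>l = 0\<close> the radius estimate leaves distance 0 to a
    scalar.\<close>
  then show "\<exists>c. a = c *\<^sub>C 1" using gasket_L_radius[OF assms, of 0] by simp
next
  assume "\<exists>c. a = c *\<^sub>C 1"
  then obtain c where c: "a = c *\<^sub>C 1" by blast
  have "osc n (rho n a) = 0" for n
  proof -
    have "osc n (mone (Suc n)) \<le> 0" by (rule osc_le) (simp only: blk_one diff_self mnorm_0)
    then show ?thesis unfolding c rho_scaleC rho_one osc_scale using osc_nonneg[of n "mone (Suc n)"] by simp
  qed
  then show "gasket_L a = 0" by (simp add: gasket_L_eq[OF assms])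
qed

section \<open>Compactness of the Lipschitz ball\<close>

lemma bounded_linear_scaleC_left: "bounded_linear (\<lambda>c. c *\<^sub>C (y :: 'a::unital_cstar_algebra))"
  by (rule bounded_linear_intro[of _ "norm y"])
     (simp_all add: scaleC_add_left scaleR_scaleC scaleC_scaleC norm_scaleC scaleR_conv_of_real)

definition supported :: "(3 list \<times> 3 list) set \<Rightarrow> cmat set" where
  "supported P = {x. \<forall>v w. (v, w) \<notin> P \<longrightarrow> x v w = 0}"

text \<open>Induction on the matrix positions: each one adds a continuous image of the closed unit
  disc, and sums of compact sets are compact. All topology then takes place in \<open>uhf\<close>,
  none on \<open>cmat\<close>.\<close>

lemma iota_supported_compact:
  assumes "finite P" "P \<subseteq> words n \<times> words n"
  shows "\<exists>K. compact K \<and> (\<forall>x\<in>supported P. (\<forall>v w. cmod (x v w) \<le> 1) \<longrightarrow> iota n x \<in> K)"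
  using assms
proof (induction P rule: finite_induct)
  case empty
  have "x = 0" if "x \<in> supported {}" for x
  proof (intro ext)
    show "x v w = 0 v w" for v w using that by (simp add: supported_def)
  qed
  then have "\<forall>x\<in>supported {}. (\<forall>v w. cmod (x v w) \<le> 1) \<longrightarrow> iota n x \<in> {iota n 0}"
    by blast
  moreover have "compact {iota n 0}" by (rule compact_insert[OF compact_empty])
  ultimately show ?case by blast
next
  case (insert p P)
  obtain p1 p2 where p: "p = (p1, p2)" by (cases p)
  define E :: cmat where "E = (\<lambda>v w. if v = p1 \<and> w = p2 then 1 else 0)"
  have E: "E \<in> M3 n" using insert.prems by (intro M_I) (auto simp: E_def p)
  have "P \<subseteq> words n \<times> words n" using insert.prems by simp
  then obtain K where K: "compact K"
    "\<And>x. x \<in> supported P \<Longrightarrow> \<forall>v w. cmod (x v w) \<le> 1 \<Longrightarrow> iota n x \<in> K"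
    using insert.IH by blast
  let ?C = "(\<lambda>c. c *\<^sub>C iota n E) ` cball 0 1"
  have "compact ?C"
    by (intro compact_continuous_image bounded_linear.continuous_on[OF bounded_linear_scaleC_left]
        continuous_on_id compact_cball)
  then have C: "compact {x + y |x y. x \<in> K \<and> y \<in> ?C}" by (rule compact_sums[OF K(1)])
  have sub: "iota n x \<in> {x + y |x y. x \<in> K \<and> y \<in> ?C}"
    if x: "x \<in> supported (insert p P)" "\<forall>v w. cmod (x v w) \<le> 1" for x
  proof -
    define x' :: cmat where "x' = (\<lambda>v w. if v = p1 \<and> w = p2 then 0 else x v w)"
    have x'P: "x' \<in> supported P" using x(1) by (auto simp: x'_def p supported_def)
    have x'1: "\<forall>v w. cmod (x' v w) \<le> 1" using x(2) by (simp add: x'_def)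
    have x'M: "x' \<in> M3 n" using x'P insert.prems by (intro M_I) (auto simp: supported_def)
    have "x = x' + mscale (x p1 p2) E"
      by (intro ext) (simp add: x'_def E_def mscale_def)
    then have "iota n x = iota n (x' + mscale (x p1 p2) E)" by (rule arg_cong)
    also have "\<dots> = iota n x' + x p1 p2 *\<^sub>C iota n E"
      by (simp only: iota_add[OF x'M M_scale[OF E]] iota_scale[OF E])
    finally have "iota n x = iota n x' + x p1 p2 *\<^sub>C iota n E" .
    moreover have "iota n x' \<in> K" by (rule K(2)[OF x'P x'1])
    moreover have "x p1 p2 *\<^sub>C iota n E \<in> ?C" using x(2) by (intro imageI) simp
    ultimately show ?thesis by blast
  qed
  show ?case by (rule exI, rule conjI[OF C]) (use sub in blast)
qed

text \<open>Each third of \<open>e\<close> pays for one move: from the closure into the set, from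
  there to level \<open>n\<close>, and from level \<open>n\<close> to a finite net of a compact set.
  The level depends on \<open>e\<close> alone because the geometric rate is uniform on the
  ball.\<close>

lemma compact_gasket_L_ball: "compact (closure {a \<in> gasket. norm a \<le> 1 \<and> gasket_L a \<le> 1})"
  (is "compact (closure ?S)")
  unfolding compact_eq_totally_bounded
proof (intro conjI allI impI)
  show "complete (closure ?S)" by (simp add: complete_eq_closed)
  fix e :: real assume e: "e > 0"
  have "(\<lambda>n. 2 * (1/2) ^ n :: real) \<longlonglongrightarrow> 2 * 0" by (intro tendsto_mult_left LIMSEQ_power_zero) simp
  then have lim: "(\<lambda>n. 2 / 2 ^ n :: real) \<longlonglongrightarrow> 0" by (simp add: power_divide)
  have "e / 3 > 0" using e by simp
  from LIMSEQ_D[OF lim this] obtain n where "norm (2 / 2 ^ n - 0 :: real) < e / 3" by blast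
  then have n: "2 / 2 ^ n < e / 3" by simp
  have "finite (words n \<times> words n)" by simp
  from iota_supported_compact[OF this order_refl] obtain K where K: "compact K"
    "\<forall>x\<in>supported (words n \<times> words n). (\<forall>v w. cmod (x v w) \<le> 1) \<longrightarrow> iota n x \<in> K"
    by (elim exE conjE)
  from K(1) \<open>e / 3 > 0\<close> have "\<exists>k. finite k \<and> K \<subseteq> (\<Union>x\<in>k. ball x (e / 3))"
    unfolding compact_eq_totally_bounded by simp
  then obtain k where k: "finite k" "K \<subseteq> (\<Union>x\<in>k. ball x (e / 3))" by (elim exE conjE)
  have "closure ?S \<subseteq> (\<Union>x\<in>k. ball x e)"
  proof
    fix b assume "b \<in> closure ?S"
    then have "\<exists>a\<in>?S. dist a b < e / 3" using \<open>e / 3 > 0\<close> by (simp only: closure_approachable)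
    then obtain a where a: "a \<in> gasket" "norm a \<le> 1" "gasket_L a \<le> 1" "dist a b < e / 3" by blast
    let ?x = "blk 2 (rho n a)"
    have "mnorm n ?x \<le> 1" using mnorm_blk[of n 2 "rho n a"] mnorm_rho[of n a] a(2) by linarith
    have M: "?x \<in> M3 n" by (rule blk_M3[OF rho_M3])
    have "?x \<in> supported (words n \<times> words n)"
      using M_outside[OF M] by (simp add: supported_def)
    moreover have "cmod (?x v w) \<le> 1" for v w
    proof (cases "v \<in> words n \<and> w \<in> words n")
      case True
      then show ?thesis using mnorm_entry[of v n w ?x] \<open>mnorm n ?x \<le> 1\<close> by linarith
    next
      case False
      then show ?thesis using M_outside[OF M, of v w] by simp
    qed
    ultimately have "iota n ?x \<in> K" using K(2) by (simp only: simp_thms)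
    then have "iota n ?x \<in> (\<Union>x\<in>k. ball x (e / 3))" using k(2) by (rule subsetD[rotated])
    then obtain y where y: "y \<in> k" "dist y (iota n ?x) < e / 3" by (elim UN_E) (simp only: mem_ball)
    have "dist a (iota n ?x) \<le> 2 / 2 ^ n"
      using gasket_L_approx[OF a(1), of 1 n] a(3) by (simp add: dist_norm)
    then have "dist y b < e"
      using y(2) a(4) n dist_triangle[of y b a] dist_triangle[of y a "iota n ?x"] dist_commute[of a "iota n ?x"]
      by linarith
    then show "b \<in> (\<Union>x\<in>k. ball x e)" using y(1) by (intro UN_I) (simp_all only: mem_ball)
  qed
  with k(1) show "\<exists>k. finite k \<and> closure ?S \<subseteq> (\<Union>x\<in>k. ball x e)" by (intro exI conjI)
qed

section \<open>Density of the Lipschitz elements\<close>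

text \<open>\<open>glue\<close> uses \<open>m j\<close> where subtriangles \<open>j\<close> and
  \<open>j + 2\<close> meet, hence the mean of the old values at \<open>j\<close> and
  \<open>j + 2\<close>.\<close>

definition gasket_ext :: "nat \<Rightarrow> cmat \<Rightarrow> cmat" where
  "gasket_ext n c = glue n c (\<lambda>j. mscale (1/2) (blk j c + blk (j + 2) c))"

text \<open>Place \<open>j\<close> of every block of the extension is a mean of
  \<open>blk j c\<close> and some old block, with \<open>p = j\<close> for block 2. In the
  difference of two blocks the common \<open>blk j c\<close> cancels, and half of a difference of
  old blocks remains.\<close>

lemma
  assumes "c \<in> gblock n"
  shows gasket_ext_gblock: "gasket_ext n c \<in> gblock (Suc n)"
    and blk_2_gasket_ext: "blk 2 (gasket_ext n c) = c"
    and osc_gasket_ext: "osc (Suc n) (gasket_ext n c) \<le> osc n c / 2"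
proof -
  note d = gblock_ldiag[OF assms]
  have m: "mscale (1/2) (blk j c + blk (j + 2) c) \<in> M3 n" for j
    using d by simp
  show e: "gasket_ext n c \<in> gblock (Suc n)" unfolding gasket_ext_def by (rule glue_gblock[OF assms m])
  show 2: "blk 2 (gasket_ext n c) = c" unfolding gasket_ext_def by (rule blk_2_glue[OF d m])
  have ld: "blk i (gasket_ext n c) \<in> ldiag n" for i
    using e d 2 exhaust_3[of i] by auto
  have b: "blk j (blk 1 (gasket_ext n c)) = mscale (1/2) (blk j c + blk (j + 2) c)"
    "blk j (blk 3 (gasket_ext n c)) = mscale (1/2) (blk (j + 1) c + blk j c)" for j
    unfolding gasket_ext_def blk_blk_glue[OF d m] three_cycle by (rule refl)+
  have half: "x = mscale (1/2) (x + x)" for x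
    by (simp add: mscale_def fun_eq_iff)
  have mean: "\<exists>p. blk j (blk i (gasket_ext n c)) = mscale (1/2) (blk p c + blk j c)" for i j
  proof -
    consider "i = 1" | "i = 2" | "i = 3" using exhaust_3[of i] by blast
    then show ?thesis
    proof cases
      case 1
      then show ?thesis using b(1)[of j] by (auto simp: add.commute)
    next
      case 2
      show ?thesis unfolding \<open>i = 2\<close> \<open>blk 2 (gasket_ext n c) = c\<close> by (rule exI[of _ j], rule half)
    next
      case 3
      then show ?thesis using b(2)[of j] by auto
    qed
  qed
  show "osc (Suc n) (gasket_ext n c) \<le> osc n c / 2"
  proof (rule osc_le, rule mnorm_ldiag[OF ldiag_diff[OF ld ld]])
    fix i k j
    obtain p q where "blk j (blk i (gasket_ext n c)) = mscale (1/2) (blk p c + blk j c)"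
      "blk j (blk k (gasket_ext n c)) = mscale (1/2) (blk q c + blk j c)" using mean by blast
    then have "blk j (blk i (gasket_ext n c) - blk k (gasket_ext n c)) = mscale (1/2) (blk p c - blk q c)"
      by (simp only: blk_diff mscale_simps(2)[symmetric] add_diff_cancel_right)
    then have "mnorm n (blk j (blk i (gasket_ext n c) - blk k (gasket_ext n c))) = mnorm n (blk p c - blk q c) / 2"
      by (simp add: mnorm_scale)
    also have "\<dots> \<le> osc n c / 2" by (intro divide_right_mono osc_ge) simp
    finally show "mnorm n (blk j (blk i (gasket_ext n c) - blk k (gasket_ext n c))) \<le> osc n c / 2" .
  qed
qed


lemma slice_tower:
  assumes "\<And>k. e k \<in> gblock (n + k)" "\<And>k. blk 2 (e (Suc k)) = e k" "k \<le> j"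
  shows "slice (n + k) (Suc (n + j)) (e j) = e k"
  using assms(3)
proof (induction j rule: dec_induct)
  case base
  show ?case using assms(1) by (simp add: slice_same)
next
  case (step j)
  then show ?case using slice_blk_2[of "n + k" "n + j" "e (Suc j)"] assms(2) by simp
qed

text \<open>By coherence the slice at level \<open>n + k\<close> of every later stage is already
  \<open>e k\<close>, so the limit has exactly this slice.\<close>

lemma gasket_tower_limit:
  assumes e: "\<And>k. e k \<in> gblock (n + k)" "\<And>k. blk 2 (e (Suc k)) = e k"
    and lim: "(\<lambda>k. iota (Suc (n + k)) (e k)) \<longlonglongrightarrow> b"
  shows "b \<in> gasket" and "rho (n + k) b = e k"
proof -
  show "b \<in> gasket"
  proof (rule gasketI)
    \<comment> \<open>Levels below \<open>n\<close> are filled with 0, which does not affect the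
      limit.\<close>
    let ?s = "\<lambda>m. if m < n then 0 else e (m - n)"
    show "?s m \<in> gblock m" for m
      using e(1)[of "m - n"] gblock_zero[of m] by (cases "m < n") simp_all
    show "(\<lambda>m. iota (Suc m) (?s m)) \<longlonglongrightarrow> b"
      by (rule LIMSEQ_offset[of _ n]) (use lim in \<open>simp add: add.commute\<close>)
  qed
  show "rho (n + k) b = e k"
  proof (intro ext)
    fix v w
    have "rho (n + k) (iota (Suc (n + j)) (e j)) = e k" if "k \<le> j" for j
      using rho_iota_gblock[OF e(1)[of j], of "n + k"] slice_tower[of e n, OF e that] that by simp
    then have "(\<lambda>j. rho (n + k) (iota (Suc (n + j)) (e j)) v w) \<longlonglongrightarrow> e k v w"
      by (intro tendsto_eventually eventually_sequentiallyI[of k]) simp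
    then show "rho (n + k) b v w = e k v w"
      using rho_tendsto[OF lim] by (rule LIMSEQ_unique[rotated])
  qed
qed

text \<open>Iterating \<open>gasket_ext\<close> keeps \<open>2 ^ n * osc n\<close> bounded, since each step halves the oscillation.\<close>

lemma lipschitz_lift:
  assumes c: "c \<in> gblock n"
  shows "\<exists>b\<in>gasket. gasket_L b < \<infinity> \<and> norm (b - iota (Suc n) c) \<le> osc n c"
proof -
  define e where "e = rec_nat c (\<lambda>k. gasket_ext (n + k))"
  have e_simps: "e 0 = c" "e (Suc k) = gasket_ext (n + k) (e k)" for k
    by (simp_all add: e_def)
  have e: "e k \<in> gblock (n + k)" for k
    by (induction k) (simp_all add: e_simps c gasket_ext_gblock del: gblock.simps)
  have e2: "blk 2 (e (Suc k)) = e k" for k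
    unfolding e_simps by (rule blk_2_gasket_ext[OF e])
  have osc_e: "osc (n + k) (e k) \<le> osc n c / 2 ^ k" for k
  proof (induction k)
    case (Suc k)
    have "osc (Suc (n + k)) (gasket_ext (n + k) (e k)) \<le> osc (n + k) (e k) / 2" by (rule osc_gasket_ext[OF e])
    then show ?case using Suc by (simp add: e_simps)
  qed (simp add: e_simps)
  let ?x = "\<lambda>k. iota (Suc (n + k)) (e k)"
  have steps: "norm (?x (Suc k) - ?x k) \<le> osc n c / 2 ^ Suc k" for k
  proof -
    have "norm (iota (Suc (n + Suc k)) (e (Suc k)) - iota (n + Suc k) (blk 2 (e (Suc k)))) \<le> osc (n + Suc k) (e (Suc k))"
      by (rule norm_iota_blk_diff[OF gblock_ldiag[OF e]])
    also have "\<dots> \<le> osc n c / 2 ^ Suc k" by (rule osc_e)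
    finally show ?thesis unfolding e2 by (simp only: add_Suc_right)
  qed
  have "Cauchy ?x" by (rule geometric_steps_Cauchy[of ?x, OF steps])
  then obtain b where lim: "?x \<longlonglongrightarrow> b" using Cauchy_convergent convergent_def by blast
  note b = gasket_tower_limit[of e n, OF e e2 lim]
  have "norm (b - iota (Suc n) c) \<le> osc n c"
    using geometric_steps_limit[of ?x, OF steps lim, of 0] by (simp add: e_simps)
  moreover have "gasket_L b < \<infinity>"
  proof (rule gasket_L_finiteI[OF b(1)])
    fix m
    show "2 ^ m * osc m (rho m b) \<le> 2 ^ n * (osc n c + 2 * norm b)"
    \<comment> \<open>The construction controls the levels above \<open>n\<close>; the finitely many
      others satisfy the crude bound by twice the norm.\<close>
    proof (cases "m \<le> n")
      case True
      have "osc m (rho m b) \<le> 2 * norm b"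
        using osc_le_norm[of m "rho m b"] mnorm_rho[of m b] by linarith
      also have "\<dots> \<le> osc n c + 2 * norm b" by simp
      finally show ?thesis using True by (intro mult_mono) simp_all
    next
      case False
      then obtain k where m: "m = n + k" using le_Suc_ex nat_le_linear by blast
      have "2 ^ m * osc m (rho m b) \<le> 2 ^ m * (osc n c / 2 ^ k)"
        unfolding m b(2) by (intro mult_left_mono osc_e) simp
      also have "\<dots> = 2 ^ n * osc n c" by (simp add: m power_add)
      also have "\<dots> \<le> 2 ^ n * (osc n c + 2 * norm b)" by (intro mult_left_mono) simp_all
      finally show ?thesis .
    qed
  qed
  ultimately show ?thesis using b(1) by blast
qed

text \<open>Two consecutive slices within \<open>e / 8\<close> of \<open>a\<close> are within
  \<open>e / 4\<close> of each other, so the later one has oscillation below \<open>e / 2\<close>.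
  Its Lipschitz lift is then within \<open>e / 2 + e / 8\<close> of \<open>a\<close>.\<close>

lemma gasket_L_finite_dense: "gasket \<subseteq> closure {a \<in> gasket. gasket_L a < \<infinity>}"
proof
  fix a assume a: "a \<in> gasket"
  show "a \<in> closure {a \<in> gasket. gasket_L a < \<infinity>}"
    unfolding closure_approachable
  proof (intro allI impI)
    fix e :: real assume "e > 0"
    then have "e / 8 > 0" by simp
    then obtain N where N: "\<And>n. N \<le> n \<Longrightarrow> norm (iota (Suc n) (rho n a) - a) < e / 8"
      using LIMSEQ_D[OF iota_rho_tendsto[OF a]] by blast
    let ?c = "rho (Suc N) a" and ?d = "amp (Suc N) 1 (rho N a)"
    have d: "?d \<in> M3 (Suc (Suc N))" by (rule ldiag_M3[OF ldiag_amp[OF rho_M3]])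
    have "iota (Suc (Suc N)) ?c - iota (Suc N) (rho N a) = iota (Suc (Suc N)) (?c - ?d)"
      using iota_amp[OF rho_M3, of N 1 a] iota_diff[OF rho_M3 d] by simp
    then have "mnorm (Suc (Suc N)) (?c - ?d) = norm (iota (Suc (Suc N)) ?c - iota (Suc N) (rho N a))"
      by (simp only: norm_iota[OF M_diff[OF rho_M3 d]])
    also have "\<dots> < e / 4"
      using N[of "Suc N"] N[of N]
        norm_triangle_ineq4[of "iota (Suc (Suc N)) ?c - a" "iota (Suc N) (rho N a) - a"] by simp
    finally have "osc (Suc N) ?c < e / 2"
      using osc_le_dist_amp[OF rho_M3, of N ?c a] by linarith
    moreover obtain b where b: "b \<in> gasket" "gasket_L b < \<infinity>"
        "norm (b - iota (Suc (Suc N)) ?c) \<le> osc (Suc N) ?c"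
      using lipschitz_lift[OF rho_gblock[OF a]] by blast
    ultimately have "dist b a < e"
      using N[of "Suc N"] \<open>e > 0\<close> dist_triangle[of b a "iota (Suc (Suc N)) ?c"] by (simp add: dist_norm)
    then show "\<exists>b\<in>{a \<in> gasket. gasket_L a < \<infinity>}. dist b a < e" using b by blast
  qed
qed

theorem proposition5p2:
  shows "lip_norm gasket gasket_L \<and> quantum_metric_space gasket gasket_L \<and>
    star_subalgebra {a \<in> gasket. gasket_L a < \<infinity>} \<and>
    gasket \<subseteq> closure {a \<in> gasket. gasket_L a < \<infinity>} \<and>
    compact (closure {a \<in> gasket. norm a \<le> 1 \<and> gasket_L a \<le> 1})"
proof -
  have "lip_norm gasket gasket_L"
  proof (rule rieffel_criterion[OF unital_cstar_subalgebra_gasket seminorm_gasket_L])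
    show "gasket_L (star a) = gasket_L a" if "a \<in> gasket" for a using that by (rule gasket_L_star)
    show "gasket \<subseteq> closure {a \<in> gasket. gasket_L a < \<infinity>}" by (rule gasket_L_finite_dense)
    show "\<forall>a\<in>gasket. gasket_L a = 0 \<longleftrightarrow> (\<exists>c. a = c *\<^sub>C 1)" using gasket_L_kernel by blast
    show "\<exists>c. norm (a - c *\<^sub>C 1) \<le> 2" if "a \<in> gasket" "gasket_L a \<le> 1" for a
      using gasket_L_radius[of a 1] that by simp
    show "compact (closure {a \<in> gasket. norm a \<le> 1 \<and> gasket_L a \<le> 1})" by (rule compact_gasket_L_ball)
  qed
  then show ?thesis
    using unital_cstar_subalgebra_gasket star_subalgebra_gasket_L_finite gasket_L_finite_dense
      compact_gasket_L_ball
    by (simp add: quantum_metric_space_def)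
qed

end
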